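(* Let $K$ be an algebraically closed field of characteristic $0$ and let $(0)\neq I\subset K[x_1,\ldots,x_n]$ be a graded ideal with $\dim I=m>0$. Then for every relatively open cone $\mathring{C}$ of $\operatorname{gT}(I)$ there exists a relatively open cone $\mathring{D}$ of $\mathcal{W}_n^m$ such that $\mathring{C}\subset\mathring{D}$.
   Context: $\dim I$ is the Krull dimension of $K[x_1,\ldots,x_n]/I$; $\mathring{C}$ denotes the relative interior of a (closed) cone $C$. For $\omega\in\mathbb{R}^n$ the $\omega$-weight of a term $cx^\nu$ is $\omega\cdot\nu$; $\operatorname{in}_\omega(f)$ is the sum of the terms of $f$ of minimal $\omega$-weight; $\operatorname{in}_\omega(I)=(\operatorname{in}_\omega(f):f\in I)$. The Gröbner fan $\operatorname{GF}(I)$ is the complete fan in $\mathbb{R}^n$ in which $\omega,\omega'$ lie in the same relatively open cone iff $\operatorname{in}_\omega(I)=\operatorname{in}_{\omega'}(I)$. The tropical variety $T(I)=\{\omega\in\mathbb{R}^n:\operatorname{in}_\omega(I)\text{ contains no monomial}\}$ is a subfan of $\operatorname{GF}(I)$ with the induced fan structure. A matrix $g\in\operatorname{GL}_n(K)$ acts by $x_i\mapsto\sum_j g_{ji}x_j$. It is known that if $\dim I>0$ there is a nonempty Zariski-open $U\subset\operatorname{GL}_n(K)$ such that $T(g(I))$ is the same fan for all $g\in U$; this fan is the generic tropical variety $\operatorname{gT}(I)$. $\mathcal{W}_n$ is the complete fan in $\mathbb{R}^n$ with cones $C_A=\{\omega\in\mathbb{R}^n:\omega_i=\min_k\omega_k\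 \forall i\in A\}$, $\emptyset\neq A\subset\{1,\ldots,n\}$ ($\dim C_A=n-|A|+1$); $\mathcal{W}_n^m$ is the fan of all its cones of dimension at most $m$. It is known from earlier work that $|\operatorname{gT}(I)|=|\mathcal{W}_n^m|$ as sets. *)

theory Defs
  imports
    "HOL-Analysis.Analysis"
    "HOL-Algebra.Algebraic_Closure_Type"
    "HOL-Algebra.QuotRing"
    "HOL-Library.Poly_Mapping"
    "HOL-Library.Extended_Nat"
begin

unbundle no fps_syntax

section \<open>Polynomial rings and their ideals\<close>

text \<open>
  The polynomial ring \<open>K[x\<^sub>1,\<dots>,x\<^sub>n]\<close> is the type of finitely supported functions from
  exponent vectors to \<open>K\<close>, with convolution as multiplication. The variables are indexed by a
  type \<open>'n\<close>, so that \<open>n = CARD('n)\<close> when \<open>'n\<close> is finite.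
\<close>

type_synonym ('n, 'k) mpoly = "('n \<Rightarrow>\<^sub>0 nat) \<Rightarrow>\<^sub>0 'k"

abbreviation mpoly_ring :: "('n, 'k::comm_ring_1) mpoly ring"
  where "mpoly_ring \<equiv> ring_of_type_algebra"

definition mpoly_monom :: "('n \<Rightarrow>\<^sub>0 nat) \<Rightarrow> ('n, 'k::comm_ring_1) mpoly"
  where "mpoly_monom \<nu> = Poly_Mapping.single \<nu> 1"

definition mpoly_const :: "'k \<Rightarrow> ('n, 'k::comm_ring_1) mpoly"
  where "mpoly_const c = Poly_Mapping.single 0 c"

definition mpoly_var :: "'n \<Rightarrow> ('n, 'k::comm_ring_1) mpoly"
  where "mpoly_var i = mpoly_monom (Poly_Mapping.single i 1)"

definition mpoly_eval ::
    "('k::comm_ring_1 \<Rightarrow> 'r::comm_ring_1) \<Rightarrow> ('n \<Rightarrow> 'r) \<Rightarrow> ('n, 'k) mpoly \<Rightarrow> 'r"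
  where "mpoly_eval \<phi> \<sigma> f =
    (\<Sum>\<nu>\<in>Poly_Mapping.keys f. \<phi> (Poly_Mapping.lookup f \<nu>) *
       (\<Prod>i\<in>Poly_Mapping.keys \<nu>. \<sigma> i ^ Poly_Mapping.lookup \<nu> i))"

definition total_degree :: "('n \<Rightarrow>\<^sub>0 nat) \<Rightarrow> nat"
  where "total_degree \<nu> = (\<Sum>i\<in>Poly_Mapping.keys \<nu>. Poly_Mapping.lookup \<nu> i)"

definition restrict_terms ::
    "(('n \<Rightarrow>\<^sub>0 nat) \<Rightarrow> bool) \<Rightarrow> ('n, 'k::comm_ring_1) mpoly \<Rightarrow> ('n, 'k) mpoly"
  where "restrict_terms P f =
    (\<Sum>\<nu>\<in>{\<nu> \<in> Poly_Mapping.keys f. P \<nu>}. Poly_Mapping.single \<nu> (Poly_Mapping.lookup f \<nu>))"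

definition graded_ideal :: "('n, 'k::comm_ring_1) mpoly set \<Rightarrow> bool"
  where "graded_ideal I \<longleftrightarrow> ideal I mpoly_ring \<and>
    (\<forall>f\<in>I. \<forall>d. restrict_terms (\<lambda>\<nu>. total_degree \<nu> = d) f \<in> I)"

text \<open>
  The Krull dimension is the supremum of the lengths of chains of prime ideals. In \<^typ>\<open>enat\<close>
  the supremum of the empty set is \<open>0\<close>, so the zero ring gets dimension \<open>0\<close> here
  instead of the customary negative value.
\<close>

definition krull_dim :: "('a, 'b) ring_scheme \<Rightarrow> enat"
  where "krull_dim R =
    Sup {enat l | l. \<exists>P. (\<forall>i\<le>l. primeideal (P i) R) \<and> (\<forall>i<l. P i \<subset> P (Suc i))}"

definition ideal_dim :: "('n, 'k::comm_ring_1) mpoly set \<Rightarrow> enat"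
  where "ideal_dim I = krull_dim (mpoly_ring Quot I)"


section \<open>Initial ideals, Groebner fan and tropical variety\<close>

text \<open>
  A fan is given by the set of its closed cones; the relatively open cones of a fan are the
  relative interiors \<^const>\<open>rel_interior\<close> of its members.
\<close>

definition weight :: "real ^ 'n::finite \<Rightarrow> ('n \<Rightarrow>\<^sub>0 nat) \<Rightarrow> real"
  where "weight \<omega> \<nu> = (\<Sum>i\<in>UNIV. \<omega> $ i * real (Poly_Mapping.lookup \<nu> i))"

definition initial_form ::
    "real ^ 'n::finite \<Rightarrow> ('n, 'k::comm_ring_1) mpoly \<Rightarrow> ('n, 'k) mpoly"
  where "initial_form \<omega> f =
    restrict_terms (\<lambda>\<nu>. \<forall>\<mu>\<in>Poly_Mapping.keys f. weight \<omega> \<nu> \<le> weight \<omega> \<mu>) f"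

definition initial_ideal ::
    "real ^ 'n::finite \<Rightarrow> ('n, 'k::comm_ring_1) mpoly set \<Rightarrow> ('n, 'k) mpoly set"
  where "initial_ideal \<omega> I = genideal mpoly_ring (initial_form \<omega> ` I)"

text \<open>
  For a graded ideal, the classes of weight vectors with the same initial ideal are relatively
  open convex polyhedral cones; the closed cones of the Groebner fan are their closures.
\<close>

definition groebner_fan ::
    "('n::finite, 'k::comm_ring_1) mpoly set \<Rightarrow> (real ^ 'n) set set"
  where "groebner_fan I =
    {closure {\<omega>'. initial_ideal \<omega>' I = initial_ideal \<omega> I} | \<omega>. True}"

definition tropical_variety ::
    "('n::finite, 'k::comm_ring_1) mpoly set \<Rightarrow> (real ^ 'n) set"
  where "tropical_variety I = {\<omega>. \<forall>\<nu>. mpoly_monom \<nu> \<notin> initial_ideal \<omega> I}"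

definition tropical_fan ::
    "('n::finite, 'k::comm_ring_1) mpoly set \<Rightarrow> (real ^ 'n) set set"
  where "tropical_fan I = {C \<in> groebner_fan I. C \<subseteq> tropical_variety I}"


section \<open>Generic coordinates\<close>

definition GL_act ::
    "'k ^ 'n ^ 'n \<Rightarrow> ('n::finite, 'k::comm_ring_1) mpoly \<Rightarrow> ('n, 'k) mpoly"
  where "GL_act g =
    mpoly_eval mpoly_const (\<lambda>i. \<Sum>j\<in>UNIV. mpoly_const (g $ j $ i) * mpoly_var j)"

text \<open>
  The coordinate ring of \<open>GL\<^sub>n(K)\<close> is \<open>K[g\<^sub>i\<^sub>j, 1/det]\<close>. As \<open>det\<close> is a
  unit there, the Zariski-closed subsets are cut out by polynomials in the entries alone.
\<close>

definition zariski_open_GL :: "('k::field ^ 'n ^ 'n::finite) set \<Rightarrow> bool"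
  where "zariski_open_GL U \<longleftrightarrow>
    (\<exists>S :: ('n \<times> 'n, 'k) mpoly set.
       U = {g. invertible g \<and> (\<exists>p\<in>S. mpoly_eval id (\<lambda>(i, j). g $ i $ j) p \<noteq> 0)})"

text \<open>
  \<open>is_generic_tropical_variety I F\<close> says that \<open>F\<close> is the generic tropical variety of
  \<open>I\<close>. There is at most one such \<open>F\<close> over an infinite field, because any two nonempty
  Zariski-open subsets of \<open>GL\<^sub>n(K)\<close> then meet.
\<close>

definition is_generic_tropical_variety ::
    "('n::finite, 'k::field) mpoly set \<Rightarrow> (real ^ 'n) set set \<Rightarrow> bool"
  where "is_generic_tropical_variety I F \<longleftrightarrow>
    (\<exists>U. zariski_open_GL U \<and> U \<noteq> {} \<and> (\<forall>g\<in>U. tropical_fan (GL_act g ` I) = F))"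


section \<open>The fan \<open>W\<^sub>n\<close> and its skeleta\<close>

definition W_cone :: "'n set \<Rightarrow> (real ^ 'n::finite) set"
  where "W_cone A = {\<omega>. \<forall>i\<in>A. \<omega> $ i = (MIN k. \<omega> $ k)}"

definition W_fan :: "(real ^ 'n::finite) set set"
  where "W_fan = {W_cone A | A. A \<noteq> {}}"

definition W_skeleton :: "nat \<Rightarrow> (real ^ 'n::finite) set set"
  where "W_skeleton m = {D \<in> W_fan. dim D \<le> m}"

end

theory Submission
  imports Defs
begin

text \<open>
  Let \<open>C\<close> be a cone of the generic fan. The weights with a given initial ideal form a convex set,
  because initial ideals of a graded ideal share its Hilbert function; hence all weights in the
  relative interior of \<open>C\<close> define the same initial ideal of \<open>g(I)\<close>, for every \<open>g\<close> in the open set.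

  Let \<open>A\<close> be the set of minimal coordinates of such a weight \<open>\<omega>\<close>. If \<open>A\<close> had at most \<open>n - m\<close>
  elements, Noether normalisation in generic coordinates would give an element of \<open>g(I)\<close> whose initial
  form is a power of a variable. Since the fan is invariant under permutations of the variables, any
  second weight \<open>\<omega>'\<close> has to be constant on \<open>A\<close>: otherwise the gradings by the permutations of \<open>\<omega>'\<close>
  isolate a pure power in the initial ideal. Along a segment in the relative interior this forces \<open>A\<close>
  to be constant, so the relative interior of \<open>C\<close> lies in that of \<open>C\<^sub>A\<close>.
\<close>

no_notation fps_nth (infixl "$" 75)

section \<open>Polynomials\<close>

text \<open>Krull dimension speaks of chains of primes, genericity of relations between variables.
  The bridge is one inequality: \<open>r\<close> variables that are independent modulo an ideal
  yield \<open>r\<close> strict inclusions of primes above it. Hence any m + 1 variables satisfy a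
  relation in g(I). It is applied to one minimal variable and m non-minimal ones, which is the
  source of the bound n - m and matches dim C_A = n - |A| + 1. Genericity always enters in the same
  way. Membership in the open set and the presence of a pure power are nonvanishing conditions on
  polynomial functions of the matrix entries, and finitely many such functions, none identically
  zero, have a common nonzero point. There are finitely many permutations of the variables, so a
  single g can be chosen whose translates by all of them lie in the open set. Equality of the
  initial ideals at \<omega> and \<omega>' for every translate then becomes, for the one ideal J =
  g(I), equality at the permuted weights.\<close>

abbreviation keys :: "('a \<Rightarrow>\<^sub>0 'b::zero) \<Rightarrow> 'a set"
  where "keys \<equiv> Poly_Mapping.keys"

abbreviation lookup :: "('a \<Rightarrow>\<^sub>0 'b::zero) \<Rightarrow> 'a \<Rightarrow> 'b"
  where "lookup \<equiv> Poly_Mapping.lookup"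

abbreviation single :: "'a \<Rightarrow> 'b \<Rightarrow> ('a \<Rightarrow>\<^sub>0 'b::zero)"
  where "single \<equiv> Poly_Mapping.single"

section \<open>Terms of a polynomial and restriction to some of them\<close>

lemma poly_mapping_sum_single:
  "(\<Sum>\<nu>\<in>keys f. single \<nu> (lookup f \<nu>)) = (f :: 'a \<Rightarrow>\<^sub>0 'b::comm_monoid_add)"
  by (rule poly_mapping_eqI)
    (auto simp: lookup_sum lookup_single when_def not_in_keys_iff_lookup_eq_zero)

lemma poly_mapping_single_induct [case_names zero single add]:
  fixes f :: "'a \<Rightarrow>\<^sub>0 'b::comm_monoid_add"
  assumes "P 0" "\<And>\<nu> c. P (single \<nu> c)" "\<And>f g. P f \<Longrightarrow> P g \<Longrightarrow> P (f + g)"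
  shows "P f"
proof -
  have "P (\<Sum>\<nu>\<in>A. single \<nu> (lookup f \<nu>))" if "finite A" for A
    using that by induction (use assms in auto)
  from this[of "keys f"] show ?thesis by (simp add: poly_mapping_sum_single)
qed

lemma lookup_single_mult_add:
  fixes f :: "('a::cancel_comm_monoid_add) \<Rightarrow>\<^sub>0 ('b::comm_semiring_1)"
  shows "lookup (single \<mu> c * f) (\<mu> + \<nu>) = c * lookup f \<nu>"
  by (induction f rule: poly_mapping_single_induct)
    (auto simp: mult_single lookup_single when_def lookup_add distrib_left)

lemma keys_single_mult: "keys (single \<mu> c * f) \<subseteq> (+) \<mu> ` keys f"
  for f :: "('a::cancel_comm_monoid_add) \<Rightarrow>\<^sub>0 ('b::comm_semiring_1)"
  using keys_mult[of "single \<mu> c" f] by (auto split: if_splits)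

lemma lookup_restrict_terms:
  "lookup (restrict_terms P f) \<nu> = (if P \<nu> then lookup f \<nu> else 0)"
  unfolding restrict_terms_def
  by (auto simp: lookup_sum lookup_single when_def not_in_keys_iff_lookup_eq_zero)

lemma keys_restrict_terms: "keys (restrict_terms P f) = {\<nu> \<in> keys f. P \<nu>}"
  by (auto simp: in_keys_iff lookup_restrict_terms split: if_splits)

lemma restrict_terms_cong:
  "(\<And>\<nu>. \<nu> \<in> keys f \<Longrightarrow> P \<nu> = Q \<nu>) \<Longrightarrow> restrict_terms P f = restrict_terms Q f"
  by (rule poly_mapping_eqI) (auto simp: lookup_restrict_terms in_keys_iff)

lemma restrict_terms_id: "(\<And>\<nu>. \<nu> \<in> keys f \<Longrightarrow> P \<nu>) \<Longrightarrow> restrict_terms P f = f"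
  by (rule poly_mapping_eqI) (auto simp: lookup_restrict_terms in_keys_iff)

lemma restrict_terms_eq_0: "(\<And>\<nu>. \<nu> \<in> keys f \<Longrightarrow> \<not> P \<nu>) \<Longrightarrow> restrict_terms P f = 0"
  by (rule poly_mapping_eqI) (auto simp: lookup_restrict_terms in_keys_iff)

lemma restrict_terms_0 [simp]: "restrict_terms P 0 = 0"
  by (rule poly_mapping_eqI) (auto simp: lookup_restrict_terms)

lemma restrict_terms_add: "restrict_terms P (f + g) = restrict_terms P f + restrict_terms P g"
  by (rule poly_mapping_eqI) (auto simp: lookup_restrict_terms lookup_add)

lemma restrict_terms_diff: "restrict_terms P (f - g) = restrict_terms P f - restrict_terms P g"
  by (rule poly_mapping_eqI) (auto simp: lookup_restrict_terms lookup_minus)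

lemma restrict_terms_sum: "restrict_terms P (sum f A) = (\<Sum>x\<in>A. restrict_terms P (f x))"
  by (induction A rule: infinite_finite_induct) (auto simp: restrict_terms_add)

lemma restrict_terms_restrict_terms:
  "restrict_terms P (restrict_terms Q f) = restrict_terms (\<lambda>\<nu>. P \<nu> \<and> Q \<nu>) f"
  by (rule poly_mapping_eqI) (auto simp: lookup_restrict_terms)

lemma restrict_terms_single: "restrict_terms P (single \<nu> c) = (if P \<nu> then single \<nu> c else 0)"
  by (rule poly_mapping_eqI) (auto simp: lookup_restrict_terms lookup_single when_def)

lemma restrict_terms_single_mult:
  "restrict_terms P (single \<mu> c * f) = single \<mu> c * restrict_terms (\<lambda>\<nu>. P (\<mu> + \<nu>)) f"
  by (induction f rule: poly_mapping_single_induct)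
    (auto simp: restrict_terms_add distrib_left mult_single restrict_terms_single)

text \<open>Splits a polynomial along an arbitrary grading \<open>g\<close>. It serves for the
  exponent of one variable, the degree, the pair of weight and degree, and a triple with two
  weights.\<close>

lemma sum_restrict_terms:
  assumes "finite A" "\<And>\<nu>. \<nu> \<in> keys f \<Longrightarrow> g \<nu> \<in> A"
  shows "(\<Sum>a\<in>A. restrict_terms (\<lambda>\<nu>. g \<nu> = a) f) = f"
  using assms by (intro poly_mapping_eqI)
    (auto simp: lookup_sum lookup_restrict_terms in_keys_iff)

text \<open>The polynomial ring K[M] as a subset of the full ring, so that sets of variables can
  vary without a change of type.\<close>

definition polys_in :: "'n set \<Rightarrow> ('n, 'k::comm_ring_1) mpoly set"
  where "polys_in M = {f. \<forall>\<nu>\<in>keys f. keys \<nu> \<subseteq> M}"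

lemma keys_add_nat: "keys (\<mu> + \<nu>) = keys \<mu> \<union> keys (\<nu> :: 'n \<Rightarrow>\<^sub>0 nat)"
  by (auto simp: in_keys_iff lookup_add)

lemma polys_in_mono: "M \<subseteq> N \<Longrightarrow> polys_in M \<subseteq> polys_in N"
  unfolding polys_in_def by blast

lemma polys_in_UNIV [simp]: "polys_in UNIV = UNIV"
  by (simp add: polys_in_def)

lemma polys_in_0 [simp]: "0 \<in> polys_in M"
  by (simp add: polys_in_def)

lemma polys_in_const [simp]: "single 0 c \<in> polys_in M"
  by (simp add: polys_in_def)

lemma polys_in_mpoly_const [simp]: "mpoly_const c \<in> polys_in M"
  by (simp add: mpoly_const_def)

lemma polys_in_1 [simp]: "1 \<in> polys_in M"
  by (simp add: polys_in_def)

lemma polys_in_var [simp]: "i \<in> M \<Longrightarrow> mpoly_var i \<in> polys_in M"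
  by (simp add: polys_in_def mpoly_var_def mpoly_monom_def)

lemma polys_in_add: "f \<in> polys_in M \<Longrightarrow> g \<in> polys_in M \<Longrightarrow> f + g \<in> polys_in M"
  using keys_add[of f g] by (fastforce simp: polys_in_def)

lemma polys_in_uminus: "f \<in> polys_in M \<Longrightarrow> - f \<in> polys_in M"
  by (simp add: polys_in_def)

lemma polys_in_diff: "f \<in> polys_in M \<Longrightarrow> g \<in> polys_in M \<Longrightarrow> f - g \<in> polys_in M"
  using polys_in_add[of f M "- g"] polys_in_uminus by fastforce

lemma polys_in_mult: "f \<in> polys_in M \<Longrightarrow> g \<in> polys_in M \<Longrightarrow> f * g \<in> polys_in M"
  using keys_mult[of f g] by (fastforce simp: polys_in_def keys_add_nat)

lemma polys_in_power: "f \<in> polys_in M \<Longrightarrow> f ^ k \<in> polys_in M"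
  by (induction k) (auto intro: polys_in_mult)

lemma polys_in_sum: "(\<And>x. x \<in> A \<Longrightarrow> f x \<in> polys_in M) \<Longrightarrow> sum f A \<in> polys_in M"
  by (induction A rule: infinite_finite_induct) (auto intro: polys_in_add)

lemma polys_in_prod: "(\<And>x. x \<in> A \<Longrightarrow> f x \<in> polys_in M) \<Longrightarrow> prod f A \<in> polys_in M"
  by (induction A rule: infinite_finite_induct) (auto intro: polys_in_mult)

lemma total_degree_UNIV: "total_degree \<nu> = (\<Sum>i\<in>UNIV. lookup \<nu> i)" for \<nu> :: "'n::finite \<Rightarrow>\<^sub>0 nat"
  unfolding total_degree_def
  by (rule sum.mono_neutral_left) (auto simp: in_keys_iff)

lemma total_degree_add: "total_degree (\<mu> + \<nu>) = total_degree \<mu> + total_degree \<nu>"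
  for \<nu> :: "'n::finite \<Rightarrow>\<^sub>0 nat"
  by (simp add: total_degree_UNIV lookup_add sum.distrib)

lemma weight_add: "weight \<omega> (\<mu> + \<nu>) = weight \<omega> \<mu> + weight \<omega> \<nu>"
  by (simp add: weight_def lookup_add sum.distrib distrib_left)

lemma finite_total_degree: "finite {\<nu> :: 'n::finite \<Rightarrow>\<^sub>0 nat. total_degree \<nu> = d}"
proof -
  have "lookup ` {\<nu> :: 'n \<Rightarrow>\<^sub>0 nat. total_degree \<nu> = d} \<subseteq> (UNIV \<rightarrow>\<^sub>E {..d})"
    by (auto simp: total_degree_UNIV intro: member_le_sum)
  moreover have "inj_on lookup {\<nu> :: 'n \<Rightarrow>\<^sub>0 nat. total_degree \<nu> = d}"
    by (intro inj_onI poly_mapping_eqI) simp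
  ultimately show ?thesis
    by (metis (no_types, lifting) finite_PiE finite_atMost finite_class.finite_UNIV inj_on_finite)
qed

section \<open>Homogeneous forms\<close>

definition homogeneous :: "nat \<Rightarrow> ('n, 'k::comm_ring_1) mpoly \<Rightarrow> bool"
  where "homogeneous d f \<longleftrightarrow> (\<forall>\<nu>\<in>keys f. total_degree \<nu> = d)"

abbreviation degree_part :: "nat \<Rightarrow> ('n, 'k::comm_ring_1) mpoly \<Rightarrow> ('n, 'k) mpoly"
  where "degree_part d \<equiv> restrict_terms (\<lambda>\<nu>. total_degree \<nu> = d)"

lemma homogeneous_0 [simp]: "homogeneous d 0"
  by (simp add: homogeneous_def)

lemma homogeneous_add: "homogeneous d f \<Longrightarrow> homogeneous d g \<Longrightarrow> homogeneous d (f + g)"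
  using keys_add[of f g] by (auto simp: homogeneous_def)

lemma homogeneous_diff: "homogeneous d f \<Longrightarrow> homogeneous d g \<Longrightarrow> homogeneous d (f - g)"
  using keys_diff[of f g] by (auto simp: homogeneous_def)

lemma homogeneous_sum: "(\<And>x. x \<in> A \<Longrightarrow> homogeneous d (f x)) \<Longrightarrow> homogeneous d (sum f A)"
  by (induction A rule: infinite_finite_induct) (auto intro: homogeneous_add)

lemma homogeneous_mult: "homogeneous d f \<Longrightarrow> homogeneous e g \<Longrightarrow> homogeneous (d + e) (f * g)"
  for f g :: "('n::finite, 'k::comm_ring_1) mpoly"
  using keys_mult[of f g] by (force simp: homogeneous_def total_degree_add)

lemma homogeneous_degree_part: "homogeneous d (degree_part d f)"
  by (auto simp: homogeneous_def keys_restrict_terms)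

lemma homogeneous_restrict_terms: "homogeneous d f \<Longrightarrow> homogeneous d (restrict_terms P f)"
  by (auto simp: homogeneous_def keys_restrict_terms)

lemma degree_part_homogeneous:
  "homogeneous d f \<Longrightarrow> degree_part e f = (if e = d then f else 0)"
  by (auto simp: homogeneous_def intro!: restrict_terms_id restrict_terms_eq_0)

text \<open>Covers both uses of \<open>mpoly_eval\<close>: with \<open>id\<close> on coefficients it
  is evaluation at a point, with \<open>mpoly_const\<close> it is substitution of polynomials, as in
  \<open>GL_act\<close>.\<close>

locale coeff_hom =
  fixes \<phi> :: "'k::comm_ring_1 \<Rightarrow> 'r::comm_ring_1"
  assumes zero: "\<phi> 0 = 0" and one: "\<phi> 1 = 1"
    and add: "\<phi> (a + b) = \<phi> a + \<phi> b" and mult: "\<phi> (a * b) = \<phi> a * \<phi> b"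
begin

lemma eval_0 [simp]: "mpoly_eval \<phi> \<sigma> 0 = 0"
  by (simp add: mpoly_eval_def)

lemma eval_add: "mpoly_eval \<phi> \<sigma> (f + g) = mpoly_eval \<phi> \<sigma> f + mpoly_eval \<phi> \<sigma> g"
  unfolding mpoly_eval_def
  using setsum_keys_plus_distrib[of "\<lambda>\<nu> c. \<phi> c * (\<Prod>i\<in>keys \<nu>. \<sigma> i ^ lookup \<nu> i)" f g]
  by (simp add: zero add distrib_right)

lemma eval_uminus: "mpoly_eval \<phi> \<sigma> (- f) = - mpoly_eval \<phi> \<sigma> f"
  using eval_add[of \<sigma> f "- f"] by (simp add: eq_neg_iff_add_eq_0 add.commute)

lemma eval_diff: "mpoly_eval \<phi> \<sigma> (f - g) = mpoly_eval \<phi> \<sigma> f - mpoly_eval \<phi> \<sigma> g"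
  using eval_add[of \<sigma> f "- g"] by (simp add: eval_uminus)

lemma eval_sum: "mpoly_eval \<phi> \<sigma> (sum f A) = (\<Sum>x\<in>A. mpoly_eval \<phi> \<sigma> (f x))"
  by (induction A rule: infinite_finite_induct) (auto simp: eval_add)

lemma eval_single:
  "mpoly_eval \<phi> \<sigma> (single \<nu> c) = \<phi> c * (\<Prod>i\<in>UNIV. \<sigma> i ^ lookup \<nu> i)"
  for \<nu> :: "'n::finite \<Rightarrow>\<^sub>0 nat"
proof -
  have "(\<Prod>i\<in>keys \<nu>. \<sigma> i ^ lookup \<nu> i) = (\<Prod>i\<in>UNIV. \<sigma> i ^ lookup \<nu> i)"
    by (rule prod.mono_neutral_left) (auto simp: in_keys_iff)
  then show ?thesis by (auto simp: mpoly_eval_def zero)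
qed

lemma eval_mult: "mpoly_eval \<phi> \<sigma> (f * g) = mpoly_eval \<phi> \<sigma> f * mpoly_eval \<phi> \<sigma> g"
  for f g :: "('n::finite, 'k) mpoly"
proof (induction f rule: poly_mapping_single_induct)
  case (single \<mu> c)
  show ?case
  proof (induction g rule: poly_mapping_single_induct)
    case (single \<nu> d)
    then show ?case
      by (simp add: mult_single eval_single mult lookup_add power_add prod.distrib mult_ac)
  qed (auto simp: eval_add distrib_left)
qed (auto simp: eval_add distrib_right)

lemma eval_1 [simp]: "mpoly_eval \<phi> \<sigma> 1 = 1"
  by (simp add: mpoly_eval_def one)

lemma eval_power: "mpoly_eval \<phi> \<sigma> (f ^ k) = mpoly_eval \<phi> \<sigma> f ^ k"
  for f :: "('n::finite, 'k) mpoly"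
  by (induction k) (auto simp: eval_mult)

lemma eval_prod: "mpoly_eval \<phi> \<sigma> (prod f A) = (\<Prod>x\<in>A. mpoly_eval \<phi> \<sigma> (f x))"
  for f :: "'x \<Rightarrow> ('n::finite, 'k) mpoly"
  by (induction A rule: infinite_finite_induct) (auto simp: eval_mult)

lemma eval_const: "mpoly_eval \<phi> \<sigma> (mpoly_const c) = \<phi> c"
  by (simp add: mpoly_eval_def mpoly_const_def zero)

lemma eval_var: "mpoly_eval \<phi> \<sigma> (mpoly_var i) = \<sigma> i"
  by (simp add: mpoly_eval_def mpoly_var_def mpoly_monom_def one)

end

interpretation ev: coeff_hom "id :: 'k::comm_ring_1 \<Rightarrow> 'k"
  by unfold_locales auto

interpretation cst: coeff_hom "mpoly_const :: 'k::comm_ring_1 \<Rightarrow> ('n, 'k) mpoly"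
  by unfold_locales (auto simp: mpoly_const_def single_add mult_single)

lemma (in coeff_hom) eval_cong_polys_in:
  "f \<in> polys_in M \<Longrightarrow> (\<And>i. i \<in> M \<Longrightarrow> \<sigma> i = \<tau> i) \<Longrightarrow> mpoly_eval \<phi> \<sigma> f = mpoly_eval \<phi> \<tau> f"
  unfolding mpoly_eval_def polys_in_def
  by (intro sum.cong prod.cong arg_cong2[of _ _ _ _ "(*)"] refl) (auto dest!: bspec)

section \<open>Nonvanishing of polynomial functions\<close>

text \<open>Over an infinite field polynomials embed into functions; restricting functions to lines
  reduces statements about products to polynomials in one variable.\<close>

definition poly_on_lines :: "(('i \<Rightarrow> 'k::comm_ring_1) \<Rightarrow> 'k) \<Rightarrow> bool"
  where "poly_on_lines \<phi> \<longleftrightarrow> (\<forall>u v. \<exists>P. \<forall>t. \<phi> (\<lambda>i. u i + t * v i) = poly P t)"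

lemma poly_on_lines_const [simp]: "poly_on_lines (\<lambda>u. c)"
  unfolding poly_on_lines_def by (intro allI exI[of _ "[:c:]"]) simp

lemma poly_on_lines_coord [simp]: "poly_on_lines (\<lambda>u. u i)"
  unfolding poly_on_lines_def
proof (intro allI)
  fix u v :: "'a \<Rightarrow> 'b"
  show "\<exists>P. \<forall>t. u i + t * v i = poly P t"
    by (intro exI[of _ "[:u i, v i:]"]) simp
qed

lemma poly_on_lines_add: "poly_on_lines \<phi> \<Longrightarrow> poly_on_lines \<psi> \<Longrightarrow> poly_on_lines (\<lambda>u. \<phi> u + \<psi> u)"
  unfolding poly_on_lines_def by (metis poly_add)

lemma poly_on_lines_mult: "poly_on_lines \<phi> \<Longrightarrow> poly_on_lines \<psi> \<Longrightarrow> poly_on_lines (\<lambda>u. \<phi> u * \<psi> u)"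
  unfolding poly_on_lines_def by (metis poly_mult)

lemma poly_on_lines_power: "poly_on_lines \<phi> \<Longrightarrow> poly_on_lines (\<lambda>u. \<phi> u ^ k)"
  by (induction k) (auto intro: poly_on_lines_mult)

lemma poly_on_lines_sum:
  "(\<And>x. x \<in> A \<Longrightarrow> poly_on_lines (\<phi> x)) \<Longrightarrow> poly_on_lines (\<lambda>u. \<Sum>x\<in>A. \<phi> x u)"
  by (induction A rule: infinite_finite_induct) (auto intro: poly_on_lines_add)

lemma poly_on_lines_prod:
  "(\<And>x. x \<in> A \<Longrightarrow> poly_on_lines (\<phi> x)) \<Longrightarrow> poly_on_lines (\<lambda>u. \<Prod>x\<in>A. \<phi> x u)"
  by (induction A rule: infinite_finite_induct) (auto intro: poly_on_lines_mult)

lemma poly_on_lines_if: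
  "(b \<Longrightarrow> poly_on_lines \<phi>) \<Longrightarrow> (\<not> b \<Longrightarrow> poly_on_lines \<psi>) \<Longrightarrow>
    poly_on_lines (\<lambda>u. if b then \<phi> u else \<psi> u)"
  by (cases b) simp_all

lemma poly_on_lines_eval:
  "(\<And>i. poly_on_lines (\<lambda>u. \<sigma> u i)) \<Longrightarrow> poly_on_lines (\<lambda>u. mpoly_eval id (\<sigma> u) f)"
  unfolding mpoly_eval_def
  by (intro poly_on_lines_sum poly_on_lines_mult poly_on_lines_prod poly_on_lines_power) auto

lemma poly_on_lines_det:
  "(\<And>i j. poly_on_lines (\<lambda>u. A u $ i $ j)) \<Longrightarrow> poly_on_lines (\<lambda>u. det (A u))"
  for A :: "('i \<Rightarrow> 'k::comm_ring_1) \<Rightarrow> 'k ^ 'n::finite ^ 'n"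
  unfolding det_def by (intro poly_on_lines_sum poly_on_lines_mult poly_on_lines_prod) auto

text \<open>On the line from \<open>u\<close> to \<open>v\<close> both functions are polynomials in
  the parameter, one nonzero at 0, the other at 1, so their product has finitely many roots. The
  point found lies on this line and therefore keeps every coordinate on which \<open>u\<close> and
  \<open>v\<close> agree; this makes the lemma usable inside a hyperplane.\<close>

lemma poly_on_lines_common_nonzero:
  fixes \<phi> \<psi> :: "('i \<Rightarrow> 'k::field_char_0) \<Rightarrow> 'k"
  assumes "poly_on_lines \<phi>" "poly_on_lines \<psi>" "\<phi> u \<noteq> 0" "\<psi> v \<noteq> 0"
  obtains w where "\<phi> w \<noteq> 0" "\<psi> w \<noteq> 0" "\<And>i. u i = v i \<Longrightarrow> w i = u i"
proof -
  from assms obtain P Q where P: "\<And>t. \<phi> (\<lambda>i. u i + t * (v i - u i)) = poly P t"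
    and Q: "\<And>t. \<psi> (\<lambda>i. u i + t * (v i - u i)) = poly Q t"
    unfolding poly_on_lines_def by meson
  from assms(3) P[of 0] have "P \<noteq> 0" by auto
  moreover from assms(4) Q[of 1] have "Q \<noteq> 0" by auto
  ultimately have "finite {t. poly (P * Q) t = 0}"
    by (simp add: poly_roots_finite)
  then obtain t where "poly (P * Q) t \<noteq> 0"
    using infinite_UNIV_char_0[where 'a = 'k] by (metis (mono_tags, lifting) UNIV_eq_I mem_Collect_eq)
  then show ?thesis
    using P[of t] Q[of t] by (intro that[of "\<lambda>i. u i + t * (v i - u i)"]) auto
qed

text \<open>The two-function case is applied to one function and the product of the others. It later
  provides one matrix that is good for all permutations at once.\<close>

lemma poly_on_lines_finite_nonzero:
  fixes \<phi> :: "'x \<Rightarrow> ('i \<Rightarrow> 'k::field_char_0) \<Rightarrow> 'k"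
  assumes "finite B" "\<And>x. x \<in> B \<Longrightarrow> poly_on_lines (\<phi> x)" "\<And>x. x \<in> B \<Longrightarrow> \<exists>u. \<phi> x u \<noteq> 0"
  shows "\<exists>u. \<forall>x\<in>B. \<phi> x u \<noteq> 0"
proof -
  have "\<exists>u. (\<Prod>x\<in>B. \<phi> x u) \<noteq> 0"
    using assms
  proof (induction rule: finite_induct)
    case (insert x B)
    then obtain u where u: "\<phi> x u \<noteq> 0" by blast
    from insert obtain v where v: "(\<Prod>x\<in>B. \<phi> x v) \<noteq> 0" by (metis (no_types, lifting) insertI2)
    have "poly_on_lines (\<lambda>u. \<Prod>x\<in>B. \<phi> x u)"
      using insert.prems by (intro poly_on_lines_prod) auto
    from poly_on_lines_common_nonzero[where \<phi> = "\<phi> x" and \<psi> = "\<lambda>u. \<Prod>x\<in>B. \<phi> x u",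
        OF insert.prems(1)[OF insertI1] this u v]
    obtain w where "\<phi> x w \<noteq> 0" "(\<Prod>x\<in>B. \<phi> x w) \<noteq> 0" .
    then show ?case using insert.hyps by auto
  qed auto
  then show ?thesis using assms(1) by auto
qed

definition var_coeff :: "'n \<Rightarrow> nat \<Rightarrow> ('n, 'k::comm_ring_1) mpoly \<Rightarrow> ('n, 'k) mpoly"
  where "var_coeff i k f =
    (\<Sum>\<nu>\<in>{\<nu>\<in>keys f. lookup \<nu> i = k}. single (\<nu> - single i k) (lookup f \<nu>))"

lemma keys_minus_single:
  "lookup \<nu> i = k \<Longrightarrow> keys (\<nu> - single i k) = keys \<nu> - {i}"
  for \<nu> :: "'n \<Rightarrow>\<^sub>0 nat"
  by (auto simp: in_keys_iff lookup_minus lookup_single when_def split: if_splits)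

lemma single_plus_minus:
  "lookup \<nu> i = k \<Longrightarrow> single i k + (\<nu> - single i k) = \<nu>"
  for \<nu> :: "'n \<Rightarrow>\<^sub>0 nat"
  by (rule poly_mapping_eqI) (auto simp: lookup_minus lookup_add lookup_single when_def)

lemma var_coeff_in: "f \<in> polys_in M \<Longrightarrow> var_coeff i k f \<in> polys_in (M - {i})"
  unfolding var_coeff_def by (intro polys_in_sum) (auto simp: polys_in_def keys_minus_single)

lemma mpoly_var_power: "mpoly_var i ^ k = single (single i k) 1"
  by (induction k) (auto simp: mpoly_var_def mpoly_monom_def mult_single simp flip: single_add)

lemma var_coeff_expand:
  assumes "finite A" "\<And>\<nu>. \<nu> \<in> keys f \<Longrightarrow> lookup \<nu> i \<in> A"
  shows "(\<Sum>k\<in>A. var_coeff i k f * mpoly_var i ^ k) = f"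
proof -
  have "var_coeff i k f * mpoly_var i ^ k = restrict_terms (\<lambda>\<nu>. lookup \<nu> i = k) f" for k
    unfolding var_coeff_def mpoly_var_power sum_distrib_right mult_single restrict_terms_def
    by (intro sum.cong) (auto simp: add.commute single_plus_minus)
  then show ?thesis using sum_restrict_terms[OF assms] by simp
qed

lemma var_coeff_nonzero: "f \<noteq> 0 \<Longrightarrow> \<exists>k. var_coeff i k f \<noteq> 0"
  using var_coeff_expand[of "(\<lambda>\<nu>. lookup \<nu> i) ` keys f" f i]
  by (metis (no_types, lifting) finite_imageI finite_keys imageI mult_zero_left sum.neutral)

lemma var_coeff_finite: "finite {k. var_coeff i k f \<noteq> 0}"
proof (rule finite_subset)
  show "{k. var_coeff i k f \<noteq> 0} \<subseteq> (\<lambda>\<nu>. lookup \<nu> i) ` keys f"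
    unfolding var_coeff_def by (auto intro: sum.neutral elim!: sum.not_neutral_contains_not_neutral)
qed simp

text \<open>Induction on the number of variables: a point where some coefficient with respect to x_i
  is nonzero leaves a nonzero polynomial in one variable, which has a nonzero value over an infinite
  field.\<close>

lemma mpoly_nonzero_eval:
  fixes f :: "('n::finite, 'k::field_char_0) mpoly"
  assumes "f \<noteq> 0"
  shows "\<exists>u. mpoly_eval id u f \<noteq> 0"
proof -
  have "\<exists>u. mpoly_eval id u f \<noteq> 0" if "finite M" "f \<in> polys_in M" "f \<noteq> 0"
    for M and f :: "('n, 'k) mpoly"
    using that
  proof (induction arbitrary: f rule: finite_induct)
    case empty
    then have "keys f \<subseteq> {0}" by (auto simp: polys_in_def)
    then have "keys f = {0}" using empty.prems(2) by (metis keys_eq_empty subset_singletonD)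
    then show ?case by (auto simp: mpoly_eval_def in_keys_iff)
  next
    case (insert i M)
    obtain e where e: "var_coeff i e f \<noteq> 0"
      using var_coeff_nonzero[OF insert.prems(2)] by blast
    have vin: "var_coeff i k f \<in> polys_in M" for k
      using var_coeff_in[OF insert.prems(1), of i] insert.hyps by simp
    obtain u where u: "mpoly_eval id u (var_coeff i e f) \<noteq> 0"
      using insert.IH[OF vin e] by blast
    define A where "A = insert e ((\<lambda>\<nu>. lookup \<nu> i) ` keys f)"
    have A: "finite A" "e \<in> A" by (auto simp: A_def)
    define P where "P = (\<Sum>k\<in>A. Polynomial.monom (mpoly_eval id u (var_coeff i k f)) k)"
    have "Polynomial.coeff P e = mpoly_eval id u (var_coeff i e f)"
      using A by (simp add: P_def coeff_sum)
    then have "P \<noteq> 0" using u by auto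
    then obtain t where t: "poly P t \<noteq> 0"
      using poly_all_0_iff_0 by blast
    have "mpoly_eval id (u(i := t)) (\<Sum>k\<in>A. var_coeff i k f * mpoly_var i ^ k) = poly P t"
    proof -
      have "mpoly_eval id (u(i := t)) (var_coeff i k f) = mpoly_eval id u (var_coeff i k f)" for k
        by (rule ev.eval_cong_polys_in[OF vin]) (use insert.hyps in auto)
      then show ?thesis
        by (simp add: P_def ev.eval_sum ev.eval_mult ev.eval_power ev.eval_var poly_sum poly_monom)
    qed
    moreover have "(\<Sum>k\<in>A. var_coeff i k f * mpoly_var i ^ k) = f"
      by (rule var_coeff_expand) (auto simp: A_def)
    ultimately show ?case using t by metis
  qed
  from this[of UNIV f] assms show ?thesis by simp
qed

lemma mpoly_no_zero_divisors:
  fixes f g :: "('n::finite, 'k::field_char_0) mpoly"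
  assumes "f \<noteq> 0" "g \<noteq> 0"
  shows "f * g \<noteq> 0"
proof -
  obtain u v where "mpoly_eval id u f \<noteq> 0" "mpoly_eval id v g \<noteq> 0"
    using assms mpoly_nonzero_eval by blast
  moreover have "poly_on_lines (\<lambda>u. mpoly_eval id u h)" for h :: "('n, 'k) mpoly"
    by (rule poly_on_lines_eval) simp
  ultimately obtain w where "mpoly_eval id w f \<noteq> 0" "mpoly_eval id w g \<noteq> 0"
    using poly_on_lines_common_nonzero[where \<phi> = "\<lambda>u. mpoly_eval id u f"
      and \<psi> = "\<lambda>u. mpoly_eval id u g" and u = u and v = v] by blast
  then have "mpoly_eval id w (f * g) \<noteq> 0" by (simp add: ev.eval_mult)
  then show ?thesis by auto
qed

lemma mpoly_prod_nonzero:
  fixes f :: "'x \<Rightarrow> ('n::finite, 'k::field_char_0) mpoly"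
  assumes "\<And>x. x \<in> A \<Longrightarrow> f x \<noteq> 0"
  shows "prod f A \<noteq> 0"
  using assms
proof (induction A rule: infinite_finite_induct)
  case (insert x A)
  then show ?case by (simp add: mpoly_no_zero_divisors)
qed auto

section \<open>Chains of prime ideals\<close>

text \<open>Ideals without a ring record, for computing with the type class operations. The
  equivalences below translate back to the records in which the dimension is defined.\<close>

definition is_ideal :: "'a::comm_ring_1 set \<Rightarrow> bool"
  where "is_ideal J \<longleftrightarrow> 0 \<in> J \<and> (\<forall>a\<in>J. \<forall>b\<in>J. a + b \<in> J) \<and> (\<forall>r. \<forall>a\<in>J. r * a \<in> J)"

definition is_prime_ideal :: "'a::comm_ring_1 set \<Rightarrow> bool"
  where "is_prime_ideal P \<longleftrightarrow> is_ideal P \<and> 1 \<notin> P \<and> (\<forall>a b. a * b \<in> P \<longrightarrow> a \<in> P \<or> b \<in> P)"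

lemma is_idealD:
  assumes "is_ideal J"
  shows is_ideal_0: "0 \<in> J"
    and is_ideal_add: "a \<in> J \<Longrightarrow> b \<in> J \<Longrightarrow> a + b \<in> J"
    and is_ideal_mult_left: "a \<in> J \<Longrightarrow> r * a \<in> J"
    and is_ideal_mult_right: "a \<in> J \<Longrightarrow> a * r \<in> J"
  using assms by (simp_all add: is_ideal_def mult.commute[of a r])

lemma is_ideal_uminus: "is_ideal J \<Longrightarrow> a \<in> J \<Longrightarrow> - a \<in> J"
  using is_ideal_mult_left[of J a "-1"] by simp

lemma is_ideal_diff: "is_ideal J \<Longrightarrow> a \<in> J \<Longrightarrow> b \<in> J \<Longrightarrow> a - b \<in> J"
  using is_ideal_add[of J a "- b"] is_ideal_uminus by fastforce

lemma is_ideal_sum: "is_ideal J \<Longrightarrow> (\<And>x. x \<in> A \<Longrightarrow> f x \<in> J) \<Longrightarrow> sum f A \<in> J"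
  by (induction A rule: infinite_finite_induct) (auto simp: is_ideal_0 is_ideal_add)

lemma ring_of_type_algebra_simps [simp]:
  "carrier ring_of_type_algebra = UNIV"
  "x \<otimes>\<^bsub>ring_of_type_algebra\<^esub> y = x * y"
  "x \<oplus>\<^bsub>ring_of_type_algebra\<^esub> y = x + y"
  "\<one>\<^bsub>ring_of_type_algebra\<^esub> = 1"
  "\<zero>\<^bsub>ring_of_type_algebra\<^esub> = 0"
  by (simp_all add: ring_of_type_algebra_def)

lemma a_inv_ring_of_type_algebra [simp]:
  "\<ominus>\<^bsub>ring_of_type_algebra\<^esub> x = - (x :: 'a::comm_ring_1)"
proof -
  interpret R: ring "ring_of_type_algebra :: 'a ring" ..
  show ?thesis by (rule R.minus_equality) auto
qed

lemma ideal_iff_is_ideal: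
  "ideal J (ring_of_type_algebra :: 'a::comm_ring_1 ring) \<longleftrightarrow> is_ideal J"
proof
  assume "ideal J (ring_of_type_algebra :: 'a ring)"
  then interpret ideal J "ring_of_type_algebra :: 'a ring" .
  show "is_ideal J"
    unfolding is_ideal_def using additive_subgroup.zero_closed[OF additive_subgroup_axioms]
      additive_subgroup.a_closed[OF additive_subgroup_axioms] I_l_closed by auto
next
  interpret R: ring "ring_of_type_algebra :: 'a ring" ..
  assume J: "is_ideal J"
  show "ideal J (ring_of_type_algebra :: 'a ring)"
  proof (rule idealI)
    show "subgroup J (add_monoid (ring_of_type_algebra :: 'a ring))"
    proof (rule R.add.subgroupI)
      show "J \<noteq> {}" using is_ideal_0[OF J] by blast
    qed (use J in \<open>auto simp: is_idealD is_ideal_uminus simp flip: a_inv_def\<close>)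
  qed (use J in \<open>auto simp: is_idealD intro: R.ring_axioms\<close>)
qed

lemma primeideal_iff_is_prime_ideal:
  "primeideal P (ring_of_type_algebra :: 'a::comm_ring_1 ring) \<longleftrightarrow> is_prime_ideal P"
proof
  assume "primeideal P (ring_of_type_algebra :: 'a ring)"
  then interpret primeideal P "ring_of_type_algebra :: 'a ring" .
  show "is_prime_ideal P"
    unfolding is_prime_ideal_def using I_prime I_notcarr one_imp_carrier is_ideal
    by (auto simp: ideal_iff_is_ideal)
next
  assume "is_prime_ideal P"
  then show "primeideal P (ring_of_type_algebra :: 'a ring)"
    by (intro primeidealI) (auto simp: ideal_iff_is_ideal is_prime_ideal_def)
qed

text \<open>An ideal that is maximal among those above \<open>J\<close> and disjoint from the
  multiplicative set \<open>S\<close> is prime, because enlarging it by any element makes it meet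
  \<open>S\<close>.\<close>

lemma ex_prime_ideal_disjoint:
  assumes J: "is_ideal J" and S: "1 \<in> S" "\<And>a b. a \<in> S \<Longrightarrow> b \<in> S \<Longrightarrow> a * b \<in> S"
    and JS: "J \<inter> S = {}"
  obtains P where "is_prime_ideal P" "J \<subseteq> P" "P \<inter> S = {}"
proof -
  define F where "F = {Q. is_ideal Q \<and> J \<subseteq> Q \<and> Q \<inter> S = {}}"
  have "\<exists>P\<in>F. \<forall>Q\<in>F. P \<subseteq> Q \<longrightarrow> Q = P"
  proof (rule subset_Zorn_nonempty)
    show "F \<noteq> {}" using J JS by (auto simp: F_def)
  next
    fix C assume C: "C \<noteq> {}" "subset.chain F C"
    have idC: "is_ideal D" if "D \<in> C" for D
      using C(2) that unfolding F_def subset.chain_def by blast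
    have "is_ideal (\<Union>C)"
      unfolding is_ideal_def
    proof (intro conjI ballI allI)
      show "0 \<in> \<Union>C" using C(1) is_ideal_0[OF idC] by blast
      fix a assume a: "a \<in> \<Union>C"
      then show "r * a \<in> \<Union>C" for r
        using is_ideal_mult_left[OF idC] by blast
      fix b assume "b \<in> \<Union>C"
      with a obtain D D' where D: "D \<in> C" "a \<in> D" "D' \<in> C" "b \<in> D'" by blast
      then have "D \<subseteq> D' \<or> D' \<subseteq> D" using C(2) unfolding subset.chain_def by blast
      with D obtain D where "D \<in> C" "a \<in> D" "b \<in> D" by blast
      then show "a + b \<in> \<Union>C" using is_ideal_add[OF idC] by blast
    qed
    then show "\<Union>C \<in> F" using C unfolding F_def subset.chain_def by blast
  qed
  then obtain P where P: "P \<in> F" and max: "\<And>Q. Q \<in> F \<Longrightarrow> P \<subseteq> Q \<Longrightarrow> Q = P" by blast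
  have idP: "is_ideal P" and JP: "J \<subseteq> P" and PS: "P \<inter> S = {}" using P by (auto simp: F_def)
  have meet: "\<exists>p\<in>P. \<exists>r. p + r * a \<in> S" if "a \<notin> P" for a
  proof (rule ccontr)
    assume no: "\<not> ?thesis"
    define Q where "Q = {p + r * a | p r. p \<in> P}"
    have "is_ideal Q"
      unfolding is_ideal_def
    proof (intro conjI ballI allI)
      show "0 \<in> Q" unfolding Q_def using is_ideal_0[OF idP] by (auto intro!: exI[of _ 0])
    next
      fix x y assume "x \<in> Q" "y \<in> Q"
      then obtain p r p' r' where "x = p + r * a" "y = p' + r' * a" "p \<in> P" "p' \<in> P"
        by (auto simp: Q_def)
      then have "x + y = (p + p') + (r + r') * a" "p + p' \<in> P"
        using idP by (auto simp: algebra_simps is_idealD)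
      then show "x + y \<in> Q" unfolding Q_def by blast
    next
      fix s x assume "x \<in> Q"
      then obtain p r where "x = p + r * a" "p \<in> P"
        by (auto simp: Q_def)
      then have "s * x = s * p + (s * r) * a" "s * p \<in> P"
        using idP by (auto simp: algebra_simps is_idealD)
      then show "s * x \<in> Q" unfolding Q_def by blast
    qed
    moreover have PQ: "P \<subseteq> Q"
      unfolding Q_def by (force intro: exI[of _ 0])
    moreover have "Q \<inter> S = {}" using no unfolding Q_def by blast
    ultimately have "Q = P" using max JP by (auto simp: F_def)
    moreover have "a \<in> Q" unfolding Q_def using is_ideal_0[OF idP] by (force intro: exI[of _ 1])
    ultimately show False using that by blast
  qed
  have "is_prime_ideal P"
    unfolding is_prime_ideal_def
  proof (intro conjI allI impI)
    show "1 \<notin> P" using PS S(1) by blast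
    fix a b assume ab: "a * b \<in> P"
    show "a \<in> P \<or> b \<in> P"
    proof (rule ccontr)
      assume "\<not> ?thesis"
      then obtain p r p' r' where *: "p \<in> P" "p + r * a \<in> S" "p' \<in> P" "p' + r' * b \<in> S"
        using meet by meson
      \<comment> \<open>A product of two elements of \<open>S\<close>. In the expansion every
        summand contains \<open>p\<close>, \<open>p'\<close> or \<open>a * b\<close>, so it lies in
        \<open>P\<close> as well.\<close>
      have "(p + r * a) * (p' + r' * b) = p * (p' + r' * b) + (r * a * p' + (r * r') * (a * b))"
        by (simp add: algebra_simps)
      also have "\<dots> \<in> P"
        using * ab idP by (intro is_ideal_add) (auto simp: is_idealD)
      finally show False using S(2) * PS by blast
    qed
  qed (rule idP)
  then show ?thesis using JP PS that by blast
qed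

text \<open>Nakayama's lemma for a finitely generated module, by eliminating one generator at a time;
  the elements of \<open>S\<close> play the role of the units outside the prime \<open>q\<close> of the base ring.\<close>

lemma nakayama_elimination:
  assumes P: "is_ideal P"
    and S: "1 \<in> S" "\<And>a b. a \<in> S \<Longrightarrow> b \<in> S \<Longrightarrow> a * b \<in> S" "\<And>a b. a \<in> S \<Longrightarrow> b \<in> q \<Longrightarrow> a - b \<in> S"
    and q: "\<And>a b. a \<in> q \<Longrightarrow> b \<in> q \<Longrightarrow> a + b \<in> q" "\<And>a b. a \<in> q \<Longrightarrow> b \<in> q \<Longrightarrow> a * b \<in> q"
      "\<And>a b. a \<in> S \<Longrightarrow> b \<in> q \<Longrightarrow> a * b \<in> q"
    and "finite T"
    and "\<And>i. i \<in> T \<Longrightarrow> \<beta> i \<in> S" "\<And>i j. i \<in> T \<Longrightarrow> j \<in> T \<Longrightarrow> c i j \<in> q"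
      "\<And>i. i \<in> T \<Longrightarrow> \<beta> i * m i - (\<Sum>j\<in>T. c i j * m j) \<in> P"
  shows "\<forall>i\<in>T. \<exists>\<gamma>\<in>S. \<gamma> * m i \<in> P"
  using assms(8-)
proof (induction arbitrary: \<beta> c rule: finite_induct)
  case (insert k T)
  note prems = insert.prems
  \<comment> \<open>The diagonal entry of row \<open>k\<close> moves to the left-hand side; the
    result stays in \<open>S\<close> because subtracting an element of \<open>q\<close> does not
    leave \<open>S\<close>.\<close>
  define \<beta>' where "\<beta>' = \<beta> k - c k k"
  have \<beta>': "\<beta>' \<in> S" unfolding \<beta>'_def using prems by (intro S) auto
  have rel: "\<beta>' * m k - (\<Sum>j\<in>T. c k j * m j) \<in> P"
    using prems(3)[of k] insert.hyps by (simp add: \<beta>'_def algebra_simps)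
  have IH: "\<forall>i\<in>T. \<exists>\<gamma>\<in>S. \<gamma> * m i \<in> P"
  \<comment> \<open>Row \<open>i\<close> is multiplied by \<open>\<beta>'\<close> and row
    \<open>k\<close>, multiplied by \<open>c i k\<close>, is added; this cancels
    \<open>m k\<close>.\<close>
  proof (rule insert.IH[of "\<lambda>i. \<beta>' * \<beta> i" "\<lambda>i j. \<beta>' * c i j + c i k * c k j"])
    fix i assume i: "i \<in> T"
    show "\<beta>' * \<beta> i \<in> S" using \<beta>' prems i by (intro S) auto
    show "\<beta>' * c i j + c i k * c k j \<in> q" if "j \<in> T" for j
      using \<beta>' prems i that by (intro q) auto
    have "\<beta>' * \<beta> i * m i - (\<Sum>j\<in>T. (\<beta>' * c i j + c i k * c k j) * m j) =
        \<beta>' * (\<beta> i * m i - (\<Sum>j\<in>insert k T. c i j * m j)) + c i k * (\<beta>' * m k - (\<Sum>j\<in>T. c k j * m j))"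
      using insert.hyps by (simp add: algebra_simps sum.distrib sum_distrib_left)
    also have "\<dots> \<in> P"
      using prems(3)[of i] i rel P by (auto intro!: is_ideal_add is_ideal_mult_left)
    finally show "\<beta>' * \<beta> i * m i - (\<Sum>j\<in>T. (\<beta>' * c i j + c i k * c k j) * m j) \<in> P" .
  qed
  then obtain \<gamma> where \<gamma>: "\<And>i. i \<in> T \<Longrightarrow> \<gamma> i \<in> S \<and> \<gamma> i * m i \<in> P" by metis
  \<comment> \<open>A common multiplier that sends all remaining generators into \<open>P\<close>;
    inserted in row \<open>k\<close> it disposes of \<open>m k\<close> too.\<close>
  define \<delta> where "\<delta> = (\<Prod>i\<in>T. \<gamma> i)"
  have \<delta>: "\<delta> \<in> S"
    unfolding \<delta>_def using insert.hyps(1) \<gamma> by (induction T) (auto intro: S)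
  have "\<delta> * m j \<in> P" if "j \<in> T" for j
  proof -
    have "\<delta> * m j = (\<Prod>i\<in>T - {j}. \<gamma> i) * (\<gamma> j * m j)"
      using that insert.hyps(1) by (simp add: \<delta>_def prod.remove mult_ac)
    then show ?thesis using \<gamma>[OF that] P by (simp add: is_idealD)
  qed
  then have "(\<Sum>j\<in>T. c k j * (\<delta> * m j)) \<in> P"
    by (intro is_ideal_sum[OF P]) (simp add: is_ideal_mult_left[OF P])
  moreover have "\<delta> * (\<beta>' * m k - (\<Sum>j\<in>T. c k j * m j)) \<in> P"
    using rel P by (rule is_ideal_mult_left[rotated])
  moreover have "\<delta> * (\<beta>' * m k - (\<Sum>j\<in>T. c k j * m j)) + (\<Sum>j\<in>T. c k j * (\<delta> * m j)) = \<delta> * \<beta>' * m k"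
    by (simp add: algebra_simps sum_distrib_left)
  ultimately have "\<delta> * \<beta>' * m k \<in> P" using P is_ideal_add by metis
  moreover have "\<delta> * \<beta>' \<in> S" using \<delta> \<beta>' by (rule S)
  ultimately show ?case using IH by blast
qed auto

text \<open>Since \<open>P\<close> contains no nonzero element of K[M], the relation
  \<open>h\<close> must really involve x_j, so its degree \<open>e\<close> in x_j is positive. The
  leading coefficient is the element of K[M] that is to be inverted.\<close>

lemma ex_leading_var_coeff:
  fixes P :: "('n::finite, 'k::comm_ring_1) mpoly set"
  assumes P: "P \<inter> polys_in M \<subseteq> {0}" and "j \<notin> M" and h: "h \<in> P" "h \<in> polys_in (insert j M)" "h \<noteq> 0"
  obtains e where "0 < e" "var_coeff j e h \<noteq> 0" "(\<Sum>k\<le>e. var_coeff j k h * mpoly_var j ^ k) = h"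
    "\<And>k. var_coeff j k h \<in> polys_in M"
proof -
  have in_M: "var_coeff j k h \<in> polys_in M" for k
    using var_coeff_in[OF h(2), of j] \<open>j \<notin> M\<close> by simp
  define e where "e = Max {k. var_coeff j k h \<noteq> 0}"
  have "{k. var_coeff j k h \<noteq> 0} \<noteq> {}" using var_coeff_nonzero[OF h(3)] by blast
  from Max_in[OF var_coeff_finite this] have e: "var_coeff j e h \<noteq> 0"
    by (simp add: e_def)
  have "k \<le> e" if "var_coeff j k h \<noteq> 0" for k
    unfolding e_def by (rule Max_ge[OF var_coeff_finite]) (use that in simp)
  then have le: "var_coeff j k h = 0" if "e < k" for k using that leD by blast
  define A where "A = {..e} \<union> (\<lambda>\<nu>. lookup \<nu> j) ` keys h"
  have "h = (\<Sum>k\<in>A. var_coeff j k h * mpoly_var j ^ k)"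
    by (rule var_coeff_expand[symmetric]) (auto simp: A_def)
  also have "\<dots> = (\<Sum>k\<le>e. var_coeff j k h * mpoly_var j ^ k)"
    by (rule sum.mono_neutral_right) (use le in \<open>auto simp: A_def not_le\<close>)
  finally have exp: "(\<Sum>k\<le>e. var_coeff j k h * mpoly_var j ^ k) = h" ..
  have "0 < e"
  proof (rule ccontr)
    assume "\<not> 0 < e"
    then have "h = var_coeff j 0 h" using exp by simp
    then show False using in_M[of 0] P h by auto
  qed
  then show ?thesis using that e exp in_M by blast
qed

text \<open>The key step: below a maximal independent set of variables \<open>M\<close> the residue ring is finite over
  \<open>K[M]\<close> after inverting one element, so a generic value \<open>c\<close> of the variable \<open>y\<close> can be imposed
  without creating relations among the remaining variables.\<close>

lemma prime_ideal_extend: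
  fixes P :: "('n::finite, 'k::field_char_0) mpoly set"
  assumes P: "is_prime_ideal P" and ind: "P \<inter> polys_in M \<subseteq> {0}" and y: "y \<in> M"
    and max: "\<And>j. j \<notin> M \<Longrightarrow> \<exists>h. h \<in> P \<inter> polys_in (insert j M) \<and> h \<noteq> 0"
  obtains Q where "is_prime_ideal Q" "P \<subset> Q" "Q \<inter> polys_in (M - {y}) \<subseteq> {0}"
proof -
  have idP: "is_ideal P" using P by (simp add: is_prime_ideal_def)
  obtain h where h: "\<And>j. j \<notin> M \<Longrightarrow> h j \<in> P" "\<And>j. j \<notin> M \<Longrightarrow> h j \<in> polys_in (insert j M)"
    "\<And>j. j \<notin> M \<Longrightarrow> h j \<noteq> 0"
    using max by (metis IntE)
  have "\<forall>j. \<exists>e. j \<notin> M \<longrightarrow> 0 < e \<and> var_coeff j e (h j) \<noteq> 0 \<and>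
      (\<Sum>k\<le>e. var_coeff j k (h j) * mpoly_var j ^ k) = h j \<and> (\<forall>k. var_coeff j k (h j) \<in> polys_in M)"
  proof
    fix j
    show "\<exists>e. j \<notin> M \<longrightarrow> 0 < e \<and> var_coeff j e (h j) \<noteq> 0 \<and>
      (\<Sum>k\<le>e. var_coeff j k (h j) * mpoly_var j ^ k) = h j \<and> (\<forall>k. var_coeff j k (h j) \<in> polys_in M)"
    proof (cases "j \<in> M")
      case False
      show ?thesis by (rule ex_leading_var_coeff[OF ind False h[OF False]]) blast
    qed simp
  qed
  from choice[OF this] obtain e where "\<forall>j. j \<notin> M \<longrightarrow> 0 < e j \<and> var_coeff j (e j) (h j) \<noteq> 0 \<and>
      (\<Sum>k\<le>e j. var_coeff j k (h j) * mpoly_var j ^ k) = h j \<and> (\<forall>k. var_coeff j k (h j) \<in> polys_in M)" ..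
  then have e: "\<And>j. j \<notin> M \<Longrightarrow> 0 < e j" "\<And>j. j \<notin> M \<Longrightarrow> var_coeff j (e j) (h j) \<noteq> 0"
    "\<And>j. j \<notin> M \<Longrightarrow> (\<Sum>k\<le>e j. var_coeff j k (h j) * mpoly_var j ^ k) = h j"
    "\<And>j k. j \<notin> M \<Longrightarrow> var_coeff j k (h j) \<in> polys_in M"
    by blast+
  have "(\<Prod>j\<in>-M. var_coeff j (e j) (h j)) \<noteq> 0"
    by (rule mpoly_prod_nonzero) (use e(2) in auto)
  then obtain u0 where u0: "mpoly_eval id u0 (\<Prod>j\<in>-M. var_coeff j (e j) (h j)) \<noteq> 0"
    using mpoly_nonzero_eval by blast
  \<comment> \<open>\<open>u0\<close> is a zero of none of the leading coefficients. With its
    \<open>y\<close>-coordinate as value, none of them vanishes identically on the hyperplane x_y =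
    c.\<close>
  define c where "c = u0 y"
  \<comment> \<open>For elements of K[M], vanishing on the hyperplane x_y = c means divisibility by
    x_y - c. So \<open>q\<close> is the prime ideal of K[M] generated by \<open>t\<close>, and
    \<open>S\<close> is its complement: what follows is a computation over the localisation of K[M]
    at this prime, written without fractions.\<close>
  define van where "van f \<longleftrightarrow> (\<forall>u. u y = c \<longrightarrow> mpoly_eval id u f = 0)" for f :: "('n, 'k) mpoly"
  define S where "S = {f \<in> polys_in M. \<not> van f}"
  define q where "q = {f \<in> polys_in M. van f}"
  define t :: "('n, 'k) mpoly" where "t = mpoly_var y - mpoly_const c"
  have S1: "1 \<in> S" by (auto simp: S_def van_def)
  have S_mult: "a * b \<in> S" if "a \<in> S" "b \<in> S" for a b
  proof -
    from that obtain u v where uv: "mpoly_eval id u a \<noteq> 0" "mpoly_eval id v b \<noteq> 0" "u y = c" "v y = c"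
      by (auto simp: S_def van_def)
    have "poly_on_lines (\<lambda>u. mpoly_eval id u f)" for f :: "('n, 'k) mpoly"
      by (rule poly_on_lines_eval) simp
    then obtain w where "mpoly_eval id w a \<noteq> 0" "mpoly_eval id w b \<noteq> 0" "w y = c"
      using poly_on_lines_common_nonzero[where \<phi> = "\<lambda>u. mpoly_eval id u a"
        and \<psi> = "\<lambda>u. mpoly_eval id u b" and u = u and v = v] uv by metis
    then show ?thesis
      using that by (auto simp: S_def van_def ev.eval_mult intro: polys_in_mult)
  qed
  have S_diff: "a - b \<in> S" if "a \<in> S" "b \<in> q" for a b
    using that by (auto simp: S_def q_def van_def ev.eval_diff intro: polys_in_diff)
  have q_add: "a + b \<in> q" if "a \<in> q" "b \<in> q" for a b
    using that by (auto simp: S_def q_def van_def ev.eval_add intro: polys_in_add)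
  have q_mult: "a * b \<in> q" if "a \<in> polys_in M" "b \<in> q" for a b
    using that by (auto simp: S_def q_def van_def ev.eval_mult intro: polys_in_mult)
  have S_in: "a \<in> S \<Longrightarrow> a \<in> polys_in M" and q_in: "a \<in> q \<Longrightarrow> a \<in> polys_in M" for a
    by (auto simp: S_def q_def)
  have t_q: "t \<in> q"
    using y by (auto simp: q_def t_def van_def ev.eval_diff ev.eval_var ev.eval_const
        intro!: polys_in_diff)
  have lead_S: "var_coeff j (e j) (h j) \<in> S" if "j \<notin> M" for j
  proof -
    have "mpoly_eval id u0 (var_coeff j (e j) (h j)) \<noteq> 0"
      using u0 that by (auto simp: ev.eval_prod)
    then show ?thesis using e(4)[OF that] by (auto simp: S_def van_def c_def)
  qed
  have S_P: "a \<notin> P" if "a \<in> S" for a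
    using that ind by (auto simp: S_def van_def)

  \<comment> \<open>Exponents of the monomials in the variables outside \<open>M\<close> that the
    relations \<open>h j\<close> cannot reduce. There are finitely many, and they will generate the
    localised residue ring.\<close>
  define E where "E = {\<mu> :: 'n \<Rightarrow>\<^sub>0 nat. (\<forall>j\<in>M. lookup \<mu> j = 0) \<and> (\<forall>j. j \<notin> M \<longrightarrow> lookup \<mu> j < e j)}"
  have E0: "0 \<in> E" using e(1) by (auto simp: E_def)
  have finE: "finite E"
  proof (rule finite_subset)
    show "E \<subseteq> (\<Union>d\<le>sum e (-M). {\<nu>. total_degree \<nu> = d})"
    proof
      fix \<mu> assume "\<mu> \<in> E"
      then have "total_degree \<mu> = (\<Sum>j\<in>-M. lookup \<mu> j)"
        unfolding total_degree_UNIV by (intro sum.mono_neutral_right) (auto simp: E_def)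
      also have "\<dots> \<le> sum e (-M)"
        using \<open>\<mu> \<in> E\<close> by (intro sum_mono) (auto simp: E_def intro: less_imp_le)
      finally show "\<mu> \<in> (\<Union>d\<le>sum e (-M). {\<nu>. total_degree \<nu> = d})" by auto
    qed
  qed (auto simp: finite_total_degree)
  define m :: "('n \<Rightarrow>\<^sub>0 nat) \<Rightarrow> ('n, 'k) mpoly" where "m \<mu> = single \<mu> 1" for \<mu>
  \<comment> \<open>The elements that, modulo \<open>P\<close> and up to a denominator in
    \<open>S\<close>, are K[M]-combinations of these monomials. The aim is that \<open>Z\<close> is
    everything.\<close>
  define Z where "Z = {s. \<exists>\<alpha>\<in>S. \<exists>r. (\<forall>\<mu>\<in>E. r \<mu> \<in> polys_in M) \<and> \<alpha> * s - (\<Sum>\<mu>\<in>E. r \<mu> * m \<mu>) \<in> P}"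
  have Z0: "0 \<in> Z"
    unfolding Z_def using S1 is_ideal_0[OF idP]
    by (auto intro!: bexI[of _ 1] exI[of _ "\<lambda>_. 0"])
  have Z_add: "a + b \<in> Z" if "a \<in> Z" "b \<in> Z" for a b
  proof -
    from that obtain \<alpha> r \<beta> s where *: "\<alpha> \<in> S" "\<beta> \<in> S" "\<forall>\<mu>\<in>E. r \<mu> \<in> polys_in M" "\<forall>\<mu>\<in>E. s \<mu> \<in> polys_in M"
      "\<alpha> * a - (\<Sum>\<mu>\<in>E. r \<mu> * m \<mu>) \<in> P" "\<beta> * b - (\<Sum>\<mu>\<in>E. s \<mu> * m \<mu>) \<in> P"
      by (auto simp: Z_def)
    have "\<beta> * (\<alpha> * a - (\<Sum>\<mu>\<in>E. r \<mu> * m \<mu>)) + \<alpha> * (\<beta> * b - (\<Sum>\<mu>\<in>E. s \<mu> * m \<mu>)) \<in> P"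
      using * idP by (intro is_ideal_add is_ideal_mult_left) auto
    also have "\<beta> * (\<alpha> * a - (\<Sum>\<mu>\<in>E. r \<mu> * m \<mu>)) + \<alpha> * (\<beta> * b - (\<Sum>\<mu>\<in>E. s \<mu> * m \<mu>)) =
       \<alpha> * \<beta> * (a + b) - (\<Sum>\<mu>\<in>E. (\<beta> * r \<mu> + \<alpha> * s \<mu>) * m \<mu>)"
      by (simp add: algebra_simps sum.distrib sum_distrib_left)
    finally have "\<alpha> * \<beta> * (a + b) - (\<Sum>\<mu>\<in>E. (\<beta> * r \<mu> + \<alpha> * s \<mu>) * m \<mu>) \<in> P" .
    moreover have "\<forall>\<mu>\<in>E. \<beta> * r \<mu> + \<alpha> * s \<mu> \<in> polys_in M"
      using * S_in by (auto intro!: polys_in_add polys_in_mult)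
    ultimately show ?thesis using S_mult[OF *(1,2)] unfolding Z_def
      by (auto intro!: bexI[of _ "\<alpha> * \<beta>"] exI[of _ "\<lambda>\<mu>. \<beta> * r \<mu> + \<alpha> * s \<mu>"])
  qed
  have Z_mult: "b * a \<in> Z" if "b \<in> polys_in M" "a \<in> Z" for a b
  proof -
    from that obtain \<alpha> r where *: "\<alpha> \<in> S" "\<forall>\<mu>\<in>E. r \<mu> \<in> polys_in M"
      "\<alpha> * a - (\<Sum>\<mu>\<in>E. r \<mu> * m \<mu>) \<in> P"
      by (auto simp: Z_def)
    have "b * (\<alpha> * a - (\<Sum>\<mu>\<in>E. r \<mu> * m \<mu>)) \<in> P"
      using * idP by (intro is_ideal_mult_left) auto
    also have "b * (\<alpha> * a - (\<Sum>\<mu>\<in>E. r \<mu> * m \<mu>)) = \<alpha> * (b * a) - (\<Sum>\<mu>\<in>E. (b * r \<mu>) * m \<mu>)"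
      by (simp add: algebra_simps sum_distrib_left)
    finally have "\<alpha> * (b * a) - (\<Sum>\<mu>\<in>E. (b * r \<mu>) * m \<mu>) \<in> P" .
    moreover have "\<forall>\<mu>\<in>E. b * r \<mu> \<in> polys_in M"
      using * that by (auto intro!: polys_in_mult)
    ultimately show ?thesis using * unfolding Z_def
      by (auto intro!: bexI[of _ \<alpha>] exI[of _ "\<lambda>\<mu>. b * r \<mu>"])
  qed
  have Z_sum: "sum f A \<in> Z" if "\<And>x. x \<in> A \<Longrightarrow> f x \<in> Z" for f :: "_ \<Rightarrow> ('n, 'k) mpoly" and A
    using that by (induction A rule: infinite_finite_induct) (auto intro: Z0 Z_add)
  have Z_cancel: "a \<in> Z" if "\<alpha> \<in> S" "\<alpha> * a - b \<in> P" "b \<in> Z" for \<alpha> a b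
  proof -
    from that obtain \<beta> r where *: "\<beta> \<in> S" "\<forall>\<mu>\<in>E. r \<mu> \<in> polys_in M"
      "\<beta> * b - (\<Sum>\<mu>\<in>E. r \<mu> * m \<mu>) \<in> P"
      by (auto simp: Z_def)
    have "\<beta> * (\<alpha> * a - b) + (\<beta> * b - (\<Sum>\<mu>\<in>E. r \<mu> * m \<mu>)) \<in> P"
      using * that idP by (intro is_ideal_add is_ideal_mult_left) auto
    also have "\<beta> * (\<alpha> * a - b) + (\<beta> * b - (\<Sum>\<mu>\<in>E. r \<mu> * m \<mu>)) = (\<beta> * \<alpha>) * a - (\<Sum>\<mu>\<in>E. r \<mu> * m \<mu>)"
      by (simp add: algebra_simps)
    finally show ?thesis using * S_mult[OF *(1) that(1)] unfolding Z_def by blast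
  qed
  have Z_m: "m \<mu> \<in> Z" if "\<mu> \<in> E" for \<mu>
    unfolding Z_def using S1 is_ideal_0[OF idP] that finE
    by (auto intro!: bexI[of _ 1] exI[of _ "\<lambda>\<nu>. if \<nu> = \<mu> then 1 else 0"]
        simp: if_distrib[of "\<lambda>x. x * _"] cong: if_cong)
  have var_m: "mpoly_var j ^ k * m \<mu> = m (single j k + \<mu>)" for j k \<mu>
    by (simp add: mpoly_var_power m_def mult_single)
  have Z_var_m: "mpoly_var j * m \<mu> \<in> Z" if \<mu>: "\<mu> \<in> E" for j \<mu>
  proof (cases "j \<in> M")
    case True
    then show ?thesis by (intro Z_mult Z_m \<mu>) auto
  next
    case j: False
    \<comment> \<open>The power of x_j is split off. After multiplication by x_j its exponent either
      is still below \<open>e j\<close>, or equals \<open>e j\<close> and is lowered by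
      \<open>h j\<close>, whose leading coefficient lies in \<open>S\<close>.\<close>
    define \<mu>' where "\<mu>' = \<mu> - single j (lookup \<mu> j)"
    have \<mu>'_in: "single j k + \<mu>' \<in> E" if "k < e j" for k
      using \<mu> that j by (auto simp: E_def \<mu>'_def lookup_add lookup_minus lookup_single when_def)
    have "mpoly_var j * m \<mu> = mpoly_var j ^ Suc (lookup \<mu> j) * m \<mu>'"
      using var_m[of j "lookup \<mu> j" \<mu>'] by (simp add: \<mu>'_def single_plus_minus mult.assoc)
    moreover have "mpoly_var j ^ k * m \<mu>' \<in> Z" if "k < e j" for k
      unfolding var_m by (intro Z_m \<mu>'_in that)
    moreover have "mpoly_var j ^ e j * m \<mu>' \<in> Z"
    proof (rule Z_cancel[OF lead_S[OF j]])
      have "{..e j} = insert (e j) {..<e j}" by auto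
      then have "h j * m \<mu>' = var_coeff j (e j) (h j) * (mpoly_var j ^ e j * m \<mu>') +
          (\<Sum>k<e j. var_coeff j k (h j) * (mpoly_var j ^ k * m \<mu>'))"
        by (subst e(3)[OF j, symmetric]) (simp add: distrib_right sum_distrib_right mult.assoc)
      then show "var_coeff j (e j) (h j) * (mpoly_var j ^ e j * m \<mu>') -
          (\<Sum>k<e j. - var_coeff j k (h j) * (mpoly_var j ^ k * m \<mu>')) \<in> P"
        using is_ideal_mult_right[OF idP h(1)[OF j], of "m \<mu>'"] by (simp add: sum_negf)
      show "(\<Sum>k<e j. - var_coeff j k (h j) * (mpoly_var j ^ k * m \<mu>')) \<in> Z"
        unfolding var_m using e(4)[OF j] by (intro Z_sum Z_mult Z_m \<mu>'_in polys_in_uminus) auto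
    qed
    moreover have "lookup \<mu> j < e j" using \<mu> j by (auto simp: E_def)
    ultimately show ?thesis by (metis Suc_lessI)
  qed
  have Z_var: "mpoly_var j * a \<in> Z" if a: "a \<in> Z" for j a
  proof -
    from a obtain \<alpha> r where *: "\<alpha> \<in> S" "\<forall>\<mu>\<in>E. r \<mu> \<in> polys_in M"
      "\<alpha> * a - (\<Sum>\<mu>\<in>E. r \<mu> * m \<mu>) \<in> P"
      by (auto simp: Z_def)
    show ?thesis
    proof (rule Z_cancel[OF *(1)])
      have "mpoly_var j * (\<alpha> * a - (\<Sum>\<mu>\<in>E. r \<mu> * m \<mu>)) \<in> P"
        by (rule is_ideal_mult_left[OF idP *(3)])
      also have "mpoly_var j * (\<alpha> * a - (\<Sum>\<mu>\<in>E. r \<mu> * m \<mu>)) =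
          \<alpha> * (mpoly_var j * a) - (\<Sum>\<mu>\<in>E. r \<mu> * (mpoly_var j * m \<mu>))"
        by (simp add: algebra_simps sum_distrib_left)
      finally show "\<alpha> * (mpoly_var j * a) - (\<Sum>\<mu>\<in>E. r \<mu> * (mpoly_var j * m \<mu>)) \<in> P" .
      show "(\<Sum>\<mu>\<in>E. r \<mu> * (mpoly_var j * m \<mu>)) \<in> Z"
        using * by (intro Z_sum Z_mult Z_var_m) auto
    qed
  qed
  have Z_mon: "\<forall>a\<in>Z. m \<nu> * a \<in> Z" for \<nu>
  proof (induction \<nu> rule: poly_mapping_single_induct)
    case zero
    then show ?case by (simp add: m_def)
  next
    case (single j k)
    show ?case
    proof
      fix a assume "a \<in> Z"
      then have "mpoly_var j ^ k * a \<in> Z"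
        by (induction k) (auto simp: mult.assoc intro: Z_var)
      then show "m (single j k) * a \<in> Z" by (simp add: m_def mpoly_var_power)
    qed
  next
    case (add \<mu> \<nu>)
    have "m (\<mu> + \<nu>) = m \<mu> * m \<nu>" by (simp add: m_def mult_single)
    then show ?case using add by (simp add: mult.assoc)
  qed
  have Z_all: "s \<in> Z" for s
  proof (induction s rule: poly_mapping_single_induct)
    case (single \<nu> c)
    have "single \<nu> c = single 0 c * (m \<nu> * m 0)"
      by (simp add: m_def mult_single)
    also have "\<dots> \<in> Z"
      by (rule Z_mult) (use Z_mon Z_m[OF E0] in auto)
    finally show ?case .
  qed (auto intro: Z0 Z_add)

  define J where "J = {p + s * t | p s. p \<in> P}"
  have idJ: "is_ideal J"
    unfolding is_ideal_def
  proof (intro conjI ballI allI)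
    show "0 \<in> J" unfolding J_def using is_ideal_0[OF idP] by (auto intro!: exI[of _ 0])
  next
    fix a b assume "a \<in> J" "b \<in> J"
    then obtain p r p' r' where "a = p + r * t" "b = p' + r' * t" "p \<in> P" "p' \<in> P"
      by (auto simp: J_def)
    then have "a + b = (p + p') + (r + r') * t" "p + p' \<in> P"
      using idP by (auto simp: algebra_simps is_idealD)
    then show "a + b \<in> J" unfolding J_def by blast
  next
    fix s a assume "a \<in> J"
    then obtain p r where "a = p + r * t" "p \<in> P"
      by (auto simp: J_def)
    then have "s * a = s * p + (s * r) * t" "s * p \<in> P"
      using idP by (auto simp: algebra_simps is_idealD)
    then show "s * a \<in> J" unfolding J_def by blast
  qed
  \<comment> \<open>If \<open>p + s * t\<close> were in \<open>S\<close>, express multiplication by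
    \<open>s\<close> on the generators by a matrix \<open>r\<close> with denominators
    \<open>\<alpha>\<close>. Modulo \<open>P\<close> the element \<open>p + s * t\<close> then acts
    as \<open>t\<close> times this matrix, with numerators in \<open>q\<close>. By
    \<open>nakayama_elimination\<close> some element of \<open>S\<close> sends the generator
    \<open>m 0 = 1\<close> into \<open>P\<close>, but \<open>S\<close> does not meet
    \<open>P\<close>.\<close>
  have "J \<inter> S = {}"
  proof (rule ccontr)
    assume "J \<inter> S \<noteq> {}"
    then obtain p s where \<beta>: "p + s * t \<in> S" "p \<in> P" by (auto simp: J_def)
    have "\<forall>\<mu>. \<exists>\<alpha> r. \<alpha> \<in> S \<and> (\<forall>\<nu>\<in>E. r \<nu> \<in> polys_in M) \<and> \<alpha> * (m \<mu> * s) - (\<Sum>\<nu>\<in>E. r \<nu> * m \<nu>) \<in> P"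
      using Z_all unfolding Z_def by blast
    from choice[OF this] obtain \<alpha> where "\<forall>\<mu>. \<exists>r. \<alpha> \<mu> \<in> S \<and> (\<forall>\<nu>\<in>E. r \<nu> \<in> polys_in M) \<and>
        \<alpha> \<mu> * (m \<mu> * s) - (\<Sum>\<nu>\<in>E. r \<nu> * m \<nu>) \<in> P" ..
    from choice[OF this] obtain r where "\<forall>\<mu>. \<alpha> \<mu> \<in> S \<and> (\<forall>\<nu>\<in>E. r \<mu> \<nu> \<in> polys_in M) \<and>
        \<alpha> \<mu> * (m \<mu> * s) - (\<Sum>\<nu>\<in>E. r \<mu> \<nu> * m \<nu>) \<in> P" ..
    then have \<alpha>: "\<And>\<mu>. \<alpha> \<mu> \<in> S" and r: "\<And>\<mu> \<nu>. \<nu> \<in> E \<Longrightarrow> r \<mu> \<nu> \<in> polys_in M"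
      and \<alpha>r: "\<And>\<mu>. \<alpha> \<mu> * (m \<mu> * s) - (\<Sum>\<nu>\<in>E. r \<mu> \<nu> * m \<nu>) \<in> P" by blast+
    have "\<forall>\<mu>\<in>E. \<exists>\<gamma>\<in>S. \<gamma> * m \<mu> \<in> P"
    proof (rule nakayama_elimination[where q = q and \<beta> = "\<lambda>\<mu>. \<alpha> \<mu> * (p + s * t)"
          and c = "\<lambda>\<mu> \<nu>. r \<mu> \<nu> * t", OF idP S1 S_mult S_diff q_add _ _ finE])
      fix \<mu> assume "\<mu> \<in> E"
      have "t * (\<alpha> \<mu> * (m \<mu> * s) - (\<Sum>\<nu>\<in>E. r \<mu> \<nu> * m \<nu>)) + \<alpha> \<mu> * m \<mu> * p \<in> P"
        using \<alpha>r \<beta>(2) idP by (intro is_ideal_add is_ideal_mult_left)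
      also have "t * (\<alpha> \<mu> * (m \<mu> * s) - (\<Sum>\<nu>\<in>E. r \<mu> \<nu> * m \<nu>)) + \<alpha> \<mu> * m \<mu> * p =
          \<alpha> \<mu> * (p + s * t) * m \<mu> - (\<Sum>\<nu>\<in>E. r \<mu> \<nu> * t * m \<nu>)"
        by (simp add: algebra_simps sum_distrib_left)
      finally show "\<alpha> \<mu> * (p + s * t) * m \<mu> - (\<Sum>\<nu>\<in>E. r \<mu> \<nu> * t * m \<nu>) \<in> P" .
    qed (use \<alpha> \<beta> r t_q in \<open>auto intro: S_mult q_mult S_in q_in\<close>)
    then show False using E0 S_P by (auto simp: m_def)
  qed
  then obtain Q where Q: "is_prime_ideal Q" "J \<subseteq> Q" "Q \<inter> S = {}"
    using ex_prime_ideal_disjoint[OF idJ S1 S_mult] by blast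
  have "P \<subseteq> J" unfolding J_def by (force intro: exI[of _ 0])
  moreover have "t \<in> J" unfolding J_def using is_ideal_0[OF idP] by (force intro: exI[of _ 1])
  moreover have "t \<notin> P"
  proof
    assume "t \<in> P"
    then have "t = 0" using ind q_in[OF t_q] by blast
    then have "mpoly_eval id (\<lambda>_. c + 1) t = 0" by simp
    then show False by (simp add: t_def ev.eval_diff ev.eval_var ev.eval_const)
  qed
  ultimately have "P \<subset> Q" using Q(2) by blast
  moreover have "f = 0" if f: "f \<in> Q" "f \<in> polys_in (M - {y})" for f
  proof (rule ccontr)
    assume "f \<noteq> 0"
    then obtain u where "mpoly_eval id u f \<noteq> 0" using mpoly_nonzero_eval by blast
    \<comment> \<open>\<open>f\<close> does not involve x_y, so a point where it is nonzero can be
      moved into the hyperplane. Thus \<open>f\<close> lies in \<open>S\<close>, which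
      \<open>Q\<close> avoids.\<close>
    moreover have "mpoly_eval id (u(y := c)) f = mpoly_eval id u f"
      by (rule ev.eval_cong_polys_in[OF f(2)]) auto
    ultimately have "\<not> van f" unfolding van_def by (metis fun_upd_same)
    then have "f \<in> S" using f(2) polys_in_mono[of "M - {y}" M] by (auto simp: S_def)
    then show False using Q(3) f(1) by blast
  qed
  ultimately show ?thesis using that Q(1) by blast
qed

text \<open>Each strict inclusion costs one independent variable. The chain begins with a prime that
  avoids the nonzero elements of K[M]; for \<open>r = 0\<close> the hypothesis says that
  \<open>J\<close> is a proper ideal.\<close>

lemma ex_prime_chain:
  fixes J :: "('n::finite, 'k::field_char_0) mpoly set"
  assumes "is_ideal J" "J \<inter> polys_in M \<subseteq> {0}" "card M = r"
  shows "\<exists>P. (\<forall>i\<le>r. is_prime_ideal (P i)) \<and> (\<forall>i<r. P i \<subset> P (Suc i)) \<and> J \<subseteq> P 0"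
  using assms
proof (induction r arbitrary: J M)
  case (0 J M)
  then have "J \<inter> (polys_in M - {0}) = {}" by blast
  then obtain P where "is_prime_ideal P" "J \<subseteq> P"
    using ex_prime_ideal_disjoint[of J "polys_in M - {0}"] 0
      mpoly_no_zero_divisors polys_in_mult by (metis DiffE DiffI empty_iff insert_iff polys_in_1 zero_neq_one)
  then show ?case by (intro exI[of _ "\<lambda>_. P"]) auto
next
  case (Suc r J M)
  then have "J \<inter> (polys_in M - {0}) = {}" by blast
  then obtain P where P: "is_prime_ideal P" "J \<subseteq> P" "P \<inter> (polys_in M - {0}) = {}"
    using ex_prime_ideal_disjoint[of J "polys_in M - {0}"] Suc.prems
      mpoly_no_zero_divisors polys_in_mult by (metis DiffE DiffI empty_iff insert_iff polys_in_1 zero_neq_one)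
  \<comment> \<open>\<open>prime_ideal_extend\<close> requires a maximal independent set, so
    \<open>M\<close> is enlarged to \<open>N\<close>. The variable that is given up is still taken
    from \<open>M\<close>: then \<open>M - {y}\<close> lies in \<open>N - {y}\<close> and has
    \<open>r\<close> elements.\<close>
  define F where "F = {N. M \<subseteq> N \<and> P \<inter> polys_in N \<subseteq> {0}}"
  have "finite F" "M \<in> F" using P(3) by (auto simp: F_def)
  then obtain N where N: "N \<in> F" "M \<subseteq> N" and Nmax: "\<And>N'. N' \<in> F \<Longrightarrow> N \<subseteq> N' \<Longrightarrow> N = N'"
    using finite_has_maximal2[of F M] by metis
  obtain y where y: "y \<in> M" using Suc.prems(3) by fastforce
  have ext: "\<exists>h. h \<in> P \<inter> polys_in (insert j N) \<and> h \<noteq> 0" if "j \<notin> N" for j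
  proof -
    have "insert j N \<notin> F" using Nmax[of "insert j N"] that by blast
    then show ?thesis using N(2) by (auto simp: F_def)
  qed
  have "P \<inter> polys_in N \<subseteq> {0}" "y \<in> N" using N y by (auto simp: F_def)
  from prime_ideal_extend[OF P(1) this ext]
  obtain Q where Q: "is_prime_ideal Q" "P \<subset> Q" "Q \<inter> polys_in (N - {y}) \<subseteq> {0}" .
  have "polys_in (M - {y}) \<subseteq> polys_in (N - {y})"
    by (rule polys_in_mono) (use N in auto)
  then have "Q \<inter> polys_in (M - {y}) \<subseteq> {0}" using Q(3) by blast
  moreover have "is_ideal Q" using Q(1) by (simp add: is_prime_ideal_def)
  moreover have "card (M - {y}) = r" using Suc.prems(3) y by simp
  ultimately have "\<exists>P. (\<forall>i\<le>r. is_prime_ideal (P i)) \<and> (\<forall>i<r. P i \<subset> P (Suc i)) \<and> Q \<subseteq> P 0"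
    by (intro Suc.IH)
  then obtain P' where P': "\<forall>i\<le>r. is_prime_ideal (P' i)" "\<forall>i<r. P' i \<subset> P' (Suc i)" "Q \<subseteq> P' 0"
    by blast
  show ?case
  proof (intro exI conjI allI impI)
    show "is_prime_ideal (case_nat P P' i)" if "i \<le> Suc r" for i
      using that P(1) P'(1) by (cases i) auto
    show "case_nat P P' i \<subset> case_nat P P' (Suc i)" if "i < Suc r" for i
      using that Q(2) P'(2,3) by (cases i) auto
    show "J \<subseteq> case_nat P P' 0" using P(2) by simp
  qed
qed

section \<open>Chains of primes in the quotient ring\<close>

lemma primeideal_quot:
  assumes P: "primeideal P R" and I: "ideal I R" and IP: "I \<subseteq> P"
  shows "primeideal ((+>\<^bsub>R\<^esub>) I ` P) (R Quot I)"
proof -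
  interpret P: primeideal P R by fact
  interpret I: ideal I R by fact
  have P_eq: "(\<Union>((+>\<^bsub>R\<^esub>) I ` P)) = P"
    using P.ideal_incl_iff[OF I P.is_ideal] IP by auto
  have idl: "ideal ((+>\<^bsub>R\<^esub>) I ` P) (R Quot I)"
    using bij_betwE[OF P.quot_ideal_correspondence[OF I]] P.is_ideal IP by blast
  have mem: "I +>\<^bsub>R\<^esub> a \<in> (+>\<^bsub>R\<^esub>) I ` P \<longleftrightarrow> a \<in> P" if "a \<in> carrier R" for a
  proof -
    have "(+>\<^bsub>R\<^esub>) I ` P \<subseteq> carrier (R Quot I)"
      using ideal.axioms(1)[OF idl] by (rule additive_subgroup.a_subset)
    then show ?thesis using P.canonical_proj_vimage_mem_iff[OF I _ that] P_eq by metis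
  qed
  have carr: "\<exists>a\<in>carrier R. A = I +>\<^bsub>R\<^esub> a" if "A \<in> carrier (R Quot I)" for A
    using that unfolding FactRing_def A_RCOSETS_def' by auto
  show ?thesis
  proof (rule primeidealI[OF idl])
    show "cring (R Quot I)" by (rule I.quotient_is_cring[OF P.is_cring])
    show "carrier (R Quot I) \<noteq> (+>\<^bsub>R\<^esub>) I ` P"
    proof
      assume *: "carrier (R Quot I) = (+>\<^bsub>R\<^esub>) I ` P"
      have "I +>\<^bsub>R\<^esub> a \<in> carrier (R Quot I)" if "a \<in> carrier R" for a
        using that unfolding FactRing_def A_RCOSETS_def' by auto
      then have "carrier R \<subseteq> P" using * mem by blast
      then show False using P.I_notcarr P.a_subset by blast
    qed
    fix A B
    assume A: "A \<in> carrier (R Quot I)" and B: "B \<in> carrier (R Quot I)"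
      and AB: "A \<otimes>\<^bsub>R Quot I\<^esub> B \<in> (+>\<^bsub>R\<^esub>) I ` P"
    obtain a b where ab: "a \<in> carrier R" "A = I +>\<^bsub>R\<^esub> a" "b \<in> carrier R" "B = I +>\<^bsub>R\<^esub> b"
      using carr A B by metis
    then have "I +>\<^bsub>R\<^esub> (a \<otimes>\<^bsub>R\<^esub> b) \<in> (+>\<^bsub>R\<^esub>) I ` P"
      using AB I.rcoset_mult_add[of a b] by (simp add: FactRing_def)
    then have "a \<in> P \<or> b \<in> P" using mem[of "a \<otimes>\<^bsub>R\<^esub> b"] ab P.I_prime by simp
    then show "A \<in> (+>\<^bsub>R\<^esub>) I ` P \<or> B \<in> (+>\<^bsub>R\<^esub>) I ` P" using ab by blast
  qed
qed

text \<open>Inclusions stay strict in the quotient because the correspondence between its ideals and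
  the ideals above \<open>I\<close> is injective.\<close>

lemma ideal_dim_ge:
  fixes I :: "('n, 'k::comm_ring_1) mpoly set"
  assumes I: "is_ideal I" and P: "\<And>i. i \<le> r \<Longrightarrow> is_prime_ideal (P i)" "\<And>i. i < r \<Longrightarrow> P i \<subset> P (Suc i)" "I \<subseteq> P 0"
  shows "enat r \<le> ideal_dim I"
proof -
  define R where "R = (mpoly_ring :: ('n, 'k) mpoly ring)"
  have idI: "ideal I R" using I by (simp add: R_def ideal_iff_is_ideal)
  interpret R: ring R unfolding R_def ..
  have IP: "I \<subseteq> P i" if "i \<le> r" for i
    using that
  proof (induction i)
    case (Suc i)
    then show ?case using P(2)[of i] by auto
  qed (rule P(3))
  have prime: "primeideal (P i) R" if "i \<le> r" for i
    using P(1)[OF that] by (simp add: R_def primeideal_iff_is_prime_ideal)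
  have inj: "inj_on (\<lambda>J. (+>\<^bsub>R\<^esub>) I ` J) {J. ideal J R \<and> I \<subseteq> J}"
    using R.quot_ideal_correspondence[OF idI] by (rule bij_betw_imp_inj_on)
  have "\<exists>Q. (\<forall>i\<le>r. primeideal (Q i) (R Quot I)) \<and> (\<forall>i<r. Q i \<subset> Q (Suc i))"
  proof (intro exI conjI allI impI)
    show "primeideal ((+>\<^bsub>R\<^esub>) I ` P i) (R Quot I)" if "i \<le> r" for i
      using primeideal_quot[OF prime idI IP] that by blast
    fix i assume i: "i < r"
    have "(+>\<^bsub>R\<^esub>) I ` P i \<noteq> (+>\<^bsub>R\<^esub>) I ` P (Suc i)"
    proof
      assume "(+>\<^bsub>R\<^esub>) I ` P i = (+>\<^bsub>R\<^esub>) I ` P (Suc i)"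
      then have "P i = P (Suc i)"
        using inj_onD[OF inj, of "P i" "P (Suc i)"] prime[of i] prime[of "Suc i"] IP[of i] IP[of "Suc i"] i
        by (auto simp: primeideal_def)
      then show False using P(2)[OF i] by simp
    qed
    then show "(+>\<^bsub>R\<^esub>) I ` P i \<subset> (+>\<^bsub>R\<^esub>) I ` P (Suc i)" using P(2)[OF i] by blast
  qed
  then show ?thesis
    unfolding ideal_dim_def krull_dim_def R_def by (intro Sup_upper) blast
qed

section \<open>Initial ideals\<close>

abbreviation weight_part :: "real ^ 'n::finite \<Rightarrow> real \<Rightarrow> ('n, 'k::comm_ring_1) mpoly \<Rightarrow> ('n, 'k) mpoly"
  where "weight_part \<omega> a \<equiv> restrict_terms (\<lambda>\<nu>. weight \<omega> \<nu> = a)"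

lemma graded_idealD:
  assumes "graded_ideal I"
  shows graded_ideal_is_ideal: "is_ideal I"
    and graded_ideal_degree_part: "f \<in> I \<Longrightarrow> degree_part d f \<in> I"
  using assms by (auto simp: graded_ideal_def ideal_iff_is_ideal)

lemma initial_form_eq_weight_part:
  assumes "\<And>\<nu>. \<nu> \<in> keys f \<Longrightarrow> a \<le> weight \<omega> \<nu>" "weight_part \<omega> a f \<noteq> 0"
  shows "initial_form \<omega> f = weight_part \<omega> a f"
proof -
  obtain \<mu> where "\<mu> \<in> keys f" "weight \<omega> \<mu> = a"
    using assms(2) restrict_terms_eq_0[of f "\<lambda>\<nu>. weight \<omega> \<nu> = a"] by blast
  then show ?thesis
    unfolding initial_form_def using assms(1) by (intro restrict_terms_cong) force
qed

lemma initial_form_0 [simp]: "initial_form \<omega> 0 = 0"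
  by (simp add: initial_form_def)

lemma obtain_min_weight:
  assumes "f \<noteq> 0"
  obtains a where "\<And>\<nu>. \<nu> \<in> keys f \<Longrightarrow> a \<le> weight \<omega> \<nu>" "weight_part \<omega> a f \<noteq> 0"
    "initial_form \<omega> f = weight_part \<omega> a f"
proof -
  define a where "a = Min (weight \<omega> ` keys f)"
  have "keys f \<noteq> {}" using assms by simp
  then have "a \<in> weight \<omega> ` keys f" unfolding a_def by (intro Min_in) auto
  then obtain \<mu> where \<mu>: "\<mu> \<in> keys f" "weight \<omega> \<mu> = a" by blast
  have le: "a \<le> weight \<omega> \<nu>" if "\<nu> \<in> keys f" for \<nu>
    unfolding a_def using that by (intro Min_le) auto
  have "\<mu> \<in> keys (weight_part \<omega> a f)" using \<mu> by (simp add: keys_restrict_terms)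
  then have "weight_part \<omega> a f \<noteq> 0" by auto
  then show ?thesis using that le initial_form_eq_weight_part[of f a \<omega>] by blast
qed

text \<open>The component of weight \<open>a\<close> and degree \<open>d\<close> of the initial
  ideal, described without generators. The weight \<open>a\<close> need not be attained, which
  admits 0 and gives closure under sums.\<close>

definition initial_piece ::
    "real ^ 'n::finite \<Rightarrow> ('n, 'k::comm_ring_1) mpoly set \<Rightarrow> real \<Rightarrow> nat \<Rightarrow> ('n, 'k) mpoly set"
  where "initial_piece \<omega> I a d =
    {weight_part \<omega> a f | f. f \<in> I \<and> homogeneous d f \<and> (\<forall>\<nu>\<in>keys f. a \<le> weight \<omega> \<nu>)}"

lemma is_ideal_genideal: "is_ideal (genideal mpoly_ring A)"
  for A :: "('n, 'k::comm_ring_1) mpoly set"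
proof -
  interpret R: ring "mpoly_ring :: ('n, 'k) mpoly ring" ..
  show ?thesis
    unfolding ideal_iff_is_ideal[symmetric] by (rule R.genideal_ideal) simp
qed

lemma genideal_subset: "is_ideal J \<Longrightarrow> A \<subseteq> J \<Longrightarrow> genideal mpoly_ring A \<subseteq> J"
  unfolding genideal_def by (auto simp: ideal_iff_is_ideal)

lemma is_ideal_initial_ideal: "is_ideal (initial_ideal \<omega> I)"
  unfolding initial_ideal_def by (rule is_ideal_genideal)

lemma initial_form_in_initial_ideal: "f \<in> I \<Longrightarrow> initial_form \<omega> f \<in> initial_ideal \<omega> I"
  unfolding initial_ideal_def genideal_def by blast

lemma weight_part_in_initial_ideal:
  assumes "f \<in> I" "\<And>\<nu>. \<nu> \<in> keys f \<Longrightarrow> a \<le> weight \<omega> \<nu>"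
  shows "weight_part \<omega> a f \<in> initial_ideal \<omega> I"
proof (cases "weight_part \<omega> a f = 0")
  case True
  then show ?thesis using is_ideal_0[OF is_ideal_initial_ideal] by metis
next
  case False
  then show ?thesis
    using initial_form_eq_weight_part[of f a \<omega>] assms initial_form_in_initial_ideal[OF assms(1)] by metis
qed

lemma initial_piece_0: "is_ideal I \<Longrightarrow> 0 \<in> initial_piece \<omega> I a d"
  unfolding initial_piece_def by (auto intro!: exI[of _ 0] simp: is_ideal_0)

lemma initial_piece_add:
  assumes "is_ideal I" "g \<in> initial_piece \<omega> I a d" "h \<in> initial_piece \<omega> I a d"
  shows "g + h \<in> initial_piece \<omega> I a d"
proof -
  from assms obtain f f' where "g = weight_part \<omega> a f" "h = weight_part \<omega> a f'"
    "f \<in> I" "homogeneous d f" "\<forall>\<nu>\<in>keys f. a \<le> weight \<omega> \<nu>"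
    "f' \<in> I" "homogeneous d f'" "\<forall>\<nu>\<in>keys f'. a \<le> weight \<omega> \<nu>"
    by (auto simp: initial_piece_def)
  then show ?thesis
    unfolding initial_piece_def using keys_add[of f f'] assms(1)
    by (auto intro!: exI[of _ "f + f'"] simp: restrict_terms_add homogeneous_add is_ideal_add)
qed

lemma initial_piece_single_mult:
  assumes "is_ideal I" "g \<in> initial_piece \<omega> I a d"
  shows "single \<mu> c * g \<in> initial_piece \<omega> I (weight \<omega> \<mu> + a) (total_degree \<mu> + d)"
proof -
  from assms obtain f where f: "g = weight_part \<omega> a f"
    "f \<in> I" "homogeneous d f" "\<forall>\<nu>\<in>keys f. a \<le> weight \<omega> \<nu>"
    by (auto simp: initial_piece_def)
  have "weight_part \<omega> (weight \<omega> \<mu> + a) (single \<mu> c * f) = single \<mu> c * g"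
    by (simp add: restrict_terms_single_mult weight_add f(1))
  moreover have "\<forall>\<nu>\<in>keys (single \<mu> c * f). weight \<omega> \<mu> + a \<le> weight \<omega> \<nu>"
    using keys_single_mult[of \<mu> c f] f(4) by (auto simp: weight_add)
  moreover have "homogeneous (total_degree \<mu> + d) (single \<mu> c * f)"
    by (rule homogeneous_mult) (use f in \<open>auto simp: homogeneous_def\<close>)
  ultimately show ?thesis
    unfolding initial_piece_def using f(2) assms(1) by (auto intro!: exI[of _ "single \<mu> c * f"] simp: is_idealD)
qed

text \<open>Pieces of equal weight and degree are added by adding their lifts, and multiplication by
  a term shifts both indices. So the right-hand side is an ideal; it contains the initial forms
  because \<open>I\<close> is graded. Conversely, a piece is 0 or an initial form. The gain is that
  an element of the initial ideal homogeneous in weight and degree is the lowest part of a single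
  element of \<open>I\<close>, not merely a combination of such parts.\<close>

theorem initial_ideal_eq:
  assumes "graded_ideal I"
  shows "initial_ideal \<omega> I =
    {h. \<forall>a d. restrict_terms (\<lambda>\<nu>. weight \<omega> \<nu> = a \<and> total_degree \<nu> = d) h \<in> initial_piece \<omega> I a d}"
    (is "_ = ?Z")
proof
  note I = graded_ideal_is_ideal[OF assms]
  show "initial_ideal \<omega> I \<subseteq> ?Z"
    unfolding initial_ideal_def
  proof (rule genideal_subset)
    show "is_ideal ?Z"
      unfolding is_ideal_def
    proof (intro conjI ballI allI)
      show "0 \<in> ?Z" using initial_piece_0[OF I] by simp
    next
      fix g h assume "g \<in> ?Z" "h \<in> ?Z"
      then show "g + h \<in> ?Z" by (simp add: restrict_terms_add initial_piece_add[OF I])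
    next
      fix r h assume h: "h \<in> ?Z"
      show "r * h \<in> ?Z"
      proof (induction r rule: poly_mapping_single_induct)
        case (single \<mu> c)
        have "restrict_terms (\<lambda>\<nu>. weight \<omega> \<nu> = a \<and> total_degree \<nu> = d) (single \<mu> c * h) \<in> initial_piece \<omega> I a d"
          for a d
        \<comment> \<open>Subtraction of degrees is truncated, so a factor that alone exceeds degree
          \<open>d\<close> is treated apart; its component is 0.\<close>
        proof (cases "total_degree \<mu> \<le> d")
          case True
          have "restrict_terms (\<lambda>\<nu>. weight \<omega> \<nu> = a \<and> total_degree \<nu> = d) (single \<mu> c * h) =
            single \<mu> c * restrict_terms (\<lambda>\<nu>. weight \<omega> \<nu> = a - weight \<omega> \<mu> \<and> total_degree \<nu> = d - total_degree \<mu>) h"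
            unfolding restrict_terms_single_mult weight_add total_degree_add
            using True by (intro arg_cong2[of _ _ _ _ "(*)"] refl restrict_terms_cong) auto
          also have "\<dots> \<in> initial_piece \<omega> I (weight \<omega> \<mu> + (a - weight \<omega> \<mu>)) (total_degree \<mu> + (d - total_degree \<mu>))"
            using h by (intro initial_piece_single_mult[OF I]) simp
          finally show ?thesis using True by simp
        next
          case False
          have "restrict_terms (\<lambda>\<nu>. weight \<omega> \<nu> = a \<and> total_degree \<nu> = d) (single \<mu> c * h) = 0"
            using False keys_single_mult[of \<mu> c h]
            by (intro restrict_terms_eq_0) (auto simp: total_degree_add)
          then show ?thesis using initial_piece_0[OF I] by simp
        qed
        then show ?case by simp
      qed (use initial_piece_0[OF I] in \<open>auto simp: restrict_terms_add distrib_right initial_piece_add[OF I]\<close>)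
    qed
    show "initial_form \<omega> ` I \<subseteq> ?Z"
    proof safe
      fix f a d assume f: "f \<in> I"
      show "restrict_terms (\<lambda>\<nu>. weight \<omega> \<nu> = a \<and> total_degree \<nu> = d) (initial_form \<omega> f) \<in> initial_piece \<omega> I a d"
      proof (cases "f = 0")
        case False
        then obtain b where b: "\<And>\<nu>. \<nu> \<in> keys f \<Longrightarrow> b \<le> weight \<omega> \<nu>" "initial_form \<omega> f = weight_part \<omega> b f"
          by (rule obtain_min_weight[where \<omega> = \<omega>]) blast
        show ?thesis
        proof (cases "a = b")
          case True
          have "restrict_terms (\<lambda>\<nu>. weight \<omega> \<nu> = a \<and> total_degree \<nu> = d) (initial_form \<omega> f)
              = weight_part \<omega> a (degree_part d f)"
            unfolding b(2) restrict_terms_restrict_terms by (rule restrict_terms_cong) (use True in auto)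
          then show ?thesis
            unfolding initial_piece_def using True b f
            by (auto intro!: exI[of _ "degree_part d f"] graded_ideal_degree_part[OF assms]
                homogeneous_degree_part simp: keys_restrict_terms)
        next
          case False
          then show ?thesis
            unfolding b(2) restrict_terms_restrict_terms
            using initial_piece_0[OF I] by (subst restrict_terms_eq_0) auto
        qed
      qed (use initial_piece_0[OF I] in auto)
    qed
  qed
  show "?Z \<subseteq> initial_ideal \<omega> I"
  proof
    fix h assume h: "h \<in> ?Z"
    have "initial_piece \<omega> I a d \<subseteq> initial_ideal \<omega> I" for a d
      unfolding initial_piece_def by (auto intro: weight_part_in_initial_ideal)
    then have "restrict_terms (\<lambda>\<nu>. (weight \<omega> \<nu>, total_degree \<nu>) = p) h \<in> initial_ideal \<omega> I" for p
      using h by (cases p, simp) blast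
    then have "(\<Sum>p\<in>(\<lambda>\<nu>. (weight \<omega> \<nu>, total_degree \<nu>)) ` keys h.
        restrict_terms (\<lambda>\<nu>. (weight \<omega> \<nu>, total_degree \<nu>) = p) h) \<in> initial_ideal \<omega> I"
      by (intro is_ideal_sum[OF is_ideal_initial_ideal])
    then show "h \<in> initial_ideal \<omega> I"
      by (subst (asm) sum_restrict_terms) auto
  qed
qed

context
  fixes I :: "('n::finite, 'k::comm_ring_1) mpoly set"
  assumes graded: "graded_ideal I"
begin

lemma weight_part_initial_ideal:
  assumes "h \<in> initial_ideal \<omega> I"
  shows "weight_part \<omega> b h \<in> initial_ideal \<omega> I"
  unfolding initial_ideal_eq[OF graded]
proof safe
  fix a d
  show "restrict_terms (\<lambda>\<nu>. weight \<omega> \<nu> = a \<and> total_degree \<nu> = d) (weight_part \<omega> b h) \<in> initial_piece \<omega> I a d"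
  proof (cases "a = b")
    case True
    then have "restrict_terms (\<lambda>\<nu>. weight \<omega> \<nu> = a \<and> total_degree \<nu> = d) (weight_part \<omega> b h) =
        restrict_terms (\<lambda>\<nu>. weight \<omega> \<nu> = a \<and> total_degree \<nu> = d) h"
      unfolding restrict_terms_restrict_terms by (intro restrict_terms_cong) auto
    then show ?thesis using assms unfolding initial_ideal_eq[OF graded] by simp
  next
    case False
    then show ?thesis
      unfolding restrict_terms_restrict_terms
      using initial_piece_0[OF graded_ideal_is_ideal[OF graded]] by (subst restrict_terms_eq_0) auto
  qed
qed

lemma degree_part_initial_ideal:
  assumes "h \<in> initial_ideal \<omega> I"
  shows "degree_part e h \<in> initial_ideal \<omega> I"
  unfolding initial_ideal_eq[OF graded]
proof safe
  fix a d
  show "restrict_terms (\<lambda>\<nu>. weight \<omega> \<nu> = a \<and> total_degree \<nu> = d) (degree_part e h) \<in> initial_piece \<omega> I a d"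
  proof (cases "e = d")
    case True
    then have "restrict_terms (\<lambda>\<nu>. weight \<omega> \<nu> = a \<and> total_degree \<nu> = d) (degree_part e h) =
        restrict_terms (\<lambda>\<nu>. weight \<omega> \<nu> = a \<and> total_degree \<nu> = d) h"
      unfolding restrict_terms_restrict_terms by (intro restrict_terms_cong) auto
    then show ?thesis using assms unfolding initial_ideal_eq[OF graded] by simp
  next
    case False
    then show ?thesis
      unfolding restrict_terms_restrict_terms
      using initial_piece_0[OF graded_ideal_is_ideal[OF graded]] by (subst restrict_terms_eq_0) auto
  qed
qed

lemma initial_ideal_lift:
  assumes "h \<in> initial_ideal \<omega> I" "homogeneous d h" "\<And>\<nu>. \<nu> \<in> keys h \<Longrightarrow> weight \<omega> \<nu> = a"
  obtains f where "f \<in> I" "homogeneous d f" "\<And>\<nu>. \<nu> \<in> keys f \<Longrightarrow> a \<le> weight \<omega> \<nu>" "weight_part \<omega> a f = h"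
proof -
  have "restrict_terms (\<lambda>\<nu>. weight \<omega> \<nu> = a \<and> total_degree \<nu> = d) h = h"
    by (rule restrict_terms_id) (use assms in \<open>auto simp: homogeneous_def\<close>)
  then have "h \<in> initial_piece \<omega> I a d"
    using assms(1) unfolding initial_ideal_eq[OF graded] by (metis (mono_tags, lifting) mem_Collect_eq)
  then show ?thesis using that unfolding initial_piece_def by blast
qed

end

lemma initial_form_eq_0_iff [simp]: "initial_form \<omega> f = 0 \<longleftrightarrow> f = 0"
  using obtain_min_weight[of f \<omega>] by (metis initial_form_0)

lemma keys_initial_form: "keys (initial_form \<omega> f) \<subseteq> keys f"
  by (auto simp: initial_form_def keys_restrict_terms)

section \<open>Standard monomials and Hilbert functions\<close>

definition independent_mod :: "('n, 'k::comm_ring_1) mpoly set \<Rightarrow> ('n \<Rightarrow>\<^sub>0 nat) set \<Rightarrow> bool"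
  where "independent_mod W B \<longleftrightarrow> (\<forall>b\<in>W. keys b \<subseteq> B \<longrightarrow> b = 0)"

definition spanning_mod ::
    "('n, 'k::comm_ring_1) mpoly set \<Rightarrow> ('n \<Rightarrow>\<^sub>0 nat) set \<Rightarrow> ('n \<Rightarrow>\<^sub>0 nat) set \<Rightarrow> bool"
  where "spanning_mod W B C \<longleftrightarrow> (\<forall>s. keys s \<subseteq> C \<longrightarrow> (\<exists>w\<in>W. \<exists>b. keys b \<subseteq> B \<and> s = w + b))"

lemma spanning_mod_trans:
  fixes W :: "('n, 'k::comm_ring_1) mpoly set"
  assumes "is_ideal W" "spanning_mod W B C" "spanning_mod W B' B"
  shows "spanning_mod W B' C"
  unfolding spanning_mod_def
proof (intro allI impI)
  fix s :: "('n, 'k) mpoly" assume "keys s \<subseteq> C"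
  then obtain w b where "w \<in> W" "keys b \<subseteq> B" "s = w + b"
    using assms(2) by (auto simp: spanning_mod_def)
  moreover from this obtain w' b' where "w' \<in> W" "keys b' \<subseteq> B'" "b = w' + b'"
    using assms(3) by (auto simp: spanning_mod_def)
  ultimately show "\<exists>w\<in>W. \<exists>b. keys b \<subseteq> B' \<and> s = w + b"
    using is_ideal_add[OF assms(1)] by (intro bexI[of _ "w + w'"] exI[of _ b']) (auto simp: add.assoc)
qed

text \<open>A maximal independent subset of \<open>C\<close> spans, since any other monomial occurs
  with an invertible coefficient in a relation. With all exponents of one degree as \<open>C\<close>
  this yields standard monomials; with a spanning set as \<open>C\<close> it extracts a basis from
  it.\<close>

lemma ex_monomial_basis_mod:
  fixes W :: "('n, 'k::field) mpoly set"
  assumes W: "is_ideal W" and "finite C"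
  obtains B where "B \<subseteq> C" "independent_mod W B" "spanning_mod W B C"
proof -
  define F where "F = {B. B \<subseteq> C \<and> independent_mod W B}"
  have "finite F" "{} \<in> F" using assms(2) by (auto simp: F_def independent_mod_def)
  then obtain B where B: "B \<in> F" and max: "\<And>B'. B' \<in> F \<Longrightarrow> B \<subseteq> B' \<Longrightarrow> B = B'"
    using finite_has_maximal2[of F "{}"] by metis
  have single: "\<exists>w\<in>W. \<exists>b. keys b \<subseteq> B \<and> single \<nu> 1 = w + b" if \<nu>: "\<nu> \<in> C" for \<nu>
  proof (cases "\<nu> \<in> B")
    case True
    then show ?thesis using is_ideal_0[OF W] by (intro bexI[of _ 0] exI[of _ "single \<nu> 1"]) auto
  next
    case False
    then have "insert \<nu> B \<notin> F" using max[of "insert \<nu> B"] by blast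
    then obtain b where b: "b \<in> W" "keys b \<subseteq> insert \<nu> B" "b \<noteq> 0"
      using B \<nu> by (auto simp: F_def independent_mod_def)
    define c where "c = lookup b \<nu>"
    have "c \<noteq> 0"
    proof
      assume "c = 0"
      then have "keys b \<subseteq> B" using b(2) by (auto simp: c_def in_keys_iff)
      then show False using B b by (auto simp: F_def independent_mod_def)
    qed
    define w where "w = single 0 (inverse c) * b"
    have look: "lookup w \<mu> = inverse c * lookup b \<mu>" for \<mu>
      using lookup_single_mult_add[of 0 "inverse c" b \<mu>] by (simp add: w_def)
    have "keys (single \<nu> 1 - w) \<subseteq> B"
    proof
      fix \<mu> assume "\<mu> \<in> keys (single \<nu> 1 - w)"
      then show "\<mu> \<in> B"
        using b(2) \<open>c \<noteq> 0\<close>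
        by (cases "\<mu> = \<nu>") (auto simp: in_keys_iff lookup_minus look lookup_single when_def c_def)
    qed
    moreover have "w \<in> W" unfolding w_def using W b(1) by (rule is_ideal_mult_left)
    ultimately show ?thesis by (intro bexI[of _ w] exI[of _ "single \<nu> 1 - w"]) auto
  qed
  have "spanning_mod W B C"
    unfolding spanning_mod_def
  proof (intro allI impI)
    fix s :: "('n, 'k) mpoly" assume s: "keys s \<subseteq> C"
    have "\<forall>\<nu>\<in>keys s. \<exists>w b. w \<in> W \<and> keys b \<subseteq> B \<and> single \<nu> 1 = w + b"
      using single s by blast
    then obtain w b where wb: "\<And>\<nu>. \<nu> \<in> keys s \<Longrightarrow> w \<nu> \<in> W" "\<And>\<nu>. \<nu> \<in> keys s \<Longrightarrow> keys (b \<nu>) \<subseteq> B"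
      "\<And>\<nu>. \<nu> \<in> keys s \<Longrightarrow> single \<nu> 1 = w \<nu> + b \<nu>" by metis
    have "s = (\<Sum>\<nu>\<in>keys s. single 0 (lookup s \<nu>) * single \<nu> 1)"
      by (simp add: mult_single poly_mapping_sum_single)
    also have "\<dots> = (\<Sum>\<nu>\<in>keys s. single 0 (lookup s \<nu>) * w \<nu>) + (\<Sum>\<nu>\<in>keys s. single 0 (lookup s \<nu>) * b \<nu>)"
      by (simp add: wb(3) distrib_left sum.distrib)
    finally have "s = (\<Sum>\<nu>\<in>keys s. single 0 (lookup s \<nu>) * w \<nu>) + (\<Sum>\<nu>\<in>keys s. single 0 (lookup s \<nu>) * b \<nu>)" .
    moreover have "(\<Sum>\<nu>\<in>keys s. single 0 (lookup s \<nu>) * w \<nu>) \<in> W"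
      using wb(1) by (intro is_ideal_sum[OF W] is_ideal_mult_left[OF W])
    moreover have "keys (single 0 (lookup s \<nu>) * b \<nu>) \<subseteq> B" if "\<nu> \<in> keys s" for \<nu>
      using keys_single_mult[of 0 "lookup s \<nu>" "b \<nu>"] wb(2)[OF that] by auto
    then have "keys (\<Sum>\<nu>\<in>keys s. single 0 (lookup s \<nu>) * b \<nu>) \<subseteq> B"
      using keys_sum[of "\<lambda>\<nu>. single 0 (lookup s \<nu>) * b \<nu>" "keys s"] by blast
    ultimately show "\<exists>w\<in>W. \<exists>b. keys b \<subseteq> B \<and> s = w + b" by blast
  qed
  then show ?thesis using that B by (auto simp: F_def)
qed

text \<open>The initial form of a nonzero relation in \<open>I\<close> is a nonzero relation with no
  new exponents. Together with \<open>spanning_mod_ideal\<close> this makes standard monomials a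
  basis modulo \<open>I\<close>, whatever the weight.\<close>

lemma independent_mod_ideal:
  assumes "independent_mod (initial_ideal \<omega> I) B"
  shows "independent_mod I B"
  unfolding independent_mod_def
proof (intro ballI impI)
  fix f assume "f \<in> I" "keys f \<subseteq> B"
  then have "initial_form \<omega> f = 0"
    using assms initial_form_in_initial_ideal[of f I \<omega>] keys_initial_form[of \<omega> f]
    unfolding independent_mod_def by blast
  then show "f = 0" by simp
qed

text \<open>Division with remainder: the part of lowest weight is removed by subtracting an element
  of \<open>I\<close> and a combination of exponents in \<open>B\<close>, which raises the lowest
  weight.\<close>

lemma spanning_mod_ideal:
  fixes I :: "('n::finite, 'k::comm_ring_1) mpoly set"
  assumes I: "graded_ideal I" and span: "spanning_mod (initial_ideal \<omega> I) B {\<nu>. total_degree \<nu> = d}"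
    and B: "B \<subseteq> {\<nu>. total_degree \<nu> = d}"
  shows "spanning_mod I B {\<nu>. total_degree \<nu> = d}"
proof -
  have idI: "is_ideal I" by (rule graded_ideal_is_ideal[OF I])
  have "\<exists>f\<in>I. \<exists>b. keys b \<subseteq> B \<and> s = f + b" if "homogeneous d s" for s
    using that
  \<comment> \<open>Real weights are not well ordered; what decreases is the number of exponents of
    degree \<open>d\<close> whose weight is at least the lowest weight in \<open>s\<close>.\<close>
  proof (induction "card {\<nu>. total_degree \<nu> = d \<and> (\<exists>\<mu>\<in>keys s. weight \<omega> \<mu> \<le> weight \<omega> \<nu>)}"
      arbitrary: s rule: less_induct)
    case less
    show ?case
    proof (cases "s = 0")
      case True
      then show ?thesis using is_ideal_0[OF idI] by (intro bexI[of _ 0] exI[of _ 0]) auto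
    next
      case False
      then obtain a where a: "\<And>\<nu>. \<nu> \<in> keys s \<Longrightarrow> a \<le> weight \<omega> \<nu>" "weight_part \<omega> a s \<noteq> 0"
        using obtain_min_weight[of s \<omega>] by metis
      have "keys (weight_part \<omega> a s) \<subseteq> {\<nu>. total_degree \<nu> = d}"
        using less.prems by (auto simp: homogeneous_def keys_restrict_terms)
      then obtain w b where wb: "w \<in> initial_ideal \<omega> I" "keys b \<subseteq> B" "weight_part \<omega> a s = w + b"
        using span unfolding spanning_mod_def by blast
      have bd: "homogeneous d b" using wb(2) B by (auto simp: homogeneous_def)
      \<comment> \<open>\<open>w\<close> and \<open>b\<close> may contain weights other than
        \<open>a\<close>. Their parts of weight \<open>a\<close> still add up to the lowest part of
        \<open>s\<close>, and \<open>w'\<close>, being homogeneous in weight and degree, lifts to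
        \<open>I\<close>.\<close>
      define w' b' where "w' = weight_part \<omega> a w" and "b' = weight_part \<omega> a b"
      have sum: "weight_part \<omega> a s = w' + b'"
        using arg_cong[OF wb(3), of "weight_part \<omega> a"]
        by (simp add: w'_def b'_def restrict_terms_add restrict_terms_restrict_terms)
      have b': "homogeneous d b'" unfolding b'_def by (rule homogeneous_restrict_terms[OF bd])
      have "w' = weight_part \<omega> a s - b'" using sum by simp
      then have w'd: "homogeneous d w'"
        using less.prems b' by (auto intro: homogeneous_diff homogeneous_restrict_terms)
      have "w' \<in> initial_ideal \<omega> I"
        unfolding w'_def by (rule weight_part_initial_ideal[OF I wb(1)])
      then obtain f where f: "f \<in> I" "homogeneous d f" "\<And>\<nu>. \<nu> \<in> keys f \<Longrightarrow> a \<le> weight \<omega> \<nu>"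
          "weight_part \<omega> a f = w'"
        by (rule initial_ideal_lift[OF I _ w'd, where \<omega> = \<omega> and a = a])
          (auto simp: w'_def keys_restrict_terms)
      define s' where "s' = s - f - b'"
      have s'd: "homogeneous d s'"
        unfolding s'_def using less.prems f b' by (intro homogeneous_diff) auto
      have "weight_part \<omega> a s' = 0"
        using sum f(4) by (simp add: s'_def restrict_terms_diff b'_def restrict_terms_restrict_terms)
      then have ne: "weight \<omega> \<nu> \<noteq> a" if "\<nu> \<in> keys s'" for \<nu>
        using that by (metis (mono_tags, lifting) keys_restrict_terms keys_zero empty_iff mem_Collect_eq)
      have ge: "a \<le> weight \<omega> \<nu>" if "\<nu> \<in> keys s'" for \<nu>
        using that a(1) f(3) keys_diff[of "s - f" b'] keys_diff[of s f]
        by (auto simp: s'_def b'_def keys_restrict_terms)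
      have gt: "a < weight \<omega> \<nu>" if "\<nu> \<in> keys s'" for \<nu>
        using ge[OF that] ne[OF that] by simp
      obtain \<mu> where \<mu>: "\<mu> \<in> keys s" "weight \<omega> \<mu> = a"
        using a(2) restrict_terms_eq_0[of s "\<lambda>\<nu>. weight \<omega> \<nu> = a"] by blast
      have "{\<nu>. total_degree \<nu> = d \<and> (\<exists>\<mu>\<in>keys s'. weight \<omega> \<mu> \<le> weight \<omega> \<nu>)} \<subset>
          {\<nu>. total_degree \<nu> = d \<and> (\<exists>\<mu>\<in>keys s. weight \<omega> \<mu> \<le> weight \<omega> \<nu>)}"
      proof (rule psubsetI)
        show "{\<nu>. total_degree \<nu> = d \<and> (\<exists>\<mu>\<in>keys s'. weight \<omega> \<mu> \<le> weight \<omega> \<nu>)} \<subseteq>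
          {\<nu>. total_degree \<nu> = d \<and> (\<exists>\<mu>\<in>keys s. weight \<omega> \<mu> \<le> weight \<omega> \<nu>)}"
          using \<mu> gt by (force intro!: bexI[of _ \<mu>])
        have "\<mu> \<in> {\<nu>. total_degree \<nu> = d \<and> (\<exists>\<mu>\<in>keys s. weight \<omega> \<mu> \<le> weight \<omega> \<nu>)}"
          using \<mu> less.prems by (auto simp: homogeneous_def)
        moreover have "\<mu> \<notin> {\<nu>. total_degree \<nu> = d \<and> (\<exists>\<mu>\<in>keys s'. weight \<omega> \<mu> \<le> weight \<omega> \<nu>)}"
          using \<mu> gt by force
        ultimately show "{\<nu>. total_degree \<nu> = d \<and> (\<exists>\<mu>\<in>keys s'. weight \<omega> \<mu> \<le> weight \<omega> \<nu>)} \<noteq>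
          {\<nu>. total_degree \<nu> = d \<and> (\<exists>\<mu>\<in>keys s. weight \<omega> \<mu> \<le> weight \<omega> \<nu>)}" by blast
      qed
      then have "card {\<nu>. total_degree \<nu> = d \<and> (\<exists>\<mu>\<in>keys s'. weight \<omega> \<mu> \<le> weight \<omega> \<nu>)} <
          card {\<nu>. total_degree \<nu> = d \<and> (\<exists>\<mu>\<in>keys s. weight \<omega> \<mu> \<le> weight \<omega> \<nu>)}"
        by (rule psubset_card_mono[rotated]) (auto intro: finite_subset[OF _ finite_total_degree[of d]])
      from less.hyps[OF this s'd] obtain g b'' where g: "g \<in> I" "keys b'' \<subseteq> B" "s' = g + b''" by blast
      have "s = (g + f) + (b'' + b')" using g(3) by (simp add: s'_def algebra_simps)
      moreover have "keys (b'' + b') \<subseteq> B"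
        using keys_add[of b'' b'] g(2) wb(2) by (auto simp: b'_def keys_restrict_terms)
      moreover have "g + f \<in> I" using idI g(1) f(1) by (rule is_ideal_add)
      ultimately show ?thesis by blast
    qed
  qed
  then show ?thesis by (auto simp: spanning_mod_def homogeneous_def subset_iff)
qed

text \<open>Both initial ideals have the Hilbert function of \<open>I\<close>.\<close>

lemma initial_ideal_subset_imp_eq:
  fixes I :: "('n::finite, 'k::field) mpoly set"
  assumes I: "graded_ideal I" and sub: "initial_ideal \<omega> I \<subseteq> initial_ideal \<omega>' I"
  shows "initial_ideal \<omega> I = initial_ideal \<omega>' I"
proof
  show "initial_ideal \<omega>' I \<subseteq> initial_ideal \<omega> I"
  proof
    fix u assume u: "u \<in> initial_ideal \<omega>' I"
    have "degree_part d u \<in> initial_ideal \<omega> I" for d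
    proof -
      let ?D = "{\<nu> :: 'n \<Rightarrow>\<^sub>0 nat. total_degree \<nu> = d}"
      obtain B where B: "B \<subseteq> ?D" "independent_mod (initial_ideal \<omega> I) B"
          "spanning_mod (initial_ideal \<omega> I) B ?D"
        using ex_monomial_basis_mod[OF is_ideal_initial_ideal finite_total_degree] by blast
      have "finite B" using B(1) finite_total_degree by (rule finite_subset)
      \<comment> \<open>\<open>B\<close> still spans modulo the larger ideal, so a basis for that
        ideal can be found inside \<open>B\<close>.\<close>
      then obtain B' where B': "B' \<subseteq> B" "independent_mod (initial_ideal \<omega>' I) B'"
          "spanning_mod (initial_ideal \<omega>' I) B' B"
        using ex_monomial_basis_mod[OF is_ideal_initial_ideal] by blast
      have "spanning_mod (initial_ideal \<omega>' I) B ?D"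
        using B(3) sub unfolding spanning_mod_def by blast
      then have "spanning_mod (initial_ideal \<omega>' I) B' ?D"
        using B'(3) by (rule spanning_mod_trans[OF is_ideal_initial_ideal])
      then have spI: "spanning_mod I B' ?D"
        using B(1) B'(1) by (intro spanning_mod_ideal[OF I]) auto
      \<comment> \<open>\<open>B'\<close> spans modulo \<open>I\<close> while \<open>B\<close> is
        independent modulo \<open>I\<close>, so no exponent of \<open>B\<close> can be missing from
        \<open>B'\<close>.\<close>
      have "\<nu> \<in> B'" if "\<nu> \<in> B" for \<nu>
      proof -
        have "keys (single \<nu> 1 :: ('n, 'k) mpoly) \<subseteq> ?D" using that B(1) by auto
        then obtain f b where f: "f \<in> I" "keys b \<subseteq> B'" "single \<nu> (1 :: 'k) = f + b"
          using spI unfolding spanning_mod_def by blast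
        then have "f = single \<nu> 1 - b" by simp
        then have "keys f \<subseteq> B"
          using keys_diff[of "single \<nu> (1 :: 'k)" b] that f(2) B'(1) by auto
        then have "f = 0"
          using independent_mod_ideal[OF B(2)] f(1) unfolding independent_mod_def by blast
        then show ?thesis using f by (metis add_0 keys_single insert_subset zero_neq_one)
      qed
      then have B_eq: "B' = B" using B'(1) by blast
      have "keys (degree_part d u) \<subseteq> ?D" by (auto simp: keys_restrict_terms)
      then obtain w b where w: "w \<in> initial_ideal \<omega> I" "keys b \<subseteq> B" "degree_part d u = w + b"
        using B(3) unfolding spanning_mod_def by blast
      have "b = degree_part d u - w" using w(3) by simp
      also have "\<dots> \<in> initial_ideal \<omega>' I"
        using w(1) sub degree_part_initial_ideal[OF I u]
        by (intro is_ideal_diff is_ideal_initial_ideal) auto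
      finally have "b = 0" using B'(2) w(2) unfolding B_eq independent_mod_def by blast
      then show ?thesis using w by simp
    qed
    then have "(\<Sum>d\<in>total_degree ` keys u. degree_part d u) \<in> initial_ideal \<omega> I"
      by (intro is_ideal_sum[OF is_ideal_initial_ideal])
    then show "u \<in> initial_ideal \<omega> I"
      by (subst (asm) sum_restrict_terms) auto
  qed
qed (rule sub)

text \<open>Here \<open>b\<close> is the remainder of \<open>h\<close> in standard monomials. If its
  lowest weight were at most \<open>a\<close>, its lowest part would be a difference of two elements
  of the initial ideal, against the independence of \<open>B\<close>.\<close>

lemma weight_tail_gt:
  fixes I :: "('n::finite, 'k::field) mpoly set"
  assumes h: "h \<in> initial_ideal \<omega> I" "\<And>\<nu>. \<nu> \<in> keys h \<Longrightarrow> weight \<omega> \<nu> = a"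
    and B: "independent_mod (initial_ideal \<omega> I) B" and b: "keys b \<subseteq> B" "h - b \<in> I"
    and \<nu>: "\<nu> \<in> keys b"
  shows "a < weight \<omega> \<nu>"
proof (rule ccontr)
  assume "\<not> a < weight \<omega> \<nu>"
  have "b \<noteq> 0" using \<nu> by auto
  then obtain c where c: "\<And>\<nu>. \<nu> \<in> keys b \<Longrightarrow> c \<le> weight \<omega> \<nu>" "weight_part \<omega> c b \<noteq> 0"
    using obtain_min_weight[of b \<omega>] by metis
  then have "c \<le> a" using \<open>\<not> a < weight \<omega> \<nu>\<close> \<nu> by fastforce
  then have "c \<le> weight \<omega> \<mu>" if "\<mu> \<in> keys (h - b)" for \<mu>
    using that keys_diff[of h b] c(1) h(2) by auto
  then have "weight_part \<omega> c (h - b) \<in> initial_ideal \<omega> I"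
    by (rule weight_part_in_initial_ideal[OF b(2)])
  moreover have "weight_part \<omega> c h \<in> initial_ideal \<omega> I"
  proof (cases "c = a")
    case True
    then have "weight_part \<omega> c h = h" using h(2) by (intro restrict_terms_id) auto
    then show ?thesis using h(1) by simp
  next
    case False
    then have "weight_part \<omega> c h = 0" using h(2) by (intro restrict_terms_eq_0) auto
    then show ?thesis using is_ideal_0[OF is_ideal_initial_ideal] by simp
  qed
  ultimately have "weight_part \<omega> c h - weight_part \<omega> c (h - b) \<in> initial_ideal \<omega> I"
    by (intro is_ideal_diff[OF is_ideal_initial_ideal])
  then have "weight_part \<omega> c b \<in> initial_ideal \<omega> I" by (simp add: restrict_terms_diff)
  moreover have "keys (weight_part \<omega> c b) \<subseteq> B" using b(1) by (auto simp: keys_restrict_terms)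
  ultimately show False using B c(2) unfolding independent_mod_def by blast
qed

section \<open>Convexity of the classes of weights\<close>

lemma weight_convex_combination:
  "weight ((1 - t) *\<^sub>R \<omega> + t *\<^sub>R \<omega>') \<nu> = (1 - t) * weight \<omega> \<nu> + t * weight \<omega>' \<nu>"
  by (simp add: weight_def sum.distrib sum_distrib_left algebra_simps sum_subtractf)

text \<open>The two weights share their standard monomials. An element homogeneous for both of them
  therefore has one remainder whose terms are strictly heavier for both, hence along the whole
  segment, so the element is an initial form there. This gives one inclusion;
  \<open>initial_ideal_subset_imp_eq\<close> turns it into equality.\<close>

theorem initial_ideal_convex_combination:
  fixes I :: "('n::finite, 'k::field) mpoly set"
  assumes I: "graded_ideal I" and eq: "initial_ideal \<omega> I = initial_ideal \<omega>' I"
    and t: "0 \<le> t" "t \<le> 1"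
  shows "initial_ideal ((1 - t) *\<^sub>R \<omega> + t *\<^sub>R \<omega>') I = initial_ideal \<omega> I"
proof (rule initial_ideal_subset_imp_eq[OF I, symmetric], rule subsetI)
  let ?\<omega> = "(1 - t) *\<^sub>R \<omega> + t *\<^sub>R \<omega>'"
  fix h assume h: "h \<in> initial_ideal \<omega> I"
  \<comment> \<open>Being the initial ideal at both weights, the ideal is homogeneous for each of
    them and for the degree, so \<open>h\<close> may be split along all three.\<close>
  define tri where "tri \<nu> = (weight \<omega> \<nu>, weight \<omega>' \<nu>, total_degree \<nu>)" for \<nu>
  have "restrict_terms (\<lambda>\<nu>. tri \<nu> = p) h \<in> initial_ideal ?\<omega> I" for p
  proof -
    obtain a a' d where p: "p = (a, a', d)" by (cases p)
    define k where "k = restrict_terms (\<lambda>\<nu>. tri \<nu> = p) h"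
    have "k = degree_part d (weight_part \<omega>' a' (weight_part \<omega> a h))"
      unfolding k_def restrict_terms_restrict_terms by (rule restrict_terms_cong) (auto simp: tri_def p)
    then have k: "k \<in> initial_ideal \<omega> I"
      using degree_part_initial_ideal[OF I] weight_part_initial_ideal[OF I] h eq by metis
    have k_keys: "weight \<omega> \<nu> = a" "weight \<omega>' \<nu> = a'" "total_degree \<nu> = d" if "\<nu> \<in> keys k" for \<nu>
      using that by (auto simp: k_def keys_restrict_terms tri_def p)
    let ?D = "{\<nu> :: 'n \<Rightarrow>\<^sub>0 nat. total_degree \<nu> = d}"
    obtain B where B: "B \<subseteq> ?D" "independent_mod (initial_ideal \<omega> I) B"
        "spanning_mod (initial_ideal \<omega> I) B ?D"
      using ex_monomial_basis_mod[OF is_ideal_initial_ideal finite_total_degree] by blast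
    have "spanning_mod I B ?D" by (rule spanning_mod_ideal[OF I B(3,1)])
    moreover have "keys k \<subseteq> ?D" using k_keys by auto
    ultimately obtain f b where f: "f \<in> I" "keys b \<subseteq> B" "k = f + b"
      unfolding spanning_mod_def by blast
    then have kb: "k - b \<in> I" by simp
    have gt: "a < weight \<omega> \<nu>" "a' < weight \<omega>' \<nu>" if "\<nu> \<in> keys b" for \<nu>
      using weight_tail_gt[OF k k_keys(1) B(2) f(2) kb that]
        weight_tail_gt[OF k[unfolded eq] k_keys(2) B(2)[unfolded eq] f(2) kb that] by auto
    define c where "c = (1 - t) * a + t * a'"
    have wt_k: "weight ?\<omega> \<nu> = c" if "\<nu> \<in> keys k" for \<nu>
      using k_keys[OF that] by (simp add: weight_convex_combination c_def)
    have wt_b: "c < weight ?\<omega> \<nu>" if "\<nu> \<in> keys b" for \<nu>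
    \<comment> \<open>For \<open>t = 1\<close> the strict inequality for \<open>\<omega>\<close>
      gets coefficient 0, and the one for \<open>\<omega>'\<close> must be used instead.\<close>
    proof (cases "t = 1")
      case False
      then show ?thesis
        unfolding c_def weight_convex_combination using gt[OF that] t
        by (intro add_less_le_mono mult_strict_left_mono mult_left_mono) auto
    qed (use gt[OF that] in \<open>simp add: c_def weight_convex_combination\<close>)
    have "weight_part ?\<omega> c (k - b) = weight_part ?\<omega> c k - weight_part ?\<omega> c b"
      by (rule restrict_terms_diff)
    also have "weight_part ?\<omega> c k = k" using wt_k by (intro restrict_terms_id) auto
    also have "weight_part ?\<omega> c b = 0" using wt_b by (intro restrict_terms_eq_0) force
    finally have "weight_part ?\<omega> c (k - b) = k" by simp
    moreover have "weight_part ?\<omega> c (k - b) \<in> initial_ideal ?\<omega> I"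
    proof (rule weight_part_in_initial_ideal[OF kb])
      fix \<nu> assume "\<nu> \<in> keys (k - b)"
      then show "c \<le> weight ?\<omega> \<nu>" using keys_diff[of k b] wt_k wt_b by force
    qed
    ultimately show ?thesis by (simp add: k_def)
  qed
  then have "(\<Sum>p\<in>tri ` keys h. restrict_terms (\<lambda>\<nu>. tri \<nu> = p) h) \<in> initial_ideal ?\<omega> I"
    by (intro is_ideal_sum[OF is_ideal_initial_ideal])
  then show "h \<in> initial_ideal ?\<omega> I"
    by (subst (asm) sum_restrict_terms) auto
qed

corollary convex_initial_class:
  fixes I :: "('n::finite, 'k::field) mpoly set"
  assumes "graded_ideal I"
  shows "convex {\<omega>'. initial_ideal \<omega>' I = W}"
  unfolding convex_alt using initial_ideal_convex_combination[OF assms] by auto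

text \<open>A convex set and its closure have the same relative interior, so the relative interior
  of the closed cone lies in the class itself.\<close>

corollary rel_interior_groebner_cone:
  fixes I :: "('n::finite, 'k::field) mpoly set"
  assumes I: "graded_ideal I" and C: "C \<in> groebner_fan I" and "\<omega> \<in> rel_interior C" "\<omega>' \<in> rel_interior C"
  shows "initial_ideal \<omega> I = initial_ideal \<omega>' I"
proof -
  obtain \<xi> where "C = closure {\<omega>'. initial_ideal \<omega>' I = initial_ideal \<xi> I}"
    using C by (auto simp: groebner_fan_def)
  then have "rel_interior C \<subseteq> {\<omega>'. initial_ideal \<omega>' I = initial_ideal \<xi> I}"
    using convex_rel_interior_closure[OF convex_initial_class[OF I]] rel_interior_subset by metis
  then show ?thesis using assms(3,4) by auto
qed

corollary convex_groebner_cone: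
  fixes I :: "('n::finite, 'k::field) mpoly set"
  assumes I: "graded_ideal I" and C: "C \<in> groebner_fan I"
  shows "convex C" "C \<noteq> {}"
  using C convex_closure[OF convex_initial_class[OF I]] by (auto simp: groebner_fan_def)

section \<open>Linear changes of coordinates\<close>

lemma homogeneous_single_0 [simp]: "homogeneous 0 (single 0 c)"
  by (simp add: homogeneous_def total_degree_def)

lemma homogeneous_const [simp]: "homogeneous 0 (mpoly_const c)"
  by (simp add: mpoly_const_def)

lemma homogeneous_1 [simp]: "homogeneous 0 1"
  by (simp add: homogeneous_def total_degree_def)

lemma homogeneous_var: "homogeneous 1 (mpoly_var i)"
  by (simp add: homogeneous_def total_degree_def mpoly_var_def mpoly_monom_def)

lemma homogeneous_power: "homogeneous d f \<Longrightarrow> homogeneous (k * d) (f ^ k)"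
  for f :: "('n::finite, 'k::comm_ring_1) mpoly"
  by (induction k) (auto intro: homogeneous_mult)

lemma homogeneous_prod:
  fixes f :: "'x \<Rightarrow> ('n::finite, 'k::comm_ring_1) mpoly"
  shows "finite A \<Longrightarrow> (\<And>x. x \<in> A \<Longrightarrow> homogeneous (d x) (f x)) \<Longrightarrow> homogeneous (sum d A) (prod f A)"
  by (induction rule: finite_induct) (auto intro: homogeneous_mult)

lemma mpoly_hom_eqI:
  fixes F G :: "('n, 'k::comm_ring_1) mpoly \<Rightarrow> 'r::comm_ring_1"
  assumes add: "\<And>f g. F (f + g) = F f + F g" "\<And>f g. G (f + g) = G f + G g"
    and mult: "\<And>f g. F (f * g) = F f * F g" "\<And>f g. G (f * g) = G f * G g"
    and const: "\<And>c. F (mpoly_const c) = G (mpoly_const c)"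
    and var: "\<And>i. F (mpoly_var i) = G (mpoly_var i)"
  shows "F f = G f"
proof (induction f rule: poly_mapping_single_induct)
  case zero
  then show ?case using const[of 0] by (simp add: mpoly_const_def)
next
  case (single \<nu> c)
  have one: "F 1 = G 1" using const[of 1] by (simp add: mpoly_const_def)
  have pow: "F (mpoly_var i ^ k) = G (mpoly_var i ^ k)" for i k
    by (induction k) (auto simp: one mult var)
  have "F (single \<nu> 1) = G (single \<nu> 1)"
  proof (induction \<nu> rule: poly_mapping_single_induct)
    case (single i k)
    then show ?case using pow[of i k] by (simp add: mpoly_var_power)
  next
    case (add \<mu> \<nu>)
    have "single (\<mu> + \<nu>) (1 :: 'k) = single \<mu> 1 * single \<nu> 1" by (simp add: mult_single)
    then show ?case using add by (simp add: mult)
  qed (simp add: one)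
  moreover have "single \<nu> c = mpoly_const c * single \<nu> 1" by (simp add: mpoly_const_def mult_single)
  ultimately show ?case by (simp add: mult const)
qed (simp add: add)

lemma GL_act_0 [simp]: "GL_act g 0 = 0"
  unfolding GL_act_def by (rule cst.eval_0)

lemma GL_act_1 [simp]: "GL_act g 1 = 1"
  unfolding GL_act_def by (rule cst.eval_1)

lemma GL_act_add: "GL_act g (f + f') = GL_act g f + GL_act g f'"
  unfolding GL_act_def by (rule cst.eval_add)

lemma GL_act_mult: "GL_act g (f * f') = GL_act g f * GL_act g f'"
  unfolding GL_act_def by (rule cst.eval_mult)

lemma GL_act_sum: "GL_act g (sum f A) = (\<Sum>x\<in>A. GL_act g (f x))"
  unfolding GL_act_def by (rule cst.eval_sum)

lemma GL_act_const: "GL_act g (mpoly_const c) = mpoly_const c"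
  unfolding GL_act_def by (rule cst.eval_const)

lemma GL_act_var: "GL_act g (mpoly_var i) = (\<Sum>j\<in>UNIV. mpoly_const (g $ j $ i) * mpoly_var j)"
  unfolding GL_act_def by (rule cst.eval_var)

lemma mpoly_const_sum: "mpoly_const (sum f A) = (\<Sum>x\<in>A. mpoly_const (f x))"
  by (induction A rule: infinite_finite_induct) (auto simp: cst.zero cst.add)

text \<open>Column \<open>i\<close> of the matrix holds the image of x_i, so substitutions compose
  in the order of the matrix product: a left action.\<close>

lemma GL_act_GL_act: "GL_act h (GL_act g f) = GL_act (h ** g) f"
proof (rule mpoly_hom_eqI[where F = "\<lambda>f. GL_act h (GL_act g f)" and G = "GL_act (h ** g)"])
  fix i
  have "GL_act h (GL_act g (mpoly_var i)) =
      (\<Sum>j\<in>UNIV. \<Sum>k\<in>UNIV. mpoly_const (g $ j $ i * h $ k $ j) * mpoly_var k)"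
    by (simp add: GL_act_var GL_act_sum GL_act_mult GL_act_const sum_distrib_left cst.mult mult.assoc)
  also have "\<dots> = (\<Sum>k\<in>UNIV. \<Sum>j\<in>UNIV. mpoly_const (g $ j $ i * h $ k $ j) * mpoly_var k)"
    by (rule sum.swap)
  also have "\<dots> = GL_act (h ** g) (mpoly_var i)"
    by (simp add: GL_act_var matrix_matrix_mult_def mpoly_const_sum sum_distrib_right
        mult.commute[of "h $ _ $ _" "g $ _ $ _"])
  finally show "GL_act h (GL_act g (mpoly_var i)) = GL_act (h ** g) (mpoly_var i)" .
qed (simp_all add: GL_act_add GL_act_mult GL_act_const)

lemma GL_act_mat_1: "GL_act (mat 1) f = f"
proof (rule mpoly_hom_eqI[where F = "GL_act (mat 1)" and G = "\<lambda>f. f"])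
  fix i
  have "(\<Sum>j\<in>UNIV. mpoly_const (mat 1 $ j $ i) * mpoly_var j) =
      (\<Sum>j\<in>UNIV. if j = i then mpoly_var j else (0 :: ('a, 'b) mpoly))"
    by (rule sum.cong) (auto simp: mat_def cst.zero cst.one)
  then show "GL_act (mat 1) (mpoly_var i) = (mpoly_var i :: ('a, 'b) mpoly)"
    by (simp add: GL_act_var)
qed (simp_all add: GL_act_add GL_act_mult GL_act_const)

lemma bij_GL_act:
  assumes "invertible g"
  shows "bij (GL_act g)"
proof -
  from assms obtain g' where "g ** g' = mat 1" "g' ** g = mat 1"
    by (auto simp: invertible_def)
  then show ?thesis
    by (intro o_bij[of "GL_act g'"]) (auto simp: fun_eq_iff GL_act_GL_act GL_act_mat_1)
qed

lemma eval_GL_act: "mpoly_eval id v (GL_act g f) = mpoly_eval id (\<lambda>i. \<Sum>j\<in>UNIV. g $ j $ i * v j) f"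
  by (rule mpoly_hom_eqI[where F = "\<lambda>f. mpoly_eval id v (GL_act g f)"
        and G = "mpoly_eval id (\<lambda>i. \<Sum>j\<in>UNIV. g $ j $ i * v j)"])
    (simp_all add: GL_act_add GL_act_mult GL_act_const GL_act_var ev.eval_add ev.eval_mult ev.eval_const
      ev.eval_var ev.eval_sum)

lemma homogeneous_GL_act: "homogeneous d f \<Longrightarrow> homogeneous d (GL_act g f)"
proof -
  assume f: "homogeneous d f"
  have lin: "homogeneous 1 (\<Sum>j\<in>UNIV. mpoly_const (g $ j $ i) * mpoly_var j)" for i
  proof (rule homogeneous_sum)
    show "homogeneous 1 (mpoly_const (g $ j $ i) * mpoly_var j)" for j
      using homogeneous_mult[OF homogeneous_const homogeneous_var, of "g $ j $ i" j]
      by (simp only: add_0)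
  qed
  show ?thesis
    unfolding GL_act_def mpoly_eval_def
  proof (rule homogeneous_sum)
    fix \<nu> assume "\<nu> \<in> keys f"
    then have d: "total_degree \<nu> = d" using f by (simp add: homogeneous_def)
    have "homogeneous (\<Sum>i\<in>keys \<nu>. lookup \<nu> i)
        (\<Prod>i\<in>keys \<nu>. (\<Sum>j\<in>UNIV. mpoly_const (g $ j $ i) * mpoly_var j) ^ lookup \<nu> i)"
      using homogeneous_power[OF lin] by (intro homogeneous_prod) auto
    then have "homogeneous d (\<Prod>i\<in>keys \<nu>. (\<Sum>j\<in>UNIV. mpoly_const (g $ j $ i) * mpoly_var j) ^ lookup \<nu> i)"
      using d by (simp add: total_degree_def)
    then show "homogeneous d (mpoly_const (lookup f \<nu>) *
        (\<Prod>i\<in>keys \<nu>. (\<Sum>j\<in>UNIV. mpoly_const (g $ j $ i) * mpoly_var j) ^ lookup \<nu> i))"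
      using homogeneous_mult[OF homogeneous_const] by fastforce
  qed
qed

lemma GL_act_degree_part: "GL_act g (degree_part d f) = degree_part d (GL_act g f)"
proof -
  define A where "A = insert d (total_degree ` keys f)"
  have "f = (\<Sum>e\<in>A. degree_part e f)"
    by (rule sum_restrict_terms[symmetric]) (auto simp: A_def)
  then have "GL_act g f = (\<Sum>e\<in>A. GL_act g (degree_part e f))"
    by (metis GL_act_sum)
  then have "degree_part d (GL_act g f) = (\<Sum>e\<in>A. degree_part d (GL_act g (degree_part e f)))"
    by (simp add: restrict_terms_sum)
  also have "\<dots> = (\<Sum>e\<in>A. if d = e then GL_act g (degree_part e f) else 0)"
    by (intro sum.cong refl degree_part_homogeneous homogeneous_GL_act homogeneous_degree_part)
  also have "\<dots> = GL_act g (degree_part d f)"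
    by (simp add: A_def)
  finally show ?thesis ..
qed

lemma is_ideal_surj_image:
  assumes "is_ideal I" "surj F" "\<And>f g. F (f + g) = F f + F g" "\<And>f g. F (f * g) = F f * F g" "F 0 = 0"
  shows "is_ideal (F ` I)"
  unfolding is_ideal_def
proof (intro conjI ballI allI)
  show "0 \<in> F ` I" using assms(5) is_ideal_0[OF assms(1)] by (metis imageI)
next
  fix a b assume "a \<in> F ` I" "b \<in> F ` I"
  then show "a + b \<in> F ` I" using is_ideal_add[OF assms(1)] by (auto simp flip: assms(3))
next
  fix r a assume "a \<in> F ` I"
  moreover obtain s where "r = F s" using assms(2) by blast
  ultimately show "r * a \<in> F ` I" using is_ideal_mult_left[OF assms(1)] by (auto simp flip: assms(4))
qed

lemma is_ideal_GL_act: "invertible g \<Longrightarrow> is_ideal I \<Longrightarrow> is_ideal (GL_act g ` I)"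
  by (rule is_ideal_surj_image) (auto simp: GL_act_add GL_act_mult bij_is_surj[OF bij_GL_act])

lemma graded_ideal_GL_act:
  assumes "graded_ideal I" "invertible g"
  shows "graded_ideal (GL_act g ` I)"
  unfolding graded_ideal_def ideal_iff_is_ideal
  using is_ideal_GL_act[OF assms(2) graded_ideal_is_ideal[OF assms(1)]] graded_ideal_degree_part[OF assms(1)]
  by (auto simp flip: GL_act_degree_part)

lemma GL_act_polys_in:
  fixes g :: "'k::comm_ring_1 ^ 'n ^ 'n::finite"
  assumes "f \<in> polys_in M" "\<And>i j. i \<in> M \<Longrightarrow> j \<notin> M \<Longrightarrow> g $ j $ i = 0"
  shows "GL_act g f \<in> polys_in M"
proof -
  have lin: "(\<Sum>j\<in>UNIV. mpoly_const (g $ j $ i) * mpoly_var j) \<in> polys_in M" if "i \<in> M" for i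
  proof (rule polys_in_sum)
    show "mpoly_const (g $ j $ i) * mpoly_var j \<in> polys_in M" for j
      using assms(2)[of i j] that by (cases "j \<in> M") (auto simp: cst.zero intro: polys_in_mult)
  qed
  show ?thesis
    unfolding GL_act_def mpoly_eval_def
    by (rule polys_in_sum, rule polys_in_mult, simp, rule polys_in_prod, rule polys_in_power, rule lin)
      (use assms(1) in \<open>auto simp: polys_in_def\<close>)
qed

section \<open>Coefficients of pure powers\<close>

lemma single_if_keys_subset:
  assumes "keys \<nu> \<subseteq> {i}" "total_degree \<nu> = d"
  shows "\<nu> = single i d"
proof (rule poly_mapping_eqI)
  have *: "lookup \<nu> j = 0" if "j \<noteq> i" for j using that assms(1) by (auto simp: in_keys_iff)
  have "total_degree \<nu> = (\<Sum>j\<in>{i}. lookup \<nu> j)"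
    unfolding total_degree_def by (rule sum.mono_neutral_left) (use assms(1) in \<open>auto simp: in_keys_iff\<close>)
  then show "lookup \<nu> j = lookup (single i d) j" for j
    using assms(2) * by (auto simp: lookup_single when_def)
qed

lemma lookup_single_eq_eval:
  fixes f :: "('n::finite, 'k::comm_ring_1) mpoly"
  assumes "homogeneous d f"
  shows "lookup f (single i d) = mpoly_eval id (\<lambda>j. if j = i then 1 else 0) f"
proof -
  have "(\<Prod>j\<in>keys \<nu>. (if j = i then 1 else 0) ^ lookup \<nu> j) = (if \<nu> = single i d then 1 else (0 :: 'k))"
    if "\<nu> \<in> keys f" for \<nu>
  proof (cases "keys \<nu> \<subseteq> {i}")
    case True
    then have "\<nu> = single i d"
      using that assms by (intro single_if_keys_subset) (auto simp: homogeneous_def)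
    moreover have "(\<Prod>j\<in>keys \<nu>. (if j = i then 1 else 0) ^ lookup \<nu> j) = (1 :: 'k)"
      using True by (intro prod.neutral) auto
    ultimately show ?thesis by simp
  next
    case False
    then obtain j where "j \<in> keys \<nu>" "j \<noteq> i" by blast
    then have "(\<Prod>j\<in>keys \<nu>. (if j = i then 1 else 0) ^ lookup \<nu> j) = (0 :: 'k)"
      by (intro prod_zero bexI[of _ j]) (auto simp: in_keys_iff zero_power)
    moreover have "\<nu> \<noteq> single i d" using False by (auto split: if_splits)
    ultimately show ?thesis by simp
  qed
  then have "mpoly_eval id (\<lambda>j. if j = i then 1 else 0) f =
      (\<Sum>\<nu>\<in>keys f. if \<nu> = single i d then lookup f \<nu> else 0)"
    unfolding mpoly_eval_def by (intro sum.cong) auto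
  also have "\<dots> = lookup f (single i d)"
    by (auto simp: in_keys_iff)
  finally show ?thesis ..
qed

text \<open>The coefficient of x_i^d in a form is its value at the i-th unit vector, which the
  substitution carries to row \<open>i\<close> of \<open>g\<close>. The presence of a pure power is
  thus a polynomial condition on one row.\<close>

lemma lookup_GL_act_single:
  fixes f :: "('n::finite, 'k::comm_ring_1) mpoly"
  assumes "homogeneous d f"
  shows "lookup (GL_act g f) (single i d) = mpoly_eval id (\<lambda>k. g $ i $ k) f"
proof -
  have "(\<Sum>j\<in>UNIV. g $ j $ k * (if j = i then 1 else 0)) = g $ i $ k" for k
    by (simp add: if_distrib[of "\<lambda>x. _ * x"] cong: if_cong)
  then show ?thesis
    by (simp add: lookup_single_eq_eval[OF homogeneous_GL_act[OF assms]] eval_GL_act)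
qed

section \<open>Permutations of the variables\<close>

text \<open>The matrix of the substitution that sends each variable with index \<open>i\<close> to the one with index
  \<open>\<tau> i\<close>.\<close>

definition perm_matrix :: "('n \<Rightarrow> 'n) \<Rightarrow> 'k::comm_ring_1 ^ 'n ^ 'n::finite"
  where "perm_matrix \<tau> = (\<chi> j i. if j = \<tau> i then 1 else 0)"

lemma perm_matrix_mult:
  fixes \<sigma> :: "'n::finite \<Rightarrow> 'n"
  shows "(perm_matrix \<sigma> :: 'k::comm_ring_1 ^ 'n ^ 'n) ** perm_matrix \<tau> = perm_matrix (\<sigma> \<circ> \<tau>)"
proof -
  have "(\<Sum>k\<in>UNIV. (if i = \<sigma> k then 1 else 0) * (if k = \<tau> j then 1 else 0 :: 'k)) =
      (\<Sum>k\<in>UNIV. if k = \<tau> j then (if i = \<sigma> k then 1 else 0) else 0)" for i j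
    by (rule sum.cong) auto
  then show ?thesis
    by (simp add: perm_matrix_def matrix_matrix_mult_def vec_eq_iff)
qed

lemma perm_matrix_id: "perm_matrix id = mat 1"
  by (simp add: perm_matrix_def mat_def vec_eq_iff)

lemma perm_matrix_inv:
  assumes "bij \<tau>"
  shows "perm_matrix \<tau> ** perm_matrix (inv_into UNIV \<tau>) = mat 1" "perm_matrix (inv_into UNIV \<tau>) ** perm_matrix \<tau> = mat 1"
  using surj_iff[THEN iffD1, OF bij_is_surj[OF assms]] inj_iff[THEN iffD1, OF bij_is_inj[OF assms]]
  by (simp_all add: perm_matrix_mult perm_matrix_id)

lemma invertible_perm_matrix: "bij \<tau> \<Longrightarrow> invertible (perm_matrix \<tau>)"
  using perm_matrix_inv by (auto simp: invertible_def)

lemma weight_0 [simp]: "weight \<omega> 0 = 0"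
  by (simp add: weight_def)

lemma weight_sum: "weight \<omega> (sum f A) = (\<Sum>x\<in>A. weight \<omega> (f x))"
  by (induction A rule: infinite_finite_induct) (auto simp: weight_add)

lemma weight_single: "weight \<omega> (single i k) = \<omega> $ i * real k"
proof -
  have "weight \<omega> (single i k) = (\<Sum>j\<in>UNIV. if j = i then \<omega> $ j * real k else 0)"
    unfolding weight_def by (rule sum.cong) (auto simp: lookup_single when_def)
  then show ?thesis by simp
qed

lemma GL_act_perm_single:
  fixes c :: "'k::comm_ring_1" and \<tau> :: "'n::finite \<Rightarrow> 'n"
  shows "GL_act (perm_matrix \<tau>) (single \<nu> c) = single (\<Sum>i\<in>UNIV. single (\<tau> i) (lookup \<nu> i)) c"
proof -
  have "(\<Sum>j\<in>UNIV. mpoly_const (perm_matrix \<tau> $ j $ i) * mpoly_var j) = (mpoly_var (\<tau> i) :: ('n, 'k) mpoly)" for i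
  proof -
    have "(\<Sum>j\<in>UNIV. mpoly_const (perm_matrix \<tau> $ j $ i) * mpoly_var j) =
        (\<Sum>j\<in>UNIV. if j = \<tau> i then mpoly_var j else (0 :: ('n, 'k) mpoly))"
      by (rule sum.cong) (auto simp: perm_matrix_def cst.zero cst.one)
    then show ?thesis by simp
  qed
  moreover have "(\<Prod>i\<in>A. single (\<mu> i) (1 :: 'k)) = single (sum \<mu> A) 1" for \<mu> :: "'n \<Rightarrow> 'n \<Rightarrow>\<^sub>0 nat" and A
    by (induction A rule: infinite_finite_induct) (auto simp: mult_single)
  ultimately show ?thesis
    unfolding GL_act_def cst.eval_single by (simp add: mpoly_var_power mpoly_const_def mult_single)
qed

text \<open>Moving exponents by \<open>\<tau>\<close> on one side equals permuting the weight on the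
  other. The predicate \<open>Q\<close> stays free because it is used both for the part of weight
  \<open>a\<close> and for the terms below it.\<close>

lemma GL_act_perm_restrict_weight:
  "GL_act (perm_matrix \<tau>) (restrict_terms (\<lambda>\<nu>. Q (weight (\<chi> i. \<omega> $ \<tau> i) \<nu>)) f) =
    restrict_terms (\<lambda>\<nu>. Q (weight \<omega> \<nu>)) (GL_act (perm_matrix \<tau>) f)"
proof (induction f rule: poly_mapping_single_induct)
  case (single \<nu> c)
  have "weight \<omega> (\<Sum>i\<in>UNIV. single (\<tau> i) (lookup \<nu> i)) = weight (\<chi> i. \<omega> $ \<tau> i) \<nu>"
    by (simp add: weight_sum weight_single) (simp add: weight_def)
  then show ?case by (simp add: restrict_terms_single GL_act_perm_single)
qed (auto simp: restrict_terms_add GL_act_add)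

lemma initial_form_GL_act_perm:
  assumes "bij \<tau>"
  shows "initial_form \<omega> (GL_act (perm_matrix \<tau>) f) = GL_act (perm_matrix \<tau>) (initial_form (\<chi> i. \<omega> $ \<tau> i) f)"
proof (cases "f = 0")
  case False
  let ?P = "GL_act (perm_matrix \<tau>)"
  have inj: "?P p = 0 \<longleftrightarrow> p = 0" for p
    using bij_is_inj[OF bij_GL_act[OF invertible_perm_matrix[OF assms]]] by (metis GL_act_0 injD)
  obtain a where a: "\<And>\<nu>. \<nu> \<in> keys f \<Longrightarrow> a \<le> weight (\<chi> i. \<omega> $ \<tau> i) \<nu>"
    "weight_part (\<chi> i. \<omega> $ \<tau> i) a f \<noteq> 0"
    "initial_form (\<chi> i. \<omega> $ \<tau> i) f = weight_part (\<chi> i. \<omega> $ \<tau> i) a f"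
    using obtain_min_weight[OF False, of "\<chi> i. \<omega> $ \<tau> i"] by metis
  have eq: "?P (weight_part (\<chi> i. \<omega> $ \<tau> i) a f) = weight_part \<omega> a (?P f)"
    by (rule GL_act_perm_restrict_weight[where Q = "\<lambda>x. x = a"])
  have "restrict_terms (\<lambda>\<nu>. weight \<omega> \<nu> < a) (?P f) = 0"
    using GL_act_perm_restrict_weight[of \<tau> "\<lambda>x. x < a" \<omega> f]
      restrict_terms_eq_0[of f "\<lambda>\<nu>. weight (\<chi> i. \<omega> $ \<tau> i) \<nu> < a"] a(1) by fastforce
  then have "{\<nu> \<in> keys (?P f). weight \<omega> \<nu> < a} = {}"
    by (metis keys_restrict_terms keys_zero)
  then have "a \<le> weight \<omega> \<nu>" if "\<nu> \<in> keys (?P f)" for \<nu> using that by force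
  moreover have "weight_part \<omega> a (?P f) \<noteq> 0" using a(2) inj eq by metis
  ultimately show ?thesis using initial_form_eq_weight_part[of "?P f" a \<omega>] eq a(3) by metis
qed simp

text \<open>Trades permuted variables for permuted weights, so that hypotheses on several ideals
  become statements about \<open>J\<close> alone. Image and preimage of an ideal under the
  substitution are ideals, so it suffices to compare initial forms.\<close>

lemma initial_ideal_GL_act_perm:
  assumes "bij \<tau>"
  shows "GL_act (perm_matrix \<tau>) h \<in> initial_ideal \<omega> (GL_act (perm_matrix \<tau>) ` J) \<longleftrightarrow>
    h \<in> initial_ideal (\<chi> i. \<omega> $ \<tau> i) J"
proof -
  let ?P = "GL_act (perm_matrix \<tau>)"
  let ?W = "initial_ideal \<omega> (?P ` J)" and ?V = "initial_ideal (\<chi> i. \<omega> $ \<tau> i) J"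
  have bij: "bij ?P" by (rule bij_GL_act[OF invertible_perm_matrix[OF assms]])
  have "?W \<subseteq> ?P ` ?V"
    unfolding initial_ideal_def[of \<omega>]
  proof (rule genideal_subset)
    show "is_ideal (?P ` ?V)"
      by (rule is_ideal_GL_act[OF invertible_perm_matrix[OF assms] is_ideal_initial_ideal])
  qed (auto simp: initial_form_GL_act_perm[OF assms] initial_form_in_initial_ideal)
  moreover have "?V \<subseteq> {h. ?P h \<in> ?W}"
    unfolding initial_ideal_def[of "\<chi> i. \<omega> $ \<tau> i"]
  proof (rule genideal_subset)
    note W = is_ideal_initial_ideal[of \<omega> "?P ` J"]
    show "is_ideal {h. ?P h \<in> ?W}"
      unfolding is_ideal_def
      using is_ideal_0[OF W] is_ideal_add[OF W] is_ideal_mult_left[OF W] by (auto simp: GL_act_add GL_act_mult)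
    have "?P (initial_form (\<chi> i. \<omega> $ \<tau> i) f) \<in> ?W" if "f \<in> J" for f
      using initial_form_in_initial_ideal[of "?P f" "?P ` J" \<omega>] that
      by (simp add: initial_form_GL_act_perm[OF assms])
    then show "initial_form (\<chi> i. \<omega> $ \<tau> i) ` J \<subseteq> {h. ?P h \<in> ?W}" by blast
  qed
  ultimately show ?thesis using bij_is_inj[OF bij] by (auto dest: injD)
qed

text \<open>Primes above g(I) are pulled back to primes above \<open>I\<close>; surjectivity of the
  substitution keeps the inclusions strict.\<close>

lemma ideal_dim_GL_act_bound:
  fixes I :: "('n::finite, 'k::field_char_0) mpoly set"
  assumes I: "is_ideal I" and g: "invertible g" and M: "GL_act g ` I \<inter> polys_in M \<subseteq> {0}"
  shows "enat (card M) \<le> ideal_dim I"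
proof -
  obtain P where P: "\<forall>i\<le>card M. is_prime_ideal (P i)" "\<forall>i<card M. P i \<subset> P (Suc i)" "GL_act g ` I \<subseteq> P 0"
    using ex_prime_chain[OF is_ideal_GL_act[OF g I] M refl] by blast
  have surj: "surj (GL_act g)" by (rule bij_is_surj[OF bij_GL_act[OF g]])
  show ?thesis
  proof (rule ideal_dim_ge[OF I, where P = "\<lambda>i. GL_act g -` P i"])
    fix i assume "i \<le> card M"
    then have "is_prime_ideal (P i)" using P by blast
    then show "is_prime_ideal (GL_act g -` P i)"
      unfolding is_prime_ideal_def is_ideal_def by (simp add: GL_act_add GL_act_mult)
  next
    fix i assume "i < card M"
    then have "P i \<subset> P (Suc i)" using P by blast
    then obtain q where "q \<in> P (Suc i)" "q \<notin> P i" and "P i \<subseteq> P (Suc i)" by blast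
    moreover obtain f where "q = GL_act g f" using surj by blast
    ultimately show "GL_act g -` P i \<subset> GL_act g -` P (Suc i)" by auto
  next
    show "I \<subseteq> GL_act g -` P 0" using P(3) by blast
  qed
qed

section \<open>Weights of the generic tropical variety\<close>

lemma weight_ge_min:
  assumes "keys \<nu> \<subseteq> M" "\<And>j. j \<in> M \<Longrightarrow> \<omega> $ i \<le> \<omega> $ j" "total_degree \<nu> = d"
  shows "\<omega> $ i * real d \<le> weight \<omega> \<nu>"
    and "weight \<omega> \<nu> = \<omega> $ i * real d \<longleftrightarrow> keys \<nu> \<subseteq> {j. \<omega> $ j = \<omega> $ i}"
proof -
  have d: "real d = (\<Sum>j\<in>UNIV. real (lookup \<nu> j))"
    unfolding assms(3)[symmetric] total_degree_UNIV by simp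
  have diff: "weight \<omega> \<nu> - \<omega> $ i * real d = (\<Sum>j\<in>UNIV. (\<omega> $ j - \<omega> $ i) * real (lookup \<nu> j))"
    by (simp add: d weight_def sum_distrib_left algebra_simps sum_subtractf)
  have nonneg: "0 \<le> (\<omega> $ j - \<omega> $ i) * real (lookup \<nu> j)" for j
  proof (cases "j \<in> M")
    case True
    then show ?thesis using assms(2) by simp
  next
    case False
    then have "lookup \<nu> j = 0" using assms(1) by (auto simp: in_keys_iff)
    then show ?thesis by simp
  qed
  show "\<omega> $ i * real d \<le> weight \<omega> \<nu>"
    using diff sum_nonneg[of UNIV "\<lambda>j. (\<omega> $ j - \<omega> $ i) * real (lookup \<nu> j)"] nonneg by simp
  have "weight \<omega> \<nu> = \<omega> $ i * real d \<longleftrightarrow> (\<Sum>j\<in>UNIV. (\<omega> $ j - \<omega> $ i) * real (lookup \<nu> j)) = 0"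
    by (simp only: diff[symmetric] eq_iff_diff_eq_0[symmetric])
  also have "\<dots> \<longleftrightarrow> (\<forall>j\<in>UNIV. (\<omega> $ j - \<omega> $ i) * real (lookup \<nu> j) = 0)"
    by (rule sum_nonneg_eq_0_iff) (use nonneg in auto)
  also have "\<dots> \<longleftrightarrow> keys \<nu> \<subseteq> {j. \<omega> $ j = \<omega> $ i}"
    by (auto simp: in_keys_iff subset_iff)
  finally show "weight \<omega> \<nu> = \<omega> $ i * real d \<longleftrightarrow> keys \<nu> \<subseteq> {j. \<omega> $ j = \<omega> $ i}" .
qed

lemma weight_part_min:
  fixes f :: "('n::finite, 'k::comm_ring_1) mpoly"
  assumes f: "homogeneous d f" "f \<in> polys_in M" and min: "\<And>j. j \<in> M \<Longrightarrow> \<omega> $ i \<le> \<omega> $ j"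
  shows "weight_part \<omega> (\<omega> $ i * real d) f = restrict_terms (\<lambda>\<nu>. keys \<nu> \<subseteq> {j. \<omega> $ j = \<omega> $ i}) f"
    and "f \<in> J \<Longrightarrow> weight_part \<omega> (\<omega> $ i * real d) f \<in> initial_ideal \<omega> J"
proof -
  have *: "keys \<nu> \<subseteq> M" "total_degree \<nu> = d" if "\<nu> \<in> keys f" for \<nu>
    using that f by (auto simp: homogeneous_def polys_in_def)
  show "weight_part \<omega> (\<omega> $ i * real d) f = restrict_terms (\<lambda>\<nu>. keys \<nu> \<subseteq> {j. \<omega> $ j = \<omega> $ i}) f"
    by (rule restrict_terms_cong) (rule weight_ge_min(2)[OF *(1) min *(2)])
  show "weight_part \<omega> (\<omega> $ i * real d) f \<in> initial_ideal \<omega> J" if "f \<in> J"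
    using that weight_ge_min(1)[OF *(1) min *(2)] by (rule weight_part_in_initial_ideal)
qed

lemma monomial_in_ideal:
  fixes W :: "('n, 'k::field) mpoly set"
  assumes "is_ideal W" "single \<nu> c \<in> W" "c \<noteq> 0"
  shows "mpoly_monom \<nu> \<in> W"
proof -
  have "mpoly_monom \<nu> = single 0 (inverse c) * single \<nu> c"
    using assms(3) by (simp add: mpoly_monom_def mult_single)
  then show ?thesis using is_ideal_mult_left[OF assms(1,2)] by metis
qed

text \<open>In degree \<open>d\<close> the only monomial in x_i alone is x_i^d, so the restricted
  form is a nonzero multiple of it.\<close>

lemma not_tropical_if_pure_power:
  fixes W :: "('n, 'k::field) mpoly set"
  assumes W: "is_ideal W" and f: "homogeneous d f" "lookup f (single i d) \<noteq> 0"
    and "restrict_terms (\<lambda>\<nu>. keys \<nu> \<subseteq> {i}) f \<in> W"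
  shows "\<exists>\<nu>. mpoly_monom \<nu> \<in> W"
proof -
  have "restrict_terms (\<lambda>\<nu>. keys \<nu> \<subseteq> {i}) f = single (single i d) (lookup f (single i d))"
  proof (rule poly_mapping_eqI)
    fix \<nu>
    have "lookup f \<nu> = 0" if "keys \<nu> \<subseteq> {i}" "\<nu> \<noteq> single i d"
      using that single_if_keys_subset[of \<nu> i d] f(1) by (metis homogeneous_def in_keys_iff)
    then show "lookup (restrict_terms (\<lambda>\<nu>. keys \<nu> \<subseteq> {i}) f) \<nu> =
        lookup (single (single i d) (lookup f (single i d))) \<nu>"
      by (auto simp: lookup_restrict_terms lookup_single when_def split: if_splits)
  qed
  then show ?thesis using monomial_in_ideal[OF W, of "single i d"] assms(4) f(2) by metis
qed

text \<open>The index of the cone of the complete fan that has \<open>\<omega>\<close> in its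
  relative interior.\<close>

definition argmin_set :: "real ^ 'n::finite \<Rightarrow> 'n set"
  where "argmin_set \<omega> = {i. \<forall>j. \<omega> $ i \<le> \<omega> $ j}"

lemma argmin_set_nonempty: "argmin_set \<omega> \<noteq> {}"
proof -
  have "Min (range (($) \<omega>)) \<in> range (($) \<omega>)" by (rule Min_in) auto
  then obtain i where "\<omega> $ i = Min (range (($) \<omega>))" by (metis imageE)
  then have "\<omega> $ i \<le> \<omega> $ j" for j by simp
  then show ?thesis by (auto simp: argmin_set_def)
qed

lemma less_if_not_argmin:
  assumes "k \<in> argmin_set \<omega>" "i \<notin> argmin_set \<omega>"
  shows "\<omega> $ k < \<omega> $ i"
proof -
  obtain l where "\<omega> $ l < \<omega> $ i" using assms(2) by (auto simp: argmin_set_def not_le)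
  moreover have "\<omega> $ k \<le> \<omega> $ l" using assms(1) by (simp add: argmin_set_def)
  ultimately show ?thesis by simp
qed

lemma eq_if_argmin: "k \<in> argmin_set \<omega> \<Longrightarrow> l \<in> argmin_set \<omega> \<Longrightarrow> \<omega> $ k = \<omega> $ l"
  by (simp add: argmin_set_def order_antisym)

text \<open>For \<open>|M| = m + 1\<close> the ideal contains a form in the variables of \<open>M\<close>, and a generic change
  of these variables makes all pure powers occur in it. If only one variable of \<open>M\<close> has minimal
  weight, its power is the initial form.\<close>

lemma card_argmin_set:
  fixes I :: "('n::finite, 'k::field_char_0) mpoly set"
  assumes I: "graded_ideal I" and dim: "ideal_dim I = enat m"
    and U: "zariski_open_GL U" "U \<noteq> {}"
    and trop: "\<And>g. g \<in> U \<Longrightarrow> \<omega> \<in> tropical_variety (GL_act g ` I)"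
  shows "card (- argmin_set \<omega>) < m"
proof (rule ccontr)
  assume "\<not> ?thesis"
  then obtain B where B: "B \<subseteq> - argmin_set \<omega>" "card B = m"
    using obtain_subset_with_card_n[of m "- argmin_set \<omega>"] by auto
  obtain i where i: "i \<in> argmin_set \<omega>" using argmin_set_nonempty by blast
  \<comment> \<open>m + 1 variables, of which \<open>i\<close> alone has minimal weight. Exceeding
    the dimension, they satisfy a relation in g(I).\<close>
  define M where "M = insert i B"
  have "i \<notin> B" using B(1) i by blast
  then have card_M: "card M = Suc m" using B(2) by (simp add: M_def)
  have idI: "is_ideal I" by (rule graded_ideal_is_ideal[OF I])
  obtain S where S: "U = {g. invertible g \<and> (\<exists>p\<in>S. mpoly_eval id (\<lambda>(i, j). g $ i $ j) p \<noteq> 0)}"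
    using U(1) by (auto simp: zariski_open_GL_def)
  obtain g p where g: "invertible g" and p: "p \<in> S" "mpoly_eval id (\<lambda>(i, j). g $ i $ j) p \<noteq> 0"
    using U(2) S by auto
  have "\<not> GL_act g ` I \<inter> polys_in M \<subseteq> {0}"
    using ideal_dim_GL_act_bound[OF idI g, of M] dim card_M by auto
  then obtain f1 where f1: "f1 \<in> GL_act g ` I" "f1 \<in> polys_in M" "f1 \<noteq> 0" by blast
  obtain \<nu> where \<nu>: "\<nu> \<in> keys f1" using f1(3) by (metis ex_in_conv keys_eq_empty)
  define d where "d = total_degree \<nu>"
  define f0 where "f0 = degree_part d f1"
  have f0: "f0 \<in> GL_act g ` I" "homogeneous d f0" "f0 \<in> polys_in M"
    using graded_ideal_degree_part[OF graded_ideal_GL_act[OF I g] f1(1)] f1(2)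
    by (auto simp: f0_def homogeneous_degree_part polys_in_def keys_restrict_terms)
  have "\<nu> \<in> keys f0" using \<nu> by (simp add: f0_def keys_restrict_terms d_def)
  then have "f0 \<noteq> 0" by auto
  then obtain v where v: "mpoly_eval id v f0 \<noteq> 0" using mpoly_nonzero_eval by blast
  \<comment> \<open>A change of the variables in \<open>M\<close> that is the identity on the
    others, so forms in K[M] remain in K[M].\<close>
  define H :: "('n \<times> 'n \<Rightarrow> 'k) \<Rightarrow> 'k ^ 'n ^ 'n" where
    "H u = (\<chi> j k. if j \<in> M \<and> k \<in> M then u (j, k) else if j = k then 1 else 0)" for u
  have H_lines: "poly_on_lines (\<lambda>u. H u $ j $ k)" for j k
    by (simp add: H_def poly_on_lines_if)
  \<comment> \<open>A nonzero value of \<open>\<phi>\<close> makes \<open>H u\<close> invertible and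
    puts its product with \<open>g\<close> into \<open>U\<close>; \<open>\<psi>\<close> is the
    coefficient of x_i^d after the substitution.\<close>
  define \<phi> where "\<phi> u = mpoly_eval id (\<lambda>(i, j). (H u ** g) $ i $ j) p * det (H u)" for u
  define \<psi> where "\<psi> u = mpoly_eval id (\<lambda>k. H u $ i $ k) f0" for u
  have Hg_lines: "poly_on_lines (\<lambda>u. case ij of (i, j) \<Rightarrow> (H u ** g) $ i $ j)" for ij
    by (cases ij) (auto simp: matrix_matrix_mult_def intro!: poly_on_lines_sum poly_on_lines_mult H_lines)
  have "poly_on_lines \<phi>"
    unfolding \<phi>_def by (intro poly_on_lines_mult poly_on_lines_eval poly_on_lines_det H_lines Hg_lines)
  moreover have "poly_on_lines \<psi>"
    unfolding \<psi>_def by (intro poly_on_lines_eval H_lines)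
  moreover have "\<phi> (\<lambda>(j, k). if j = k then 1 else 0) \<noteq> 0"
  proof -
    have "H (\<lambda>(j, k). if j = k then 1 else 0) = mat 1"
      by (simp add: H_def mat_def vec_eq_iff)
    then show ?thesis using p(2) by (simp add: \<phi>_def)
  qed
  \<comment> \<open>All rows indexed by \<open>M\<close> agree with \<open>v\<close> on
    \<open>M\<close>. This matrix may be singular, which is harmless: it only shows that
    \<open>\<psi>\<close> is not identically zero.\<close>
  moreover have "\<psi> (\<lambda>(j, k). v k) \<noteq> 0"
  proof -
    have "\<psi> (\<lambda>(j, k). v k) = mpoly_eval id v f0"
      unfolding \<psi>_def by (rule ev.eval_cong_polys_in[OF f0(3)]) (auto simp: H_def M_def)
    then show ?thesis using v by simp
  qed
  ultimately obtain w where w: "\<phi> w \<noteq> 0" "\<psi> w \<noteq> 0"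
    using poly_on_lines_common_nonzero by metis
  define h where "h = H w"
  have "invertible h" using w(1) by (auto simp: \<phi>_def h_def invertible_det_nz)
  then have "invertible (h ** g)" using g by (rule invertible_mult)
  moreover have "mpoly_eval id (\<lambda>(i, j). (h ** g) $ i $ j) p \<noteq> 0"
    using w(1) by (auto simp: \<phi>_def h_def)
  ultimately have hg: "h ** g \<in> U" using S p(1) by blast
  define f where "f = GL_act h f0"
  have f: "f \<in> GL_act (h ** g) ` I" "homogeneous d f" "f \<in> polys_in M"
  proof -
    show "f \<in> GL_act (h ** g) ` I" using f0(1) by (auto simp: f_def GL_act_GL_act)
    show "homogeneous d f" unfolding f_def by (rule homogeneous_GL_act[OF f0(2)])
    show "f \<in> polys_in M"
      unfolding f_def by (rule GL_act_polys_in[OF f0(3)]) (auto simp: h_def H_def)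
  qed
  have lead: "lookup f (single i d) \<noteq> 0"
    using w(2) by (simp add: f_def lookup_GL_act_single[OF f0(2)] \<psi>_def h_def)
  have min: "\<omega> $ i \<le> \<omega> $ j" for j using i by (simp add: argmin_set_def)
  have "restrict_terms (\<lambda>\<nu>. keys \<nu> \<subseteq> {j. \<omega> $ j = \<omega> $ i}) f = restrict_terms (\<lambda>\<nu>. keys \<nu> \<subseteq> {i}) f"
  proof (rule restrict_terms_cong)
    fix \<nu> assume "\<nu> \<in> keys f"
    then have "keys \<nu> \<subseteq> M" using f(3) by (auto simp: polys_in_def)
    moreover have "\<omega> $ j \<noteq> \<omega> $ i" if "j \<in> B" for j
      using less_if_not_argmin[OF i, of j] B(1) that by force
    ultimately show "(keys \<nu> \<subseteq> {j. \<omega> $ j = \<omega> $ i}) = (keys \<nu> \<subseteq> {i})"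
      by (auto simp: M_def)
  qed
  then have "restrict_terms (\<lambda>\<nu>. keys \<nu> \<subseteq> {i}) f \<in> initial_ideal \<omega> (GL_act (h ** g) ` I)"
    using weight_part_min[OF f(2,3), of \<omega> i] min f(1) by metis
  then have "\<exists>\<nu>. mpoly_monom \<nu> \<in> initial_ideal \<omega> (GL_act (h ** g) ` I)"
    by (rule not_tropical_if_pure_power[OF is_ideal_initial_ideal f(2) lead])
  then show False using trop[OF hg] by (auto simp: tropical_variety_def)
qed

text \<open>By genericity the hypothesis may be applied after any permutation of the variables. So the
  initial ideal is homogeneous for all weights obtained from \<open>\<omega>'\<close> by permuting the coordinates in
  \<open>argmin_set \<omega>\<close>; if \<open>\<omega>'\<close> were not constant there, these gradings would cut a form down to a pure
  power.\<close>

lemma constant_on_argmin_set: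
  fixes I :: "('n::finite, 'k::field_char_0) mpoly set"
  assumes I: "graded_ideal I" "I \<noteq> {0}"
    and U: "zariski_open_GL U" "U \<noteq> {}"
    and trop: "\<And>g. g \<in> U \<Longrightarrow> \<omega> \<in> tropical_variety (GL_act g ` I)"
    and eq: "\<And>g. g \<in> U \<Longrightarrow> initial_ideal \<omega> (GL_act g ` I) = initial_ideal \<omega>' (GL_act g ` I)"
    and k: "k \<in> argmin_set \<omega>" and l: "l \<in> argmin_set \<omega>"
  shows "\<omega>' $ k = \<omega>' $ l"
proof (rule ccontr)
  assume neq: "\<omega>' $ k \<noteq> \<omega>' $ l"
  let ?A = "argmin_set \<omega>"
  have "Min ((($) \<omega>') ` ?A) \<in> (($) \<omega>') ` ?A"
    using argmin_set_nonempty by (intro Min_in) auto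
  then obtain k0 where k0: "k0 \<in> ?A" "\<omega>' $ k0 = Min ((($) \<omega>') ` ?A)" by (metis imageE)
  then have k0_min: "\<omega>' $ k0 \<le> \<omega>' $ j" if "j \<in> ?A" for j using that by simp
  obtain l0 where l0: "l0 \<in> ?A" "\<omega>' $ k0 < \<omega>' $ l0"
    using neq k0_min[OF k] k0_min[OF l] k l by (metis order_le_less)
  have idI: "is_ideal I" by (rule graded_ideal_is_ideal[OF I(1)])
  obtain f1 where f1: "f1 \<in> I" "f1 \<noteq> 0" using I(2) is_ideal_0[OF idI] by blast
  obtain \<nu> where \<nu>: "\<nu> \<in> keys f1" using f1(2) by (metis ex_in_conv keys_eq_empty)
  define d where "d = total_degree \<nu>"
  define f0 where "f0 = degree_part d f1"
  have f0: "f0 \<in> I" "homogeneous d f0"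
    using graded_ideal_degree_part[OF I(1) f1(1)] by (auto simp: f0_def homogeneous_degree_part)
  have "\<nu> \<in> keys f0" using \<nu> by (simp add: f0_def keys_restrict_terms d_def)
  then have "f0 \<noteq> 0" by auto
  then obtain v where v: "mpoly_eval id v f0 \<noteq> 0" using mpoly_nonzero_eval by blast
  obtain S where S: "U = {g. invertible g \<and> (\<exists>p\<in>S. mpoly_eval id (\<lambda>(i, j). g $ i $ j) p \<noteq> 0)}"
    using U(1) by (auto simp: zariski_open_GL_def)
  obtain g1 p where g1: "invertible g1" and p: "p \<in> S" "mpoly_eval id (\<lambda>(i, j). g1 $ i $ j) p \<noteq> 0"
    using U(2) S by auto
  define H :: "('n \<times> 'n \<Rightarrow> 'k) \<Rightarrow> 'k ^ 'n ^ 'n" where "H u = (\<chi> j k. u (j, k))" for u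
  have H_lines: "poly_on_lines (\<lambda>u. H u $ j $ k)" for j k
    by (simp add: H_def)
  define \<phi> where "\<phi> \<tau> u = mpoly_eval id (\<lambda>(i, j). (perm_matrix \<tau> ** H u) $ i $ j) p * det (H u)"
    for \<tau> :: "'n \<Rightarrow> 'n" and u
  define \<psi> where "\<psi> u = mpoly_eval id (\<lambda>k. H u $ k0 $ k) f0" for u
  have PH_lines: "poly_on_lines (\<lambda>u. case ij of (i, j) \<Rightarrow> (perm_matrix \<tau> ** H u) $ i $ j)" for \<tau> ij
    by (cases ij) (auto simp: matrix_matrix_mult_def intro!: poly_on_lines_sum poly_on_lines_mult H_lines)
  \<comment> \<open>One index set for all conditions on the matrix: \<open>None\<close> for the
    coefficient of the power of x_k0, \<open>Some \<tau>\<close> for the translate by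
    \<open>\<tau>\<close>.\<close>
  define \<Phi> where "\<Phi> x = (case x of None \<Rightarrow> \<psi> | Some \<tau> \<Rightarrow> \<phi> \<tau>)" for x
  have \<phi>: "poly_on_lines (\<phi> \<tau>)" for \<tau>
    unfolding \<phi>_def by (intro poly_on_lines_mult poly_on_lines_eval poly_on_lines_det H_lines PH_lines)
  have \<psi>: "poly_on_lines \<psi>"
    unfolding \<psi>_def by (intro poly_on_lines_eval H_lines)
  have "\<exists>u. \<forall>x\<in>insert None (Some ` {\<tau>. bij \<tau>}). \<Phi> x u \<noteq> 0"
  proof (rule poly_on_lines_finite_nonzero)
    show "finite (insert None (Some ` {\<tau> :: 'n \<Rightarrow> 'n. bij \<tau>}))" by simp
    show "poly_on_lines (\<Phi> x)" for x
      using \<phi> \<psi> by (simp add: \<Phi>_def split: option.split)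
    fix x assume "x \<in> insert None (Some ` {\<tau> :: 'n \<Rightarrow> 'n. bij \<tau>})"
    then consider "x = None" | \<tau> where "x = Some \<tau>" "bij \<tau>" by blast
    then show "\<exists>u. \<Phi> x u \<noteq> 0"
    proof cases
      case 1
      have "\<Phi> x (\<lambda>(j, k). v k) \<noteq> 0" using v by (simp add: 1 \<Phi>_def \<psi>_def H_def)
      then show ?thesis by blast
    next
      case 2
      \<comment> \<open>Chosen so that the translate by \<open>\<tau>\<close> is the given matrix
        \<open>g1\<close>, at which \<open>p\<close> is nonzero.\<close>
      define u where "u = (\<lambda>(j, k). (perm_matrix (inv_into UNIV \<tau>) ** g1) $ j $ k)"
      have Hu: "H u = perm_matrix (inv_into UNIV \<tau>) ** g1" by (simp add: H_def u_def vec_eq_iff)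
      have "perm_matrix \<tau> ** H u = g1"
        by (simp add: Hu matrix_mul_assoc perm_matrix_inv(1)[OF 2(2)])
      moreover have "invertible (H u)"
        unfolding Hu by (intro invertible_mult g1 invertible_perm_matrix bij_imp_bij_inv 2(2))
      ultimately have "\<Phi> x u \<noteq> 0"
        using p(2) by (simp add: 2 \<Phi>_def \<phi>_def invertible_det_nz)
      then show ?thesis by blast
    qed
  qed
  then obtain u where u: "\<psi> u \<noteq> 0" "\<And>\<tau>. bij \<tau> \<Longrightarrow> \<phi> \<tau> u \<noteq> 0"
    by (auto simp: \<Phi>_def)
  define g where "g = H u"
  have g: "invertible g" using u(2)[OF bij_id] by (auto simp: \<phi>_def g_def invertible_det_nz)
  have Pg: "perm_matrix \<tau> ** g \<in> U" if "bij \<tau>" for \<tau>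
    using u(2)[OF that] p(1) invertible_mult[OF invertible_perm_matrix[OF that] g] S
    by (auto simp: \<phi>_def g_def)
  define J where "J = GL_act g ` I"
  have J: "graded_ideal J" unfolding J_def by (rule graded_ideal_GL_act[OF I(1) g])
  have PJ: "GL_act (perm_matrix \<tau>) ` J = GL_act (perm_matrix \<tau> ** g) ` I" for \<tau>
    by (simp add: J_def image_image GL_act_GL_act)
  have perm: "initial_ideal (\<chi> i. \<omega> $ \<tau> i) J = initial_ideal (\<chi> i. \<omega>' $ \<tau> i) J" if \<tau>: "bij \<tau>" for \<tau>
    using eq[OF Pg[OF \<tau>]] initial_ideal_GL_act_perm[OF \<tau>, of _ _ J] unfolding PJ by blast
  have mono: "mpoly_monom \<nu> \<notin> initial_ideal \<omega> J" for \<nu>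
    using trop[OF Pg[OF bij_id]] by (simp add: tropical_variety_def perm_matrix_id J_def)
  define f where "f = GL_act g f0"
  have f: "f \<in> J" "homogeneous d f" "f \<in> polys_in UNIV" and lead: "lookup f (single k0 d) \<noteq> 0"
    using f0 u(1) by (auto simp: f_def J_def homogeneous_GL_act lookup_GL_act_single \<psi>_def g_def)
  \<comment> \<open>Sets of variables to which \<open>f\<close> can be cut down inside the initial
    ideal. The whole of \<open>?A\<close> qualifies, while \<open>{k0}\<close> would leave a
    monomial; the contradiction comes from shrinking a minimal member.\<close>
  define F where "F = {B. k0 \<in> B \<and> B \<subseteq> ?A \<and> restrict_terms (\<lambda>\<nu>. keys \<nu> \<subseteq> B) f \<in> initial_ideal \<omega> J}"
  have "?A \<in> F"
  proof -
    have "\<omega> $ k0 \<le> \<omega> $ j" for j using k0(1) by (simp add: argmin_set_def)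
    moreover have "?A = {j. \<omega> $ j = \<omega> $ k0}"
      using eq_if_argmin[OF _ k0(1)] less_if_not_argmin[OF k0(1)] by fastforce
    ultimately show ?thesis
      using weight_part_min[OF f(2,3), of \<omega> k0] f(1) k0(1) by (simp add: F_def)
  qed
  moreover have "finite F" by simp
  ultimately obtain B where B: "B \<in> F" and min: "\<And>B'. B' \<in> F \<Longrightarrow> B' \<subseteq> B \<Longrightarrow> B = B'"
    using finite_has_minimal2[of F ?A] by metis
  have "B \<noteq> {k0}"
  proof
    assume "B = {k0}"
    then have "restrict_terms (\<lambda>\<nu>. keys \<nu> \<subseteq> {k0}) f \<in> initial_ideal \<omega> J" using B by (simp add: F_def)
    from not_tropical_if_pure_power[OF is_ideal_initial_ideal f(2) lead this] show False
      using mono by blast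
  qed
  then obtain b where b: "b \<in> B" "b \<noteq> k0" using B by (auto simp: F_def)
  have bA: "b \<in> ?A" using b B by (auto simp: F_def)
  \<comment> \<open>The swap gives \<open>b\<close> the larger weight that \<open>\<omega>'\<close>
    has at \<open>l0\<close> and fixes \<open>k0\<close>. As \<open>\<omega>\<close> is constant on
    \<open>?A\<close> it does not change, so the initial ideal at \<open>\<omega>\<close> is also
    homogeneous for the permuted \<open>\<omega>'\<close>.\<close>
  define \<tau> where "\<tau> = Transposition.transpose b l0"
  have \<tau>: "bij \<tau>" by (simp add: \<tau>_def)
  have \<tau>A: "\<tau> i \<in> ?A" if "i \<in> ?A" for i
    using that bA l0(1) by (simp add: \<tau>_def Transposition.transpose_def)
  define w where "w = (\<chi> i. \<omega>' $ \<tau> i)"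
  have "(\<chi> i. \<omega> $ \<tau> i) = \<omega>"
  proof -
    have "\<omega> $ b = \<omega> $ l0" by (rule eq_if_argmin[OF bA l0(1)])
    then show ?thesis by (simp add: vec_eq_iff \<tau>_def Transposition.transpose_def)
  qed
  then have w_eq: "initial_ideal \<omega> J = initial_ideal w J"
    using perm[OF \<tau>] by (simp add: w_def)
  have \<tau>k0: "\<tau> k0 = k0"
    using b(2) l0(2) by (auto simp: \<tau>_def Transposition.transpose_def)
  have w_min: "w $ k0 \<le> w $ j" if "j \<in> B" for j
    using that B \<tau>A[of j] k0_min by (auto simp: w_def \<tau>k0 F_def)
  define q where "q = restrict_terms (\<lambda>\<nu>. keys \<nu> \<subseteq> B) f"
  have q: "homogeneous d q" "q \<in> polys_in B" "q \<in> initial_ideal w J"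
    using f(2) B w_eq
    by (auto simp: q_def homogeneous_restrict_terms polys_in_def keys_restrict_terms F_def)
  let ?B' = "B \<inter> {j. w $ j = w $ k0}"
  have "weight_part w (w $ k0 * real d) q = restrict_terms (\<lambda>\<nu>. keys \<nu> \<subseteq> {j. w $ j = w $ k0}) q"
    by (rule weight_part_min(1)[OF q(1,2) w_min])
  also have "\<dots> = restrict_terms (\<lambda>\<nu>. keys \<nu> \<subseteq> ?B') f"
    unfolding q_def restrict_terms_restrict_terms by (rule restrict_terms_cong) auto
  finally have "restrict_terms (\<lambda>\<nu>. keys \<nu> \<subseteq> ?B') f \<in> initial_ideal \<omega> J"
    using weight_part_initial_ideal[OF J q(3)] w_eq by metis
  then have "?B' \<in> F" using B by (auto simp: F_def)
  \<comment> \<open>Minimality makes \<open>w\<close> agree at \<open>b\<close> and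
    \<open>k0\<close>, that is, \<open>\<omega>'\<close> agree at \<open>l0\<close> and
    \<open>k0\<close>, against the choice of \<open>l0\<close>.\<close>
  then have "B = ?B'" by (rule min) auto
  then have "w $ b = w $ k0" using b(1) by blast
  then show False using l0(2) by (simp add: w_def \<tau>k0) (simp add: \<tau>_def)
qed

text \<open>On the segment from \<open>\<omega>\<close> to \<open>\<omega>'\<close>, consider the first point at which a coordinate outside
  \<open>argmin_set \<omega>\<close> becomes minimal; \<open>\<omega>\<close> is not constant on the set of minimal coordinates there.\<close>

lemma argmin_set_subset:
  fixes R :: "(real ^ 'n::finite) set"
  assumes R: "convex R" "\<omega> \<in> R" "\<omega>' \<in> R"
    and const: "\<And>\<xi> \<xi>' k l. \<xi> \<in> R \<Longrightarrow> \<xi>' \<in> R \<Longrightarrow> k \<in> argmin_set \<xi> \<Longrightarrow> l \<in> argmin_set \<xi> \<Longrightarrow> \<xi>' $ k = \<xi>' $ l"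
  shows "argmin_set \<omega>' \<subseteq> argmin_set \<omega>"
proof (rule ccontr)
  let ?A = "argmin_set \<omega>"
  assume "\<not> argmin_set \<omega>' \<subseteq> ?A"
  then obtain j0 where j0: "j0 \<in> argmin_set \<omega>'" "j0 \<notin> ?A" by blast
  obtain k where k: "k \<in> ?A" using argmin_set_nonempty by blast
  define D E where "D j = \<omega> $ j - \<omega> $ k" and "E j = \<omega>' $ j - \<omega>' $ k" for j
  have D: "0 < D j" if "j \<notin> ?A" for j
    using less_if_not_argmin[OF k that] by (simp add: D_def)
  have DA: "D j = 0" "E j = 0" if "j \<in> ?A" for j
    using eq_if_argmin[OF that k] const[OF R(2,3) that k] by (simp_all add: D_def E_def)
  \<comment> \<open>The coordinates that reach coordinate \<open>k\<close> on the segment;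
    \<open>s j\<close> is the parameter at which coordinate \<open>j\<close> does so, the zero of
    \<open>(1 - s) * D j + s * E j\<close>.\<close>
  define V where "V = {j. j \<notin> ?A \<and> E j \<le> 0}"
  define s where "s j = D j / (D j - E j)" for j
  have "j0 \<in> V" using j0 by (simp add: V_def E_def argmin_set_def)
  then have "Min (s ` V) \<in> s ` V" by (intro Min_in) auto
  then obtain j where j: "j \<in> V" "s j = Min (s ` V)" by (metis imageE)
  define t where "t = s j"
  have t_le: "t \<le> s i" if "i \<in> V" for i using that j by (simp add: t_def)
  have pos: "0 < D i - E i" if "i \<in> V" for i using that D[of i] by (auto simp: V_def)
  have t: "0 \<le> t" "t \<le> 1" using j(1) pos[OF j(1)] D[of j] by (auto simp: t_def s_def V_def)
  define \<xi> where "\<xi> = (1 - t) *\<^sub>R \<omega> + t *\<^sub>R \<omega>'"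
  have \<xi>: "\<xi> \<in> R" using R t unfolding convex_alt \<xi>_def by blast
  have \<xi>_diff: "\<xi> $ i - \<xi> $ k = (1 - t) * D i + t * E i" for i
    by (simp add: \<xi>_def D_def E_def algebra_simps)
  have j_eq: "\<xi> $ j = \<xi> $ k"
  proof -
    have "t * (D j - E j) = D j" using pos[OF j(1)] by (simp add: t_def s_def)
    then have "(1 - t) * D j + t * E j = 0" by (simp add: algebra_simps)
    then show ?thesis using \<xi>_diff[of j] by simp
  qed
  have k_min: "\<xi> $ k \<le> \<xi> $ i" for i
  proof -
    have "0 \<le> (1 - t) * D i + t * E i"
    proof (cases "i \<in> V")
      case True
      then have "t * (D i - E i) \<le> D i"
        using t_le[OF True] pos[OF True] by (simp add: s_def pos_le_divide_eq)
      then show ?thesis by (simp add: algebra_simps)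
    next
      case False
      then have "0 \<le> D i" "0 \<le> E i" using D[of i] DA[of i] by (cases "i \<in> ?A"; force simp: V_def)+
      then show ?thesis using t by simp
    qed
    then show ?thesis using \<xi>_diff[of i] by simp
  qed
  have "k \<in> argmin_set \<xi>" "j \<in> argmin_set \<xi>"
    using k_min j_eq by (auto simp: argmin_set_def)
  \<comment> \<open>Both \<open>k\<close> and \<open>j\<close> are minimal at \<open>\<xi>\<close>,
    so \<open>\<omega>\<close> must agree on them, although \<open>j\<close> is not minimal for
    \<open>\<omega>\<close>.\<close>
  from const[OF \<xi> R(2) this] show False using D[of j] j(1) by (simp add: D_def V_def)
qed

section \<open>The cones of \<open>W\<^sub>n\<close>\<close>

lemma W_cone_eq:
  assumes "A \<noteq> {}"
  shows "W_cone A = {\<omega>. A \<subseteq> argmin_set \<omega>}"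
proof -
  have "\<omega> $ i = (MIN k. \<omega> $ k) \<longleftrightarrow> i \<in> argmin_set \<omega>" for \<omega> :: "real ^ 'n" and i
    by (subst eq_commute, subst Min_eq_iff) (auto simp: argmin_set_def)
  then show ?thesis by (auto simp: W_cone_def)
qed

text \<open>The coordinates in \<open>A\<close> share one value, so the indicator vector of
  \<open>A\<close> and the unit vectors outside \<open>A\<close> span the cone.\<close>

lemma dim_W_cone_le:
  fixes A :: "'n::finite set"
  assumes "A \<noteq> {}"
  shows "dim (W_cone A) \<le> Suc (card (- A))"
proof -
  let ?a = "\<Sum>i\<in>A. axis i 1 :: real ^ 'n" and ?T = "(\<lambda>i. axis i 1 :: real ^ 'n) ` (- A)"
  obtain k where k: "k \<in> A" using assms by blast
  have "W_cone A \<subseteq> span (insert ?a ?T)"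
  proof
    fix \<omega> assume "\<omega> \<in> W_cone A"
    then have \<omega>: "\<omega> $ i = \<omega> $ k" if "i \<in> A" for i
      using that k by (auto simp: W_cone_def)
    have "\<omega> = (\<Sum>i\<in>UNIV. \<omega> $ i *\<^sub>R axis i 1)"
      using basis_expansion[of \<omega>] by (simp add: scalar_mult_eq_scaleR)
    also have "\<dots> = (\<Sum>i\<in>A. \<omega> $ i *\<^sub>R axis i 1) + (\<Sum>i\<in>-A. \<omega> $ i *\<^sub>R axis i 1)"
      by (subst sum.union_disjoint[symmetric]) (auto simp: Compl_partition)
    also have "(\<Sum>i\<in>A. \<omega> $ i *\<^sub>R axis i 1) = \<omega> $ k *\<^sub>R ?a"
      by (simp add: \<omega> scaleR_sum_right)
    also have "\<omega> $ k *\<^sub>R ?a + (\<Sum>i\<in>-A. \<omega> $ i *\<^sub>R axis i 1) \<in> span (insert ?a ?T)"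
      by (intro span_add span_mul span_sum span_base) auto
    finally show "\<omega> \<in> span (insert ?a ?T)" .
  qed
  then have "dim (W_cone A) \<le> card (insert ?a ?T)"
    by (rule dim_le_card) simp
  also have "\<dots> \<le> Suc (card ?T)" by (rule card_insert_le_m1) auto
  also have "card ?T \<le> card (- A)" by (rule card_image_le) simp
  finally show ?thesis by simp
qed

text \<open>The equalities on the minimal set persist on the affine hull, and the strict
  inequalities towards the other coordinates hold on an open neighbourhood of
  \<open>\<omega>\<close>; together they define points of the cone.\<close>

lemma mem_rel_interior_W_cone: "\<omega> \<in> rel_interior (W_cone (argmin_set \<omega>))"
proof -
  let ?A = "argmin_set \<omega>"
  let ?L = "{\<xi> :: real ^ 'a. \<forall>i\<in>?A. \<forall>j\<in>?A. \<xi> $ i = \<xi> $ j}"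
  let ?T = "\<Inter>i\<in>?A. \<Inter>j\<in>-?A. {\<xi> :: real ^ 'a. \<xi> $ i < \<xi> $ j}"
  have W: "W_cone ?A = {\<xi>. ?A \<subseteq> argmin_set \<xi>}" by (rule W_cone_eq[OF argmin_set_nonempty])
  have "affine ?L"
    unfolding affine_def
  proof (intro ballI allI impI CollectI)
    fix x y :: "real ^ 'a" and u v :: real and i j
    assume "x \<in> ?L" "y \<in> ?L" "i \<in> ?A" "j \<in> ?A"
    then have "x $ i = x $ j" "y $ i = y $ j" by blast+
    then show "(u *\<^sub>R x + v *\<^sub>R y) $ i = (u *\<^sub>R x + v *\<^sub>R y) $ j" by simp
  qed
  moreover have "W_cone ?A \<subseteq> ?L" using eq_if_argmin unfolding W by blast
  ultimately have hull: "affine hull W_cone ?A \<subseteq> ?L" by (rule hull_minimal[rotated])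
  have "open ?T"
    by (intro open_INT ballI open_Collect_less continuous_intros) auto
  moreover have "\<omega> \<in> ?T" using less_if_not_argmin by blast
  moreover have "\<omega> \<in> W_cone ?A" by (simp add: W)
  moreover have "?T \<inter> affine hull W_cone ?A \<subseteq> W_cone ?A"
  proof
    fix \<xi> assume \<xi>: "\<xi> \<in> ?T \<inter> affine hull W_cone ?A"
    have "\<xi> $ i \<le> \<xi> $ j" if "i \<in> ?A" for i j
    proof (cases "j \<in> ?A")
      case True
      then have "\<xi> $ i = \<xi> $ j" using \<xi> hull that by blast
      then show ?thesis by simp
    next
      case False
      then have "\<xi> $ i < \<xi> $ j" using \<xi> that by blast
      then show ?thesis by simp
    qed
    then show "\<xi> \<in> W_cone ?A" unfolding W by (auto simp: argmin_set_def[of \<xi>])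
  qed
  ultimately show ?thesis unfolding mem_rel_interior by blast
qed

theorem corollary3p8:
  fixes I :: "('n::finite, 'k::{alg_closed_field, field_char_0}) mpoly set"
    and m :: nat
    and gT :: "(real ^ 'n) set set"
  assumes "graded_ideal I"
    and "I \<noteq> {0}"
    and "ideal_dim I = enat m"
    and "m > 0"
    and "is_generic_tropical_variety I gT"
  shows "\<forall>C\<in>gT. \<exists>D\<in>W_skeleton m. rel_interior C \<subseteq> rel_interior D"
proof
  fix C assume C: "C \<in> gT"
  obtain U where U: "zariski_open_GL U" "U \<noteq> {}" and gT: "\<And>g. g \<in> U \<Longrightarrow> tropical_fan (GL_act g ` I) = gT"
    using assms(5) by (auto simp: is_generic_tropical_variety_def)
  have inv: "invertible g" if "g \<in> U" for g
    using U(1) that by (auto simp: zariski_open_GL_def)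
  have graded: "graded_ideal (GL_act g ` I)" if "g \<in> U" for g
    by (rule graded_ideal_GL_act[OF assms(1) inv[OF that]])
  have fan: "C \<in> groebner_fan (GL_act g ` I)" "C \<subseteq> tropical_variety (GL_act g ` I)" if "g \<in> U" for g
    using gT[OF that] C by (auto simp: tropical_fan_def)
  obtain g where "g \<in> U" using U(2) by blast
  note convC = convex_groebner_cone[OF graded[OF this] fan(1)[OF this]]
  have trop: "\<omega> \<in> tropical_variety (GL_act g ` I)" if "\<omega> \<in> rel_interior C" "g \<in> U" for \<omega> g
    using that fan(2) rel_interior_subset by blast
  have eq: "initial_ideal \<omega> (GL_act g ` I) = initial_ideal \<omega>' (GL_act g ` I)"
    if "\<omega> \<in> rel_interior C" "\<omega>' \<in> rel_interior C" "g \<in> U" for \<omega> \<omega>' g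
    using rel_interior_groebner_cone[OF graded[OF that(3)] fan(1)[OF that(3)] that(1,2)] .
  have const: "\<omega>' $ k = \<omega>' $ l"
    if "\<omega> \<in> rel_interior C" "\<omega>' \<in> rel_interior C" "k \<in> argmin_set \<omega>" "l \<in> argmin_set \<omega>" for \<omega> \<omega>' k l
    using constant_on_argmin_set[OF assms(1,2) U trop[OF that(1)] eq[OF that(1,2)] that(3,4)] .
  have sub: "argmin_set \<omega>' \<subseteq> argmin_set \<omega>" if "\<omega> \<in> rel_interior C" "\<omega>' \<in> rel_interior C" for \<omega> \<omega>'
    using argmin_set_subset[OF convex_rel_interior[OF convC(1)] that const] .
  obtain \<omega> where \<omega>: "\<omega> \<in> rel_interior C"
    using convC rel_interior_eq_empty by blast
  \<comment> \<open>At most m - 1 coordinates are not minimal, and the cone has dimension at most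
    one more than their number.\<close>
  have "card (- argmin_set \<omega>) < m"
    by (rule card_argmin_set[OF assms(1,3) U trop[OF \<omega>]])
  then have "W_cone (argmin_set \<omega>) \<in> W_skeleton m"
    using dim_W_cone_le[OF argmin_set_nonempty, of \<omega>] argmin_set_nonempty[of \<omega>]
    by (auto simp: W_skeleton_def W_fan_def)
  moreover have "rel_interior C \<subseteq> rel_interior (W_cone (argmin_set \<omega>))"
  proof
    fix \<omega>' assume "\<omega>' \<in> rel_interior C"
    \<comment> \<open>Any two points of the relative interior may exchange their roles in
      \<open>sub\<close>, so both inclusions hold.\<close>
    then have "argmin_set \<omega>' = argmin_set \<omega>" using sub \<omega> by blast
    then show "\<omega>' \<in> rel_interior (W_cone (argmin_set \<omega>))"
      using mem_rel_interior_W_cone[of \<omega>'] by simp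
  qed
  ultimately show "\<exists>D\<in>W_skeleton m. rel_interior C \<subseteq> rel_interior D" by blast
qed

end
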